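(* Let $\lambda_{0,0}$ be an eigenvalue of multiplicity $m$ of the pulled-back Maxwell eigenvalue problem on $\mathrm{D}_0$ at $t=0$, with orthonormal eigenbasis $\boldsymbol{E}_{0,0}=\big[[\boldsymbol{E}_{0,0}]_1,\ldots,[\boldsymbol{E}_{0,0}]_m\big]$. Assume that $\mathrm{d}_t\mathbf{G}_t(\boldsymbol{x};\boldsymbol{z})$ is linear in $\boldsymbol{z}$, that $\boldsymbol{z}$ is centered, i.e. $\mathbb{E}[\boldsymbol{z}]=\boldsymbol{0}$, and that $\operatorname{Cov}[\partial\mathbf{G}_t(\boldsymbol{x};\boldsymbol{z})]$ exists. Let $(t,\boldsymbol{z})\mapsto(\boldsymbol{E}_{0,t},\boldsymbol{\lambda}_{0,t})$ be the unique local, analytic trajectory (of solutions of the eigenspace problem) for which $(\boldsymbol{E}_{0,t},\boldsymbol{\lambda}_{0,t})=(\boldsymbol{E}_{0,0},\lambda_{0,0}\boldsymbol{I})$ at $t=0$. Then $$\mathbb{E}[\boldsymbol{\lambda}_{0,t}]=\boldsymbol{\lambda}_{0,0}+\mathcal{O}(t^2),$$ $$\mathbb{E}[\boldsymbol{E}_{0,t}]=\boldsymbol{E}_{0,0}+\mathcal{O}(t^2),$$ $$\operatorname{Cov}[\boldsymbol{\lambda}_{0,t}]=t^2\operatorname{Cov}\big[\mathrm{d}_t\boldsymbol{\lambda}_{0,t}\big]+\mathcal{O}(t^3),$$ $$\operatorname{Cov}[\boldsymbol{E}_{0,t}]=t^2\operatorname{Cov}\big[\mathrm{d}_t\boldsymbol{E}_{0,t}\big]+\mathcal{O}(t^3),$$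 where $\boldsymbol{\lambda}_{0,0}=\lambda_{0,0}\boldsymbol{I}$.
   Context: **Deformation model.** Let $\mathrm{D}_0\subset\mathbb{R}^3$ be a bounded Lipschitz domain (the reference domain) with boundary $\partial\mathrm{D}_0$ and outward normal $\boldsymbol{n}_0$, let $M\in\mathbb{N}\cup\{\infty\}$, $\mathbb{U}=[-1,1]^M$, and let $(\Omega,\mathcal{F},\mathbb{P})$ be a probability space with a random variable $\boldsymbol{z}=\boldsymbol{z}(\omega)\in\mathbb{U}$. For $t\in\mathbb{R}$ let $\mathbf{G}_t:\mathrm{D}_0\to\mathbb{R}^3$, $\boldsymbol{x}\mapsto\mathbf{G}_t(\boldsymbol{x};\boldsymbol{z})$, be deformation fields with $\mathbf{G}_0(\boldsymbol{x};\boldsymbol{z})=\boldsymbol{x}=\mathbf{G}_t(\boldsymbol{x};\boldsymbol{0})$, continuously differentiable in $\boldsymbol{x}$ with spatial Jacobian $\partial\mathbf{G}_t$ smooth in $t$. The coefficients are $$\mathbf{C}_t=\frac{1}{\det(\partial\mathbf{G}_t)}\,\partial\mathbf{G}_t^\top\,\partial\mathbf{G}_t,\qquad \mathbf{A}_t=\det(\partial\mathbf{G}_t)\,\partial\mathbf{G}_t^{-1}\,\partial\mathbf{G}_t^{-\top},$$ which are random through $\boldsymbol{z}(\omega)$; in particular $\mathbf{C}_0=\mathbf{A}_0=\boldsymbol{I}$. For a differentiable function $\mathbf{B}_t$ of $t$, $\mathrm{d}_t\mathbf{B}_t=\frac{\mathrm{d}}{\mathrm{d}t}\mathbf{B}_t\big|_{t=0}$.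 $(\cdot,\cdot)_{\mathrm{D}_0}$ is the inner product of $[L^2(\mathrm{D}_0)]^3$, and $H_0(\mathrm{curl};\mathrm{D}_0)$ is the space of $L^2$ vector fields with $L^2$ curl and vanishing tangential trace. **Pulled-back Maxwell eigenvalue problem.** Find $(\lambda_{0,t},\boldsymbol{E}_{0,t})\in\mathbb{R}\times H_0(\mathrm{curl};\mathrm{D}_0)$ (depending on $\omega$) with $$\nabla\times(\mathbf{C}_t\nabla\times\boldsymbol{E}_{0,t})=\lambda_{0,t}\mathbf{A}_t\boldsymbol{E}_{0,t},\quad \nabla\cdot(\mathbf{A}_t\boldsymbol{E}_{0,t})=0\ \text{ in }\mathrm{D}_0,\quad \boldsymbol{E}_{0,t}\times\boldsymbol{n}_0=0\ \text{ on }\partial\mathrm{D}_0,\quad (\mathbf{A}_t\boldsymbol{E}_{0,t},\boldsymbol{E}_{0,t})_{\mathrm{D}_0}=1.$$ **Eigenspace problem.** For an eigenvalue of multiplicity $m$ at $t=0$ one considers $\boldsymbol{E}_{0,t}=\big[[\boldsymbol{E}_{0,t}]_1,\ldots,[\boldsymbol{E}_{0,t}]_m\big]\in[H_0(\mathrm{curl};\mathrm{D}_0)]^m$ and $\boldsymbol{\lambda}_{0,t}\in\mathbb{R}^{m\times m}$ (not necessarily diagonal for $t\ne0$) with $$\nabla\times(\mathbf{C}_t\nabla\times\boldsymbol{E}_{0,t})=\mathbf{A}_t\boldsymbol{E}_{0,t}\boldsymbol{\lambda}_{0,t},\quad \nabla\cdot(\mathbf{A}_t\boldsymbol{E}_{0,t})=0\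 \text{ in }\mathrm{D}_0,\quad \boldsymbol{E}_{0,t}\times\boldsymbol{n}_0=0\ \text{ on }\partial\mathrm{D}_0,\quad (\mathbf{A}_t\boldsymbol{E}_{0,t},\boldsymbol{E}_{0,t})_{\mathrm{D}_0}=\boldsymbol{I}$$ (operators act columnwise; the last expression is the $m\times m$ Gram matrix). **Derivative of the trajectory.** The trajectory $(\boldsymbol{E}_{0,t},\boldsymbol{\lambda}_{0,t})$ depends analytically on $(\mathbf{C}_t,\mathbf{A}_t)$, satisfies the eigenspace problem in a neighbourhood of $t=0$, and its derivative at $t=0$, $(\mathrm{d}_t\boldsymbol{E}_{0,t},\mathrm{d}_t\boldsymbol{\lambda}_{0,t})$, is the unique solution, for $i=1,\ldots,m$, of $$\nabla\times(\mathbf{C}_0\nabla\times\mathrm{d}_t[\boldsymbol{E}_{0,t}]_i)-\lambda_{0,0}\mathbf{A}_0\,\mathrm{d}_t[\boldsymbol{E}_{0,t}]_i-\sum_{j=1}^m\mathbf{A}_0[\boldsymbol{E}_{0,0}]_j[\mathrm{d}_t\boldsymbol{\lambda}_{0,t}]_{ji}=-\nabla\times\big((\mathrm{d}_t\mathbf{C}_t)\nabla\times[\boldsymbol{E}_{0,0}]_i\big)+\lambda_{0,0}(\mathrm{d}_t\mathbf{A}_t)[\boldsymbol{E}_{0,0}]_i\ \text{ in }\mathrm{D}_0,$$ $$-\nabla\cdot(\mathbf{A}_0\,\mathrm{d}_t[\boldsymbol{E}_{0,t}]_i)=\nabla\cdot\big((\mathrm{d}_t\mathbf{A}_t)[\boldsymbol{E}_{0,0}]_i\big)\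 \text{ in }\mathrm{D}_0,\qquad \mathrm{d}_t[\boldsymbol{E}_{0,t}]_i\times\boldsymbol{n}_0=0\ \text{ on }\partial\mathrm{D}_0,$$ $$-\big(\mathbf{A}_0\,\mathrm{d}_t[\boldsymbol{E}_{0,t}]_i,[\boldsymbol{E}_{0,0}]_i\big)_{\mathrm{D}_0}=\tfrac12\big((\mathrm{d}_t\mathbf{A}_t)[\boldsymbol{E}_{0,0}]_i,[\boldsymbol{E}_{0,0}]_i\big)_{\mathrm{D}_0},\qquad -\big(\mathbf{A}_0\,\mathrm{d}_t[\boldsymbol{E}_{0,t}]_i,[\boldsymbol{E}_{0,0}]_j\big)_{\mathrm{D}_0}=0\ \ (j\ne i).$$ **Statistics.** $\mathbb{E}[\boldsymbol{u}](\boldsymbol{x})=\int_\Omega\boldsymbol{u}(\boldsymbol{x})\,\mathrm{d}\mathbb{P}$ and $\operatorname{Cov}[\boldsymbol{u}](\boldsymbol{x},\boldsymbol{y})=\int_\Omega\big(\boldsymbol{u}(\boldsymbol{x})-\mathbb{E}[\boldsymbol{u}](\boldsymbol{x})\big)\otimes\big(\boldsymbol{u}(\boldsymbol{y})-\mathbb{E}[\boldsymbol{u}](\boldsymbol{y})\big)\,\mathrm{d}\mathbb{P}$ (no spatial arguments for $\boldsymbol{\lambda}_{0,t}$). Landau symbols refer to $t\to0$.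
   Formalization: Smoothness of the Jacobian in t is taken with t-derivatives bounded uniformly in x and z near t=0, and for M=∞ linearity in z includes continuity of the Jacobian of d_tG in z (product topology, uniformly in x); without these the mean expansion can fail. *)

theory Defs
  imports "HOL-Probability.Probability" "HOL-Library.Landau_Symbols" "HOL-Library.Extended_Nat"
begin

section \<open>Domains\<close>

text \<open>Near every boundary point the domain is, up to a rigid motion, the set above the graph of a
  Lipschitz function.\<close>

definition lipschitz_domain :: "(real^3) set \<Rightarrow> bool" where
  "lipschitz_domain D \<longleftrightarrow> open D \<and> connected D \<and> D \<noteq> {} \<and>
     (\<forall>p\<in>frontier D. \<exists>(R :: real^3 \<Rightarrow> real^3) (g :: real \<times> real \<Rightarrow> real) L V.
        orthogonal_transformation R \<and> L-lipschitz_on UNIV g \<and> open V \<and> p \<in> V \<and>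
        D \<inter> V = {x \<in> V. g (R x $ 1, R x $ 2) < R x $ 3})"


section \<open>Differential operators and function spaces\<close>

text \<open>Elements of Lebesgue and Sobolev spaces are represented by functions on the whole space,
  of which only the values almost everywhere in \<open>D\<close> matter.\<close>

definition C1_field :: "('a::real_normed_vector \<Rightarrow> 'b::real_normed_vector) \<Rightarrow> bool" where
  "C1_field f \<longleftrightarrow> (\<forall>x. f differentiable at x) \<and>
     (\<forall>v. continuous_on UNIV (\<lambda>x. frechet_derivative f (at x) v))"

definition test_field :: "'a::real_normed_vector set \<Rightarrow> ('a \<Rightarrow> 'b::real_normed_vector) \<Rightarrow> bool" where
  "test_field D f \<longleftrightarrow> C1_field f \<and> (\<exists>K. compact K \<and> K \<subseteq> D \<and> (\<forall>x. x \<notin> K \<longrightarrow> f x = 0))"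

definition curl :: "(real^3 \<Rightarrow> real^3) \<Rightarrow> real^3 \<Rightarrow> real^3" where
  "curl f x = (let J = jacobian f (at x) in vector [J$3$2 - J$2$3, J$1$3 - J$3$1, J$2$1 - J$1$2])"

definition grad :: "(real^3 \<Rightarrow> real) \<Rightarrow> real^3 \<Rightarrow> real^3" where
  "grad f x = (\<chi> j. frechet_derivative f (at x) (axis j 1))"

definition sq_integrable :: "'a measure \<Rightarrow> ('a \<Rightarrow> 'b::euclidean_space) \<Rightarrow> bool" where
  "sq_integrable \<mu> u \<longleftrightarrow> u \<in> borel_measurable \<mu> \<and> integrable \<mu> (\<lambda>x. (norm (u x))\<^sup>2)"

definition L2_inner :: "(real^3) set \<Rightarrow> (real^3 \<Rightarrow> real^3) \<Rightarrow> (real^3 \<Rightarrow> real^3) \<Rightarrow> real" where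
  "L2_inner D u v = integral\<^sup>L (lebesgue_on D) (\<lambda>x. u x \<bullet> v x)"

definition has_weak_curl :: "(real^3) set \<Rightarrow> (real^3 \<Rightarrow> real^3) \<Rightarrow> (real^3 \<Rightarrow> real^3) \<Rightarrow> bool" where
  "has_weak_curl D u v \<longleftrightarrow> sq_integrable (lebesgue_on D) u \<and> sq_integrable (lebesgue_on D) v \<and>
     (\<forall>f. test_field D f \<longrightarrow> L2_inner D v f = L2_inner D u (curl f))"

text \<open>The weak curl is unique up to null sets, and everything below is insensitive to the chosen
  representative.\<close>

definition wcurl :: "(real^3) set \<Rightarrow> (real^3 \<Rightarrow> real^3) \<Rightarrow> real^3 \<Rightarrow> real^3" where
  "wcurl D u = (SOME v. has_weak_curl D u v)"

definition weak_div_free :: "(real^3) set \<Rightarrow> (real^3 \<Rightarrow> real^3) \<Rightarrow> bool" where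
  "weak_div_free D u \<longleftrightarrow> sq_integrable (lebesgue_on D) u \<and>
     (\<forall>f. test_field D f \<longrightarrow> L2_inner D u (grad f) = 0)"

definition Hcurl :: "(real^3) set \<Rightarrow> (real^3 \<Rightarrow> real^3) set" where
  "Hcurl D = {u. \<exists>v. has_weak_curl D u v}"

definition Hcurl_norm :: "(real^3) set \<Rightarrow> (real^3 \<Rightarrow> real^3) \<Rightarrow> real" where
  "Hcurl_norm D u = sqrt (L2_inner D u u + L2_inner D (wcurl D u) (wcurl D u))"

text \<open>The tangential trace \<open>u \<times> n\<close> as a functional on boundary values of \<open>C\<^sup>1\<close> fields: for
  smooth \<open>u\<close>, Green's formula equates the right-hand side, up to sign, with the boundary integral
  of \<open>(u \<times> n) \<bullet> f\<close>.\<close>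

definition tangential_trace :: "(real^3) set \<Rightarrow> (real^3 \<Rightarrow> real^3) \<Rightarrow> (real^3 \<Rightarrow> real^3) \<Rightarrow> real" where
  "tangential_trace D u f = L2_inner D (wcurl D u) f - L2_inner D u (curl f)"

definition Hcurl0 :: "(real^3) set \<Rightarrow> (real^3 \<Rightarrow> real^3) set" where
  "Hcurl0 D = {u \<in> Hcurl D. \<forall>f. C1_field f \<longrightarrow> tangential_trace D u f = 0}"


section \<open>The tensor product of \<open>H(curl)\<close> with itself\<close>

text \<open>Kernels \<open>K(x,y)\<close> that are square integrable together with the curl in \<open>x\<close> (acting on the
  columns), the curl in \<open>y\<close> (acting on the rows), and the mixed curl.\<close>

definition sq_integrable2 :: "(real^3) set \<Rightarrow> (real^3 \<Rightarrow> real^3 \<Rightarrow> real^3^3) \<Rightarrow> bool" where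
  "sq_integrable2 D K \<longleftrightarrow> sq_integrable (lebesgue_on D \<Otimes>\<^sub>M lebesgue_on D) (\<lambda>(x, y). K x y)"

definition has_curl_x where
  "has_curl_x D K S \<longleftrightarrow> sq_integrable2 D K \<and> sq_integrable2 D S \<and>
     (AE y in lebesgue_on D. \<forall>b.
        has_weak_curl D (\<lambda>x. column b (K x y)) (\<lambda>x. column b (S x y)))"

definition has_curl_y where
  "has_curl_y D K S \<longleftrightarrow> sq_integrable2 D K \<and> sq_integrable2 D S \<and>
     (AE x in lebesgue_on D. \<forall>a.
        has_weak_curl D (\<lambda>y. row a (K x y)) (\<lambda>y. row a (S x y)))"

definition curl_x where "curl_x D K = (SOME S. has_curl_x D K S)"

definition curl_y where "curl_y D K = (SOME S. has_curl_y D K S)"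

definition Hcurl2 :: "(real^3) set \<Rightarrow> (real^3 \<Rightarrow> real^3 \<Rightarrow> real^3^3) set" where
  "Hcurl2 D = {K. (\<exists>S. has_curl_x D K S) \<and> (\<exists>S. has_curl_y D K S) \<and>
                  (\<exists>S. has_curl_x D (curl_y D K) S)}"

definition L2_sq2 :: "(real^3) set \<Rightarrow> (real^3 \<Rightarrow> real^3 \<Rightarrow> real^3^3) \<Rightarrow> real" where
  "L2_sq2 D K = integral\<^sup>L (lebesgue_on D \<Otimes>\<^sub>M lebesgue_on D) (\<lambda>(x, y). (norm (K x y))\<^sup>2)"

definition Hcurl2_norm :: "(real^3) set \<Rightarrow> (real^3 \<Rightarrow> real^3 \<Rightarrow> real^3^3) \<Rightarrow> real" where
  "Hcurl2_norm D K = sqrt (L2_sq2 D K + L2_sq2 D (curl_x D K) + L2_sq2 D (curl_y D K)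
                            + L2_sq2 D (curl_x D (curl_y D K)))"


section \<open>Parameters and deformation fields\<close>

text \<open>The parameter set \<open>[-1,1]\<^sup>M\<close>; for finite \<open>M\<close> the sequences are padded by zeros.\<close>

definition cube :: "enat \<Rightarrow> (nat \<Rightarrow> real) set" where
  "cube M = {z. \<forall>i. (enat i < M \<longrightarrow> \<bar>z i\<bar> \<le> 1) \<and> (\<not> enat i < M \<longrightarrow> z i = 0)}"

definition linear_on_cube :: "enat \<Rightarrow> ((nat \<Rightarrow> real) \<Rightarrow> 'b::real_vector) \<Rightarrow> bool" where
  "linear_on_cube M f \<longleftrightarrow> (\<forall>w\<in>cube M. \<forall>z\<in>cube M. \<forall>a b.
     (\<lambda>i. a * w i + b * z i) \<in> cube M \<longrightarrow> f (\<lambda>i. a * w i + b * z i) = a *\<^sub>R f w + b *\<^sub>R f z)"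

text \<open>A field \<open>V(x;z)\<close> that is linear in \<open>z\<close>. With infinitely many parameters, linearity is
  understood to include continuity of the Jacobian in \<open>z\<close> (product topology on the cube, uniformly
  in \<open>x\<close>), as for a convergent series \<open>V(x;z) = \<Sum>\<^sub>i z\<^sub>i V\<^sub>i(x)\<close>; a merely algebraically
  linear functional of \<open>z\<close> need not have mean zero when \<open>z\<close> has. For finite \<open>M\<close> continuity
  is not assumed.\<close>

definition linear_param_field ::
    "(real^3) set \<Rightarrow> enat \<Rightarrow> ((nat \<Rightarrow> real) \<Rightarrow> real^3 \<Rightarrow> real^3) \<Rightarrow> bool" where
  "linear_param_field D M V \<longleftrightarrow> (\<forall>x\<in>D. linear_on_cube M (\<lambda>z. V z x)) \<and>
     (M = \<infinity> \<longrightarrow> (\<forall>z\<in>cube M. uniform_limit D (\<lambda>w x. jacobian (V w) (at x))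
                              (\<lambda>x. jacobian (V z) (at x)) (at z within cube M)))"

text \<open>Smoothness in \<open>t\<close> of the Jacobian, uniformly in \<open>(x,z)\<close>: all \<open>t\<close>-derivatives exist and are
  bounded on \<open>D \<times> [-1,1]\<^sup>M\<close> for \<open>t\<close> near \<open>0\<close>.\<close>

definition smooth_in_t ::
    "(real^3) set \<Rightarrow> enat \<Rightarrow> (real \<Rightarrow> (nat \<Rightarrow> real) \<Rightarrow> real^3 \<Rightarrow> real^3^3) \<Rightarrow> bool" where
  "smooth_in_t D M J \<longleftrightarrow> (\<exists>J'. J' 0 = J \<and>
     (\<forall>n t. \<forall>z\<in>cube M. \<forall>x\<in>D.
        ((\<lambda>s. J' n s z x) has_vector_derivative J' (Suc n) t z x) (at t)) \<and>
     (\<forall>n. \<exists>e>0. \<exists>B. \<forall>t z x. \<bar>t\<bar> < e \<longrightarrow> z \<in> cube M \<longrightarrow> x \<in> D \<longrightarrow> norm (J' n t z x) \<le> B))"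

definition deformation ::
    "(real^3) set \<Rightarrow> enat \<Rightarrow> (real \<Rightarrow> (nat \<Rightarrow> real) \<Rightarrow> real^3 \<Rightarrow> real^3) \<Rightarrow> bool" where
  "deformation D M G \<longleftrightarrow>
     (\<forall>z\<in>cube M. \<forall>x\<in>D. G 0 z x = x) \<and>
     (\<forall>t. \<forall>x\<in>D. G t (\<lambda>_. 0) x = x) \<and>
     (\<forall>t. \<forall>z\<in>cube M. (\<forall>x\<in>D. G t z differentiable at x) \<and>
                      continuous_on D (\<lambda>x. jacobian (G t z) (at x))) \<and>
     smooth_in_t D M (\<lambda>t z x. jacobian (G t z) (at x))"

definition C_of :: "real^3^3 \<Rightarrow> real^3^3" where
  "C_of J = (1 / det J) *\<^sub>R (transpose J ** J)"

definition A_of :: "real^3^3 \<Rightarrow> real^3^3" where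
  "A_of J = det J *\<^sub>R (matrix_inv J ** transpose (matrix_inv J))"

text \<open>The pair \<open>(C\<^sub>t, A\<^sub>t)\<close>.\<close>

definition coeffs ::
    "(real \<Rightarrow> (nat \<Rightarrow> real) \<Rightarrow> real^3 \<Rightarrow> real^3) \<Rightarrow> real \<Rightarrow> (nat \<Rightarrow> real) \<Rightarrow>
     real^3 \<Rightarrow> (real^3^3) \<times> (real^3^3)" where
  "coeffs G t z x = (let J = jacobian (G t z) (at x) in (C_of J, A_of J))"


section \<open>The Maxwell eigenvalue problem\<close>

definition maxwell_eigenspace ::
    "(real^3) set \<Rightarrow> (real^3 \<Rightarrow> (real^3^3) \<times> (real^3^3)) \<Rightarrow> real \<Rightarrow> (real^3 \<Rightarrow> real^3) set" where
  "maxwell_eigenspace D c l = {u \<in> Hcurl0 D.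
     has_weak_curl D (\<lambda>x. fst (c x) *v wcurl D u x) (\<lambda>x. l *\<^sub>R (snd (c x) *v u x)) \<and>
     weak_div_free D (\<lambda>x. snd (c x) *v u x)}"

text \<open>\<open>E\<close> is a \<open>3 \<times> m\<close> matrix field whose columns form an orthonormal basis of the
  eigenspace; in particular the multiplicity of the eigenvalue is \<open>m\<close>.\<close>

definition orthonormal_eigenbasis ::
    "(real^3) set \<Rightarrow> (real^3 \<Rightarrow> (real^3^3) \<times> (real^3^3)) \<Rightarrow> real \<Rightarrow> (real^3 \<Rightarrow> real^'m^3) \<Rightarrow> bool" where
  "orthonormal_eigenbasis D c l E \<longleftrightarrow>
     (\<forall>i. (\<lambda>x. column i (E x)) \<in> maxwell_eigenspace D c l) \<and>
     (\<forall>i j. L2_inner D (\<lambda>x. snd (c x) *v column i (E x)) (\<lambda>x. column j (E x))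
              = (if i = j then 1 else 0)) \<and>
     (\<forall>u\<in>maxwell_eigenspace D c l. \<exists>a. AE x in lebesgue_on D. u x = E x *v a)"

definition eigenspace_problem ::
    "(real^3) set \<Rightarrow> (real^3 \<Rightarrow> (real^3^3) \<times> (real^3^3)) \<Rightarrow> (real^3 \<Rightarrow> real^'m^3) \<Rightarrow> real^'m^'m \<Rightarrow> bool"
  where
  "eigenspace_problem D c E L \<longleftrightarrow>
     (\<forall>i. (\<lambda>x. column i (E x)) \<in> Hcurl0 D \<and>
          has_weak_curl D (\<lambda>x. fst (c x) *v wcurl D (\<lambda>y. column i (E y)) x)
                          (\<lambda>x. column i (snd (c x) ** E x ** L)) \<and>
          weak_div_free D (\<lambda>x. column i (snd (c x) ** E x))) \<and>
     (\<forall>i j. L2_inner D (\<lambda>x. snd (c x) *v column i (E x)) (\<lambda>x. column j (E x))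
              = (if i = j then 1 else 0))"


section \<open>Analytic dependence on the coefficients\<close>

definition coeff_perturbations :: "(real^3) set \<Rightarrow> (real^3 \<Rightarrow> (real^3^3) \<times> (real^3^3)) set" where
  "coeff_perturbations D = {h. continuous_on D h \<and> bounded (h ` D) \<and>
     (\<forall>x\<in>D. transpose (fst (h x)) = fst (h x) \<and> transpose (snd (h x)) = snd (h x))}"

definition sup_norm :: "'a set \<Rightarrow> ('a \<Rightarrow> 'b::real_normed_vector) \<Rightarrow> real" where
  "sup_norm D h = (SUP x\<in>D. norm (h x))"

definition identity_coeffs :: "real^3 \<Rightarrow> (real^3^3) \<times> (real^3^3)" where
  "identity_coeffs x = (mat 1, mat 1)"

text \<open>Analyticity at the coefficients \<open>(I,I)\<close> of a map \<open>(F,L)\<close> from symmetric continuous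
  coefficient pairs (sup norm) to \<open>[H\<^sub>0(curl)]\<^sup>m \<times> \<real>\<^sup>m\<^sup>\<times>\<^sup>m\<close>: near \<open>(I,I)\<close> it is a
  power series \<open>\<Sum>\<^sub>k P\<^sub>k(h,\<dots>,h)\<close> with \<open>k\<close>-linear \<open>P\<^sub>k\<close> whose norms are \<open>O(r\<^sup>-\<^sup>k)\<close>. The
  arguments of \<open>P\<^sub>k\<close> are collected in a list of length \<open>k\<close>; \<open>PF\<close> and \<open>PL\<close> are its two
  components.\<close>

definition analytic_at_identity ::
    "(real^3) set \<Rightarrow> ((real^3 \<Rightarrow> (real^3^3) \<times> (real^3^3)) \<Rightarrow> real^3 \<Rightarrow> real^'m^3) \<Rightarrow>
     ((real^3 \<Rightarrow> (real^3^3) \<times> (real^3^3)) \<Rightarrow> real^'m^'m) \<Rightarrow> bool" where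
  "analytic_at_identity D F L \<longleftrightarrow> (\<exists>r>0. \<exists>K PF PL.
     (\<forall>hs\<in>lists (coeff_perturbations D).
        (\<forall>i. (\<lambda>x. column i (PF hs x)) \<in> Hcurl0 D \<and>
             Hcurl_norm D (\<lambda>x. column i (PF hs x)) \<le> K * (\<Prod>h\<leftarrow>hs. sup_norm D h / r)) \<and>
        norm (PL hs) \<le> K * (\<Prod>h\<leftarrow>hs. sup_norm D h / r)) \<and>
     (\<forall>xs\<in>lists (coeff_perturbations D). \<forall>ys\<in>lists (coeff_perturbations D).
      \<forall>g\<in>coeff_perturbations D. \<forall>h\<in>coeff_perturbations D. \<forall>a b.
        (AE x in lebesgue_on D. PF (xs @ (\<lambda>x. a *\<^sub>R g x + b *\<^sub>R h x) # ys) x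
            = a *\<^sub>R PF (xs @ g # ys) x + b *\<^sub>R PF (xs @ h # ys) x) \<and>
        PL (xs @ (\<lambda>x. a *\<^sub>R g x + b *\<^sub>R h x) # ys)
            = a *\<^sub>R PL (xs @ g # ys) + b *\<^sub>R PL (xs @ h # ys)) \<and>
     (\<forall>h\<in>coeff_perturbations D. sup_norm D h < r \<longrightarrow>
        (\<forall>i. (\<lambda>x. column i (F (\<lambda>y. identity_coeffs y + h y) x)) \<in> Hcurl0 D \<and>
             (\<lambda>N. Hcurl_norm D (\<lambda>x. column i (F (\<lambda>y. identity_coeffs y + h y) x
                                              - (\<Sum>k<N. PF (replicate k h) x)))) \<longlonglongrightarrow> 0) \<and>
        (\<lambda>k. PL (replicate k h)) sums L (\<lambda>y. identity_coeffs y + h y)))"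

text \<open>A local analytic trajectory of solutions of the eigenspace problem that starts in
  \<open>(E\<^sub>0, l I)\<close>; local means: for all \<open>t\<close> near \<open>0\<close>, uniformly in the parameter \<open>z\<close>.
  For \<open>m > 1\<close> the eigenspace problem alone determines \<open>E\<close> only up to a \<open>t\<close>-dependent
  rotation; no particular normalisation is fixed here, only that it depends analytically on
  the coefficients.\<close>

definition analytic_trajectory ::
    "(real^3) set \<Rightarrow> enat \<Rightarrow> (real \<Rightarrow> (nat \<Rightarrow> real) \<Rightarrow> real^3 \<Rightarrow> real^3) \<Rightarrow>
     (real^3 \<Rightarrow> real^'m^3) \<Rightarrow> real \<Rightarrow>
     (real \<Rightarrow> (nat \<Rightarrow> real) \<Rightarrow> real^3 \<Rightarrow> real^'m^3) \<Rightarrow> (real \<Rightarrow> (nat \<Rightarrow> real) \<Rightarrow> real^'m^'m) \<Rightarrow> bool"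
  where
  "analytic_trajectory D M G E0 l E L \<longleftrightarrow>
     (\<forall>\<^sub>F t in nhds 0. \<forall>z\<in>cube M. eigenspace_problem D (coeffs G t z) (E t z) (L t z)) \<and>
     (\<exists>F \<Lambda>. analytic_at_identity D F \<Lambda> \<and>
        (\<forall>\<^sub>F t in nhds 0. \<forall>z\<in>cube M.
           (AE x in lebesgue_on D. E t z x = F (coeffs G t z) x) \<and> L t z = \<Lambda> (coeffs G t z))) \<and>
     (\<forall>z\<in>cube M. (AE x in lebesgue_on D. E 0 z x = E0 x) \<and> L 0 z = l *\<^sub>R mat 1)"

definition has_Hcurl_derivative_at_0 ::
    "(real^3) set \<Rightarrow> (real \<Rightarrow> real^3 \<Rightarrow> real^'m^3) \<Rightarrow> (real^3 \<Rightarrow> real^'m^3) \<Rightarrow> bool" where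
  "has_Hcurl_derivative_at_0 D E E' \<longleftrightarrow>
     (\<forall>i. (\<lambda>x. column i (E' x)) \<in> Hcurl D \<and>
          ((\<lambda>t. Hcurl_norm D (\<lambda>x. column i ((E t x - E 0 x) /\<^sub>R t - E' x))) \<longlongrightarrow> 0) (at 0))"


section \<open>Statistics\<close>

text \<open>Random elements of \<open>[H(curl)]\<^sup>m\<close>, represented by jointly measurable fields, so that the
  pointwise expectation is meaningful.\<close>

definition random_Hcurl_field ::
    "'w measure \<Rightarrow> (real^3) set \<Rightarrow> ('w \<Rightarrow> real^3 \<Rightarrow> real^'m^3) \<Rightarrow> bool" where
  "random_Hcurl_field P D u \<longleftrightarrow>
     (\<lambda>(w, x). u w x) \<in> borel_measurable (P \<Otimes>\<^sub>M lebesgue_on D) \<and>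
     (\<exists>v :: 'w \<Rightarrow> real^3 \<Rightarrow> real^'m^3. (\<lambda>(w, x). v w x) \<in> borel_measurable (P \<Otimes>\<^sub>M lebesgue_on D) \<and>
        (\<forall>w\<in>space P. \<forall>i. has_weak_curl D (\<lambda>x. column i (u w x)) (\<lambda>x. column i (v w x))))"

definition tensor :: "real^'b^'a \<Rightarrow> real^'d^'c \<Rightarrow> real^'d^'c^'b^'a" where
  "tensor X Y = (\<chi> a b c d. X $ a $ b * Y $ c $ d)"

definition Mean :: "'w measure \<Rightarrow> ('w \<Rightarrow> real^'b^'a) \<Rightarrow> real^'b^'a" where
  "Mean P X = integral\<^sup>L P X"

definition Cov :: "'w measure \<Rightarrow> ('w \<Rightarrow> real^'b^'a) \<Rightarrow> ('w \<Rightarrow> real^'d^'c) \<Rightarrow> real^'d^'c^'b^'a" where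
  "Cov P X Y = integral\<^sup>L P (\<lambda>w. tensor (X w - Mean P X) (Y w - Mean P Y))"

definition Cov_exists :: "'w measure \<Rightarrow> ('w \<Rightarrow> real^'b^'a) \<Rightarrow> ('w \<Rightarrow> real^'d^'c) \<Rightarrow> bool" where
  "Cov_exists P X Y \<longleftrightarrow> integrable P X \<and> integrable P Y \<and>
     integrable P (\<lambda>w. tensor (X w - Mean P X) (Y w - Mean P Y))"

definition field_Cov_exists ::
    "'w measure \<Rightarrow> (real^3) set \<Rightarrow> ('w \<Rightarrow> real^3 \<Rightarrow> real^'b^'a) \<Rightarrow> bool" where
  "field_Cov_exists P D u \<longleftrightarrow> (AE (x, y) in lebesgue_on D \<Otimes>\<^sub>M lebesgue_on D.
     Cov_exists P (\<lambda>w. u w x) (\<lambda>w. u w y))"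

definition field_Cov ::
    "'w measure \<Rightarrow> ('w \<Rightarrow> real^3 \<Rightarrow> real^'b^'a) \<Rightarrow> real^3 \<Rightarrow> real^3 \<Rightarrow> real^'b^'a^'b^'a" where
  "field_Cov P u x y = Cov P (\<lambda>w. u w x) (\<lambda>w. u w y)"

text \<open>The \<open>3 \<times> 3\<close> block of a covariance that relates the columns \<open>i\<close> and \<open>j\<close>.\<close>

definition block :: "'m \<Rightarrow> 'm \<Rightarrow> real^'m^3^'m^3 \<Rightarrow> real^3^3" where
  "block i j K = (\<chi> a b. K $ a $ i $ b $ j)"

end

theory Submission
  imports Defs
begin

text \<open>
  The eigenpair is an analytic function of the coefficients \<open>(C, A)\<close>, and the coefficients of a deformation
  are \<open>(I, I) + t h(z) + O(t\<^sup>2)\<close>, uniformly in the point \<open>x\<close> and the parameter \<open>z\<close>. Here \<open>h(z)\<close> is the image of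
  the Jacobian of the deformation velocity under a fixed linear map, the derivative of \<open>J \<mapsto> (C, A)\<close> at the
  identity (\<open>deformation_coeffs_expansion\<close>). Truncating the power series therefore gives
  \<open>E\<^sub>t = E\<^sub>0 + t dE + R\<^sub>t\<close> and \<open>\<lambda>\<^sub>t = \<lambda>\<^sub>0 + t d\<lambda> + r\<^sub>t\<close> with remainders at most \<open>K t\<^sup>2\<close> in \<open>H(curl)\<close> and in the matrix
  norm, for one constant \<open>K\<close> and all parameters; the derivatives \<open>dE\<close> and \<open>d\<lambda>\<close> are bounded linear functions of
  \<open>h(z)\<close> (\<open>trajectory_first_order\<close>).

  As \<open>h\<close> is linear in \<open>z\<close> and \<open>z\<close> is centered, the derivatives have mean zero. With finitely many parameters this
  is linearity of the expectation. With infinitely many, \<open>z\<close> is truncated to finitely many coordinates, and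
  bounded convergence removes the truncation (\<open>mean_zero_if_linear_on_cube\<close>). For the field \<open>dE\<close>, whose mean is
  taken pointwise, the argument applies to its pairings with test fields, and the fundamental lemma of the
  calculus of variations concludes (\<open>mean_zero_field\<close>).

  Hence the mean of \<open>E\<^sub>t - E\<^sub>0\<close> is the mean of \<open>R\<^sub>t\<close>, whose norm is at most \<open>K t\<^sup>2\<close>, because means commute with weak
  curls and do not increase norms (\<open>mean_Hcurl\<close>). For the covariance, write the centered field as \<open>t \<beta> + \<rho>\<close>, where
  \<open>\<beta>\<close> and \<open>\<rho>\<close> are the centered \<open>dE\<close> and \<open>R\<^sub>t\<close>. Then the covariances of \<open>E\<^sub>t\<close> and \<open>t dE\<close> differ by the mean of
  \<open>\<rho>(x) \<otimes> (t \<beta> + \<rho>)(y) + t \<beta>(x) \<otimes> \<rho>(y)\<close>. The curls of such a kernel in \<open>x\<close> and in \<open>y\<close> act on the two factors, so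
  its norm in the tensor product of \<open>H(curl)\<close> with itself is bounded by products of norms, which are
  \<open>O(t\<^sup>3)\<close> (\<open>correlation_kernel_sum_Hcurl2\<close>, \<open>field_Cov_expansion\<close>). The same computation with matrices in place of
  fields handles the eigenvalues (\<open>Cov_expansion\<close>).
\<close>

section \<open>First-order expansion of the coefficients\<close>

text \<open>The derivative of \<open>C_of\<close> at the identity matrix.\<close>

definition coeff_lin :: "real^3^3 \<Rightarrow> real^3^3" where
  "coeff_lin H = H + transpose H - trace H *\<^sub>R mat 1"

lemma matrix_add_rdistrib: "(A + B) ** C = A ** C + B ** (C :: real^'p^'n)" for A B :: "real^'n^'k"
  by (simp add: matrix_matrix_mult_def vec_eq_iff distrib_right sum.distrib)

lemma bounded_bilinear_matrix_mult:
  "bounded_bilinear ((**) :: real^3^3 \<Rightarrow> real^3^3 \<Rightarrow> real^3^3)"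
proof -
  have "bilinear ((**) :: real^3^3 \<Rightarrow> real^3^3 \<Rightarrow> real^3^3)"
    unfolding bilinear_def linear_iff
    by (simp add: matrix_add_ldistrib matrix_add_rdistrib matrix_scalar_ac scalar_matrix_assoc)
  then show ?thesis by (simp add: bilinear_conv_bounded_bilinear)
qed

lemma matrix_mult_norm_bound:
  obtains K where "K > 0" "\<And>(A::real^3^3) (B::real^3^3). norm (A ** B) \<le> K * (norm A * norm B)"
proof -
  obtain K where K: "K > 0" "\<And>(A::real^3^3) (B::real^3^3). norm (A ** B) \<le> norm A * norm B * K"
    using bounded_bilinear.pos_bounded[OF bounded_bilinear_matrix_mult] by auto
  have "norm (A ** B) \<le> K * (norm A * norm B)" for A B :: "real^3^3"
    using K(2)[of A B] by (simp only: mult.commute[of K])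
  then show thesis using K(1) that by simp
qed

lemma entry_le_norm: "\<bar>(H::real^3^3) $ i $ j\<bar> \<le> norm H"
  using component_le_norm_cart[of "H $ i" j] Finite_Cartesian_Product.norm_nth_le[of H i] by linarith

lemma bounded_linear_transpose3: "bounded_linear (transpose :: real^3^3 \<Rightarrow> real^3^3)"
  by (simp add: linear_conv_bounded_linear[symmetric] linear_iff transpose_def vec_eq_iff)

lemma trace_scaleR: "trace (c *\<^sub>R (H :: real^3^3)) = c * trace H"
  by (simp add: trace_def sum_distrib_left)

lemma bounded_linear_coeff_lin: "bounded_linear coeff_lin"
proof -
  have "bounded_linear (trace :: real^3^3 \<Rightarrow> real)"
    by (simp add: linear_conv_bounded_linear[symmetric] linear_iff trace_add trace_scaleR)
  then have "bounded_linear (\<lambda>H::real^3^3. H + transpose H - trace H *\<^sub>R mat 1)"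
    by (intro bounded_linear_sub bounded_linear_add bounded_linear_ident bounded_linear_transpose3
        bounded_linear_compose[OF bounded_linear_scaleR_left])
  then show ?thesis by (simp add: coeff_lin_def[abs_def])
qed

text \<open>After the linear part, the Leibniz formula leaves twelve products of two or three entries of
  \<open>H\<close>, each at most \<open>|H|\<^sup>2\<close>.\<close>

lemma det_first_order:
  fixes H :: "real^3^3"
  assumes "norm H \<le> 1"
  shows "\<bar>det (mat 1 + H) - 1 - trace H\<bar> \<le> 12 * (norm H)\<^sup>2"
proof -
  define n where "n = norm H"
  have e: "\<bar>H $ i $ j\<bar> \<le> n" for i j unfolding n_def by (rule entry_le_norm)
  have n: "0 \<le> n" "n \<le> 1" using assms by (auto simp: n_def)
  have p2: "\<bar>H $ i $ j * H $ k $ l\<bar> \<le> n\<^sup>2" for i j k l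
    unfolding abs_mult power2_eq_square by (rule mult_mono[OF e e n(1) abs_ge_zero])
  have p3: "\<bar>H $ i $ j * H $ k $ l * H $ p $ q\<bar> \<le> n\<^sup>2" for i j k l p q
    using mult_mono[OF p2[of i j k l] order_trans[OF e[of p q] n(2)] zero_le_power2 abs_ge_zero]
    unfolding abs_mult mult_1_right .
  have expand: "(1+a)*(1+e)*(1+i) + b*f*g + c*d*h - (1+a)*f*h - b*d*(1+i) - c*(1+e)*g - 1 - (a+e+i)
      = a*e + a*i + e*i - b*d - c*g - f*h + a*e*i + b*f*g + c*d*h - a*f*h - b*d*i - c*e*g"
    for a b c d e f g h i :: real by algebra
  have "det (mat 1 + H)
      = (1+H$1$1)*(1+H$2$2)*(1+H$3$3) + H$1$2*H$2$3*H$3$1 + H$1$3*H$2$1*H$3$2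
        - (1+H$1$1)*H$2$3*H$3$2 - H$1$2*H$2$1*(1+H$3$3) - H$1$3*(1+H$2$2)*H$3$1"
    unfolding det_3 by (simp add: mat_def)
  then have eq: "det (mat 1 + H) - 1 - trace H =
     H$1$1*H$2$2 + H$1$1*H$3$3 + H$2$2*H$3$3 - H$1$2*H$2$1 - H$1$3*H$3$1 - H$2$3*H$3$2
     + H$1$1*H$2$2*H$3$3 + H$1$2*H$2$3*H$3$1 + H$1$3*H$2$1*H$3$2
     - H$1$1*H$2$3*H$3$2 - H$1$2*H$2$1*H$3$3 - H$1$3*H$2$2*H$3$1"
    unfolding trace_def sum_3 by (simp only: expand)
  have three: "\<bar>x + y + w\<bar> \<le> 3 * m" "\<bar>- x - y - w\<bar> \<le> 3 * m"
    if "\<bar>x\<bar> \<le> m" "\<bar>y\<bar> \<le> m" "\<bar>w\<bar> \<le> m" for x y w m :: real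
    using that by linarith+
  have blocks: "\<bar>(a1 + a2 + a3 - a4 - a5 - a6) + (a7 + a8 + a9) - a10 - a11 - a12\<bar> \<le> 12 * m"
    if "\<bar>a1 + a2 + a3\<bar> \<le> 3 * m" "\<bar>- a4 - a5 - a6\<bar> \<le> 3 * m"
      "\<bar>a7 + a8 + a9\<bar> \<le> 3 * m" "\<bar>- a10 - a11 - a12\<bar> \<le> 3 * m"
    for a1 a2 a3 a4 a5 a6 a7 a8 a9 a10 a11 a12 m :: real
    using that by linarith
  show ?thesis unfolding eq n_def[symmetric]
    using blocks[OF three(1)[OF p2 p2 p2] three(2)[OF p2 p2 p2] three(1)[OF p3 p3 p3] three(2)[OF p3 p3 p3]]
    by (simp only: add.assoc add_diff_eq)
qed

lemma trace_bound: "\<bar>trace (H :: real^3^3)\<bar> \<le> 3 * norm H"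
proof -
  have "\<bar>trace H\<bar> \<le> (\<Sum>i\<in>UNIV. \<bar>H $ i $ i\<bar>)" unfolding trace_def by (rule sum_abs)
  also have "\<dots> \<le> (\<Sum>i\<in>(UNIV :: 3 set). norm H)" by (intro sum_mono entry_le_norm)
  finally show ?thesis by simp
qed

text \<open>Multiplication with \<open>d = det (I + H)\<close> removes the denominator of \<open>C\<close>. As \<open>d = 1 + tr H + q\<close> with
  \<open>q = O(|H|\<^sup>2)\<close>, the terms up to first order cancel in \<open>d (C - I - T H) = H\<^sup>T H - q I - (d - 1) T H\<close>, where
  \<open>T\<close> is \<open>coeff_lin\<close>.\<close>

lemma C_of_first_order:
  obtains \<delta> c where "0 < \<delta>" "0 < c"
    "\<And>H. norm H \<le> \<delta> \<Longrightarrow> det (mat 1 + H) \<noteq> 0 \<and>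
        norm (C_of (mat 1 + H) - mat 1 - coeff_lin H) \<le> c * (norm H)\<^sup>2"
proof -
  obtain K where K: "K > 0" "\<And>(A::real^3^3) (B::real^3^3). norm (A ** B) \<le> K * (norm A * norm B)"
    by (rule matrix_mult_norm_bound) (rule that)
  obtain b where b: "b > 0" "\<And>H. norm (coeff_lin H) \<le> norm H * b"
    using bounded_linear.pos_bounded[OF bounded_linear_coeff_lin] by blast
  obtain a where a: "a > 0" "\<And>H::real^3^3. norm (transpose H) \<le> norm H * a"
    using bounded_linear.pos_bounded[OF bounded_linear_transpose3] by blast
  define I where "I = (mat 1 :: real^3^3)"
  define c where "c = 2 * (K * a + 12 * norm I + 15 * b)"
  have "c > 0" unfolding c_def using K a b by (auto intro!: add_pos_nonneg add_nonneg_pos)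
  \<comment> \<open>The radius \<open>1/30\<close> and \<open>|d - 1| \<le> 15 |H|\<close> give \<open>d \<ge> 1/2\<close>.\<close>
  have main: "det (I + H) \<noteq> 0 \<and> norm (C_of (I + H) - I - coeff_lin H) \<le> c * (norm H)\<^sup>2"
    if H: "norm H \<le> 1/30" for H
  proof -
    define d where "d = det (I + H)"
    define q where "q = d - 1 - trace H"
    have n2: "(norm H)\<^sup>2 \<le> norm H" using H mult_right_mono[of "norm H" 1 "norm H"]
      by (simp add: power2_eq_square)
    have q: "\<bar>q\<bar> \<le> 12 * (norm H)\<^sup>2" unfolding q_def d_def I_def
      using det_first_order[of H] H by simp
    have d1: "\<bar>d - 1\<bar> \<le> 15 * norm H"
      using q trace_bound[of H] n2 unfolding q_def by linarith
    have d: "d \<ge> 1/2" using d1 H by linarith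
    have "C_of (I + H) = (1/d) *\<^sub>R (I + H + transpose H + transpose H ** H)"
      unfolding C_of_def d_def[symmetric]
      by (simp add: I_def matrix_add_ldistrib matrix_add_rdistrib transpose_mat add_ac
          linear_add[OF bounded_linear.linear[OF bounded_linear_transpose3]])
    then have "d *\<^sub>R (C_of (I + H) - I - coeff_lin H)
        = (I + H + transpose H + transpose H ** H) - d *\<^sub>R I - d *\<^sub>R coeff_lin H"
      using d by (simp add: algebra_simps)
    also have "\<dots> = transpose H ** H - q *\<^sub>R I - (d - 1) *\<^sub>R coeff_lin H"
      unfolding coeff_lin_def q_def I_def[symmetric] by (simp add: algebra_simps)
    finally have *: "d *\<^sub>R (C_of (I + H) - I - coeff_lin H)
        = transpose H ** H - q *\<^sub>R I - (d - 1) *\<^sub>R coeff_lin H" .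
    have "norm (transpose H ** H) \<le> K * a * (norm H)\<^sup>2"
    proof -
      have "norm (transpose H ** H) \<le> K * (norm (transpose H) * norm H)" by (rule K)
      also have "\<dots> \<le> K * (norm H * a * norm H)"
        using a(2) K(1) by (intro mult_left_mono mult_right_mono) auto
      finally show ?thesis by (simp add: power2_eq_square mult_ac)
    qed
    moreover have "norm (q *\<^sub>R I) \<le> 12 * norm I * (norm H)\<^sup>2"
      using mult_right_mono[OF q, of "norm I"] by (simp add: mult_ac)
    moreover have "norm ((d - 1) *\<^sub>R coeff_lin H) \<le> 15 * b * (norm H)\<^sup>2"
      using mult_mono[OF d1 b(2)[of H]] by (simp add: power2_eq_square mult_ac)
    ultimately have "norm (d *\<^sub>R (C_of (I + H) - I - coeff_lin H)) \<le> c / 2 * (norm H)\<^sup>2"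
      unfolding * c_def
      using norm_triangle_ineq4[of "transpose H ** H - q *\<^sub>R I" "(d - 1) *\<^sub>R coeff_lin H"]
        norm_triangle_ineq4[of "transpose H ** H" "q *\<^sub>R I"]
      by (simp add: algebra_simps)
    moreover have "1/2 * norm (C_of (I + H) - I - coeff_lin H)
        \<le> norm (d *\<^sub>R (C_of (I + H) - I - coeff_lin H))"
      using mult_right_mono[OF d norm_ge_zero] d by simp
    ultimately show ?thesis using d by (simp add: d_def)
  qed
  show thesis
  proof (rule that[of "1/30" c, folded I_def])
    show "c > 0" by fact
  qed (simp, rule main)
qed

lemma A_of_inverse:
  assumes "det J \<noteq> 0"
  shows "A_of J ** C_of J = mat 1" "C_of J ** A_of J = mat 1"
proof -
  let ?I = "matrix_inv J"
  have "invertible J" using assms by (simp add: invertible_det_nz)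
  then have "\<exists>A'. J ** A' = mat 1 \<and> A' ** J = mat 1" by (auto simp: invertible_def)
  then have inv: "J ** ?I = mat 1" "?I ** J = mat 1"
    unfolding matrix_inv_def by (metis (mono_tags, lifting) someI_ex)+
  have tinv: "transpose ?I ** transpose J = mat 1"
    by (metis inv(1) matrix_transpose_mul transpose_mat)
  have "(transpose ?I ** (transpose J ** J)) = J"
    by (simp add: matrix_mul_assoc tinv)
  then have "(?I ** transpose ?I) ** (transpose J ** J) = mat 1"
    by (simp add: matrix_mul_assoc[symmetric] inv)
  then show "A_of J ** C_of J = mat 1" using assms
    unfolding A_of_def C_of_def
    by (simp add: matrix_scalar_ac scalar_matrix_assoc[symmetric])
  then show "C_of J ** A_of J = mat 1" by (simp add: matrix_left_right_inverse)
qed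

text \<open>The coefficients depend on the Jacobian with derivative \<open>(T, -T)\<close> at the identity, where \<open>T\<close>
  is \<open>coeff_lin\<close>: the second component is the inverse \<open>A = C\<^sup>-\<^sup>1\<close> of the first, and
  \<open>A - I + (C - I) = A (C - I)\<^sup>2\<close>.\<close>

lemma coeffs_first_order:
  obtains \<delta> c where "0 < \<delta>" "0 < c"
    "\<And>H. norm H \<le> \<delta> \<Longrightarrow>
        norm ((C_of (mat 1 + H), A_of (mat 1 + H)) - (mat 1, mat 1) - (coeff_lin H, - coeff_lin H))
          \<le> c * (norm H)\<^sup>2"
    "continuous_on {J. norm (J - mat 1) \<le> \<delta>} C_of"
    "continuous_on {J. norm (J - mat 1) \<le> \<delta>} A_of"
proof -
  obtain K where K: "K > 0" "\<And>(A::real^3^3) (B::real^3^3). norm (A ** B) \<le> K * (norm A * norm B)"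
    by (rule matrix_mult_norm_bound) (rule that)
  obtain b where b: "b > 0" "\<And>H. norm (coeff_lin H) \<le> norm H * b"
    using bounded_linear.pos_bounded[OF bounded_linear_coeff_lin] by blast
  define I where "I = (mat 1 :: real^3^3)"
  obtain \<delta>0 c0 where 0: "0 < \<delta>0" "0 < c0"
    "\<And>H. norm H \<le> \<delta>0 \<Longrightarrow> det (I + H) \<noteq> 0 \<and>
        norm (C_of (I + H) - I - coeff_lin H) \<le> c0 * (norm H)\<^sup>2"
    by (rule C_of_first_order[folded I_def]) (rule that)
  \<comment> \<open>For this \<open>\<delta>\<close> the norm of \<open>A (C - I) = I - A\<close> is at most half that of \<open>A\<close>, which bounds \<open>A\<close> by \<open>2 |I|\<close>.\<close>
  define \<delta> where "\<delta> = min \<delta>0 (min 1 (1 / (2 * K * (c0 + b))))"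
  have \<delta>: "0 < \<delta>" "\<delta> \<le> \<delta>0" "\<delta> \<le> 1" "\<delta> * (2 * K * (c0 + b)) \<le> 1"
  proof -
    have g: "0 < 2 * K * (c0 + b)" using 0 K b by simp
    show "0 < \<delta>" "\<delta> \<le> \<delta>0" "\<delta> \<le> 1" using 0(1) g by (auto simp: \<delta>_def)
    have "\<delta> \<le> 1 / (2 * K * (c0 + b))" by (simp add: \<delta>_def)
    then show "\<delta> * (2 * K * (c0 + b)) \<le> 1" using g by (simp add: pos_le_divide_eq)
  qed
  define N where "N = norm I"
  have C: "norm (C_of (I + H) - I) \<le> (c0 + b) * norm H" if "norm H \<le> \<delta>" for H
  proof -
    have "(norm H)\<^sup>2 \<le> norm H"
      using that \<delta> mult_right_mono[of "norm H" 1 "norm H"] by (simp add: power2_eq_square)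
    then have "c0 * (norm H)\<^sup>2 \<le> c0 * norm H" using 0 by simp
    moreover have "norm (C_of (I + H) - I - coeff_lin H) \<le> c0 * (norm H)\<^sup>2"
      using 0(3)[of H] that \<delta> by auto
    ultimately show ?thesis
      using b(2)[of H] norm_triangle_sub[of "C_of (I + H) - I" "coeff_lin H"]
      by (simp add: algebra_simps)
  qed
  have Ac: "A_of (I + H) ** (C_of (I + H) - I) = I - A_of (I + H)" if "norm H \<le> \<delta>" for H
  proof -
    have "det (I + H) \<noteq> 0" using 0(3)[of H] that \<delta> by auto
    then have "A_of (I + H) ** C_of (I + H) = I" unfolding I_def by (rule A_of_inverse)
    then show ?thesis
      by (simp only: bounded_bilinear.diff_right[OF bounded_bilinear_matrix_mult] I_def matrix_mul_rid)
  qed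
  have A: "norm (A_of (I + H)) \<le> 2 * N" if "norm H \<le> \<delta>" for H
  proof -
    let ?A = "A_of (I + H)" let ?c = "C_of (I + H) - I"
    have "?A = I - ?A ** ?c" by (simp add: Ac[OF that])
    then have "norm ?A \<le> N + norm (?A ** ?c)"
      unfolding N_def by (metis norm_triangle_ineq4)
    also have "norm (?A ** ?c) \<le> norm ?A * (K * norm ?c)" using K(2)[of ?A ?c] by (simp add: mult_ac)
    also have "K * norm ?c \<le> K * ((c0 + b) * \<delta>)"
      using C[OF that] that K(1) 0 b by (intro mult_left_mono order_trans[OF C[OF that]]) auto
    also have "\<dots> \<le> 1/2" using \<delta>(4) by (simp add: mult_ac)
    finally show ?thesis by (simp add: mult_left_mono)
  qed
  have 1: "norm (A_of (I + H) - I + coeff_lin H) \<le> (K * (2 * N) * K * (c0 + b)\<^sup>2 + c0) * (norm H)\<^sup>2"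
    if "norm H \<le> \<delta>" for H
  proof -
    let ?A = "A_of (I + H)" let ?c = "C_of (I + H) - I"
    have "(?A ** ?c) ** ?c = (I - ?A) ** ?c" by (simp only: Ac[OF that])
    also have "\<dots> = I ** ?c - ?A ** ?c"
      by (rule bounded_bilinear.diff_left[OF bounded_bilinear_matrix_mult])
    also have "I ** ?c = ?c" by (simp only: I_def matrix_mul_lid)
    also have "?c - ?A ** ?c = ?A - I + ?c" by (simp add: Ac[OF that])
    finally have "?A - I + ?c = (?A ** ?c) ** ?c" by (rule sym)
    then have "norm (?A - I + ?c) \<le> K * (norm (?A ** ?c) * norm ?c)" using K(2) by simp
    also have "\<dots> \<le> K * (K * (norm ?A * norm ?c) * norm ?c)"
      using K by (intro mult_left_mono mult_right_mono) auto
    also have "\<dots> = (K * norm ?A * K) * (norm ?c)\<^sup>2" by (simp add: power2_eq_square mult_ac)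
    also have "\<dots> \<le> (K * (2 * N) * K) * ((c0 + b) * norm H)\<^sup>2"
      using K(1) A[OF that] C[OF that]
      by (intro mult_mono power_mono) (auto simp: N_def)
    finally have "norm (?A - I + ?c) \<le> K * (2 * N) * K * (c0 + b)\<^sup>2 * (norm H)\<^sup>2"
      by (simp add: power_mult_distrib mult_ac)
    moreover have "norm (C_of (I + H) - I - coeff_lin H) \<le> c0 * (norm H)\<^sup>2"
      using 0(3)[of H] that \<delta> by auto
    ultimately show ?thesis
      using norm_triangle_ineq4[of "?A - I + ?c" "?c - coeff_lin H"]
      by (simp add: algebra_simps)
  qed
  define c where "c = (K * (2 * N) * K * (c0 + b)\<^sup>2 + c0) + c0"
  have "0 \<le> K * (2 * N) * K * (c0 + b)\<^sup>2" using K(1) by (simp add: N_def)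
  then have "c > 0" unfolding c_def using 0(2) by linarith
  have 2: "norm ((C_of (I + H), A_of (I + H)) - (I, I) - (coeff_lin H, - coeff_lin H)) \<le> c * (norm H)\<^sup>2"
    if "norm H \<le> \<delta>" for H
  proof -
    have "norm (C_of (I + H) - I - coeff_lin H) \<le> c0 * (norm H)\<^sup>2"
      using 0(3)[of H] that \<delta> by auto
    then show ?thesis
      using 1[OF that] norm_Pair_le[of "C_of (I + H) - I - coeff_lin H" "A_of (I + H) - I + coeff_lin H"]
      by (simp add: c_def algebra_simps)
  qed
  let ?S = "{J. norm (J - I) \<le> \<delta>}"
  have nz: "det J \<noteq> 0" if "J \<in> ?S" for J
    using 0(3)[of "J - I"] that \<delta> by auto
  have contC: "continuous_on ?S C_of"
  proof -
    have "continuous_on ?S (\<lambda>J. (1 / det J) *\<^sub>R (transpose J ** J))"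
      using nz bounded_linear.continuous_on[OF bounded_linear_transpose3 continuous_on_id]
      unfolding det_3
      by (intro continuous_intros bounded_bilinear.continuous_on[OF bounded_bilinear_matrix_mult]) auto
    then show ?thesis by (simp add: C_of_def[abs_def])
  qed
  \<comment> \<open>Inversion is continuous because \<open>A(J') - A(J) = A(J') (C(J) - C(J')) A(J)\<close> and \<open>A\<close> is bounded.\<close>
  have contA: "continuous_on ?S A_of"
    unfolding continuous_on_iff
  proof (intro ballI allI impI)
    fix J e assume J: "J \<in> ?S" and e: "(0::real) < e"
    define m where "m = K * (2 * N) * (K * (2 * N)) + 1"
    have m: "m > 0" unfolding m_def N_def using K(1) by (intro add_nonneg_pos) auto
    obtain d where d: "d > 0" "\<And>J'. J' \<in> ?S \<Longrightarrow> dist J' J < d \<Longrightarrow> dist (C_of J') (C_of J) < e / m"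
      using contC[unfolded continuous_on_iff, rule_format, OF J, of "e / m"] e m by auto
    have "dist (A_of J') (A_of J) < e" if J': "J' \<in> ?S" and "dist J' J < d" for J'
    proof -
      have eq: "A_of J' - A_of J = A_of J' ** ((C_of J - C_of J') ** A_of J)"
      proof -
        have "A_of J' ** (C_of J ** A_of J) = A_of J'" using A_of_inverse nz[OF J] by simp
        moreover have "A_of J' ** (C_of J' ** A_of J) = A_of J"
          using A_of_inverse nz[OF J'] by (simp add: matrix_mul_assoc)
        ultimately show ?thesis
          by (simp add: bounded_bilinear.diff_left[OF bounded_bilinear_matrix_mult]
              bounded_bilinear.diff_right[OF bounded_bilinear_matrix_mult])
      qed
      have AJ: "norm (A_of J) \<le> 2 * N" "norm (A_of J') \<le> 2 * N"
        using A[of "J - I"] A[of "J' - I"] J J' by auto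
      have "norm (A_of J' - A_of J) \<le> K * (norm (A_of J') * norm ((C_of J - C_of J') ** A_of J))"
        unfolding eq by (rule K)
      also have "\<dots> \<le> K * (2 * N * (K * (norm (C_of J - C_of J') * (2 * N))))"
        using K AJ by (intro mult_left_mono mult_mono order_trans[OF K(2)]) (auto simp: N_def)
      also have "\<dots> \<le> m * norm (C_of J - C_of J')"
        by (simp add: m_def algebra_simps)
      also have "\<dots> < m * (e / m)"
        using d(2)[OF J'] that m by (intro mult_strict_left_mono) (auto simp: dist_norm norm_minus_commute)
      finally show ?thesis using m by (simp add: dist_norm)
    qed
    then show "\<exists>d>0. \<forall>x'\<in>?S. dist x' J < d \<longrightarrow> dist (A_of x') (A_of J) < e" using d(1) by blast
  qed
  show thesis by (rule that[of \<delta> c, folded I_def]) (fact \<delta> \<open>c > 0\<close> 2 contC contA)+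
qed

section \<open>The coefficients along a deformation\<close>

lemma vector_mvt_bound:
  fixes f :: "real \<Rightarrow> 'a::real_normed_vector"
  assumes der: "\<And>s. \<bar>s\<bar> \<le> \<bar>t\<bar> \<Longrightarrow> (f has_vector_derivative f' s) (at s)"
    and bound: "\<And>s. \<bar>s\<bar> \<le> \<bar>t\<bar> \<Longrightarrow> norm (f' s) \<le> B"
  shows "norm (f t - f 0) \<le> B * \<bar>t\<bar>"
proof -
  have "norm (f t - f 0) \<le> B * norm (t - 0)"
  proof (rule differentiable_bound[of "{-\<bar>t\<bar>..\<bar>t\<bar>}" f "\<lambda>s h. h *\<^sub>R f' s"])
    fix s assume "s \<in> {-\<bar>t\<bar>..\<bar>t\<bar>}"
    then have s: "\<bar>s\<bar> \<le> \<bar>t\<bar>" by auto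
    show "(f has_derivative (\<lambda>h. h *\<^sub>R f' s)) (at s within {-\<bar>t\<bar>..\<bar>t\<bar>})"
      using der[OF s] unfolding has_vector_derivative_def by (rule has_derivative_at_withinI)
    show "onorm (\<lambda>h. h *\<^sub>R f' s) \<le> B"
      using bound[OF s] by (intro onorm_le) (simp add: mult.commute[of B] mult_left_mono)
  qed auto
  then show ?thesis by simp
qed

lemma second_order_bound:
  fixes f :: "real \<Rightarrow> 'a::real_normed_vector"
  assumes f: "\<And>s. \<bar>s\<bar> \<le> \<bar>t\<bar> \<Longrightarrow> (f has_vector_derivative f' s) (at s)"
    and f': "\<And>s. \<bar>s\<bar> \<le> \<bar>t\<bar> \<Longrightarrow> (f' has_vector_derivative f'' s) (at s)"
    and bound: "\<And>s. \<bar>s\<bar> \<le> \<bar>t\<bar> \<Longrightarrow> norm (f'' s) \<le> B"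
  shows "norm (f t - f 0 - t *\<^sub>R f' 0) \<le> B * t\<^sup>2"
proof -
  have B: "0 \<le> B" using norm_ge_zero bound[of 0] by (rule order_trans) simp
  have "norm ((f t - t *\<^sub>R f' 0) - (f 0 - 0 *\<^sub>R f' 0)) \<le> (B * \<bar>t\<bar>) * \<bar>t\<bar>"
  proof (rule vector_mvt_bound)
    fix s assume s: "\<bar>s\<bar> \<le> \<bar>t\<bar>"
    show "((\<lambda>s. f s - s *\<^sub>R f' 0) has_vector_derivative (f' s - f' 0)) (at s)"
      using f[OF s] by (auto intro!: derivative_eq_intros)
    have "norm (f' s - f' 0) \<le> B * \<bar>s\<bar>"
      by (rule vector_mvt_bound[OF f' bound]) (use s in auto)
    also have "\<dots> \<le> B * \<bar>t\<bar>" using s B by (rule mult_left_mono)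
    finally show "norm (f' s - f' 0) \<le> B * \<bar>t\<bar>" .
  qed
  then show ?thesis by (simp add: power2_eq_square mult.assoc abs_mult[symmetric] algebra_simps)
qed

lemma difference_quotient_tendsto:
  fixes f :: "real \<Rightarrow> 'a::real_normed_vector"
  assumes "(f has_vector_derivative v) (at 0)"
  shows "((\<lambda>t. (1 / t) *\<^sub>R (f t - f 0)) \<longlongrightarrow> v) (at 0)"
proof -
  have lim: "((\<lambda>t. norm (f t - f 0 - t *\<^sub>R v) / norm t) \<longlongrightarrow> 0) (at 0)"
    using assms by (simp add: has_vector_derivative_def has_derivative_at)
  have eq: "norm (f t - f 0 - t *\<^sub>R v) / norm t = norm ((1 / t) *\<^sub>R (f t - f 0) - v)"
    if "t \<noteq> 0" for t
  proof -
    have "(1 / t) *\<^sub>R (f t - f 0 - t *\<^sub>R v) = (1 / t) *\<^sub>R (f t - f 0) - v"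
      using that by (simp add: scaleR_diff_right)
    then show ?thesis by (metis norm_scaleR abs_divide abs_one divide_inverse mult.commute mult_1 real_norm_def)
  qed
  have "((\<lambda>t. norm ((1 / t) *\<^sub>R (f t - f 0) - v)) \<longlongrightarrow> 0) (at 0)"
    by (rule Lim_transform_eventually[OF lim]) (unfold eventually_at_filter, rule always_eventually, use eq in blast)
  then show ?thesis by (simp add: tendsto_norm_zero_iff LIM_zero_iff)
qed

lemma has_derivative_jacobian:
  fixes f :: "real^3 \<Rightarrow> real^3"
  assumes "(f has_derivative (\<lambda>h. A *v h)) (at x)"
  shows "jacobian f (at x) = A"
  unfolding jacobian_def frechet_derivative_at[OF assms, symmetric] by simp

lemma jacobian_cong_open:
  fixes f g :: "real^3 \<Rightarrow> real^3"
  assumes "open D" "x \<in> D" "\<And>y. y \<in> D \<Longrightarrow> f y = g y" "(g has_derivative (\<lambda>h. A *v h)) (at x)"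
  shows "jacobian f (at x) = A"
  by (rule has_derivative_jacobian, rule has_derivative_transform_within_open[OF assms(4,1,2)])
    (simp add: assms(3))

text \<open>Taylor's formula in \<open>t\<close>, starting from the Jacobian \<open>I\<close> of the identity \<open>G\<^sub>0\<close>; smoothness of a
  deformation includes the bound on the second derivative in \<open>t\<close> that makes the remainder uniform.\<close>

lemma deformation_jacobian_expansion:
  assumes D: "open D" and G: "deformation D M G"
  obtains e B J' where "e > 0" "B > 0"
    "\<And>t z x. \<bar>t\<bar> < e \<Longrightarrow> z \<in> cube M \<Longrightarrow> x \<in> D \<Longrightarrow>
       norm (jacobian (G t z) (at x) - mat 1 - t *\<^sub>R J' z x) \<le> B * t\<^sup>2"
    "\<And>z x. z \<in> cube M \<Longrightarrow> x \<in> D \<Longrightarrow> norm (J' z x) \<le> B"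
proof -
  obtain J where J: "J 0 = (\<lambda>t z x. jacobian (G t z) (at x))"
    "\<And>n t z x. z \<in> cube M \<Longrightarrow> x \<in> D \<Longrightarrow>
        ((\<lambda>s. J n s z x) has_vector_derivative J (Suc n) t z x) (at t)"
    "\<And>n. \<exists>e>0. \<exists>B. \<forall>t z x. \<bar>t\<bar> < e \<longrightarrow> z \<in> cube M \<longrightarrow> x \<in> D \<longrightarrow> norm (J n t z x) \<le> B"
    using G unfolding deformation_def smooth_in_t_def by blast
  obtain e1 B1 where 1: "e1 > 0"
    "\<And>t z x. \<bar>t\<bar> < e1 \<Longrightarrow> z \<in> cube M \<Longrightarrow> x \<in> D \<Longrightarrow> norm (J (Suc 0) t z x) \<le> B1"
    using J(3)[of "Suc 0"] by blast
  obtain e2 B2 where 2: "e2 > 0"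
    "\<And>t z x. \<bar>t\<bar> < e2 \<Longrightarrow> z \<in> cube M \<Longrightarrow> x \<in> D \<Longrightarrow> norm (J (Suc (Suc 0)) t z x) \<le> B2"
    using J(3)[of "Suc (Suc 0)"] by blast
  define B where "B = max 1 (max B1 B2)"
  show thesis
  proof (rule that[of e2 B "J (Suc 0) 0"])
    fix t z x assume t: "\<bar>t\<bar> < e2" and z: "z \<in> cube M" and x: "x \<in> D"
    have "jacobian (G 0 z) (at x) = mat 1"
    proof (rule jacobian_cong_open[OF D x, where g = "\<lambda>y. y"])
      show "G 0 z y = y" if "y \<in> D" for y using G that z by (simp add: deformation_def)
    qed (simp add: has_derivative_ident)
    moreover have "norm (J 0 t z x - J 0 0 z x - t *\<^sub>R J (Suc 0) 0 z x) \<le> B2 * t\<^sup>2"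
      by (rule second_order_bound[OF J(2)[OF z x] J(2)[OF z x]]) (use 2(2) t z x in auto)
    moreover have "B2 * t\<^sup>2 \<le> B * t\<^sup>2" by (intro mult_right_mono) (auto simp: B_def)
    ultimately show "norm (jacobian (G t z) (at x) - mat 1 - t *\<^sub>R J (Suc 0) 0 z x) \<le> B * t\<^sup>2"
      by (simp add: J(1))
  next
    fix z x assume "z \<in> cube M" "x \<in> D"
    then have "norm (J (Suc 0) 0 z x) \<le> B1" using 1 by simp
    then show "norm (J (Suc 0) 0 z x) \<le> B" by (simp add: B_def)
  qed (use 2(1) in \<open>auto simp: B_def\<close>)
qed

text \<open>The derivatives in \<open>t\<close> and \<open>x\<close> commute, because the difference quotients in \<open>t\<close> converge
  together with their Jacobians, the latter uniformly in \<open>x\<close>.\<close>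

lemma jacobian_deformation_velocity:
  assumes D: "open D" and G: "deformation D M G" and z: "z \<in> cube M" and x0: "x0 \<in> D"
    and dG: "\<And>x. x \<in> D \<Longrightarrow> ((\<lambda>t. G t z x) has_vector_derivative V x) (at 0)"
    and e: "e > 0"
    and exp: "\<And>t x. \<bar>t\<bar> < e \<Longrightarrow> x \<in> D \<Longrightarrow>
       norm (jacobian (G t z) (at x) - mat 1 - t *\<^sub>R J' x) \<le> B * t\<^sup>2"
  shows "(V has_derivative (\<lambda>h. J' x0 *v h)) (at x0)"
proof -
  \<comment> \<open>The theorem on termwise differentiation of sequences is applied on a ball, which is convex.\<close>
  obtain r where r: "r > 0" "ball x0 r \<subseteq> D" using D x0 open_contains_ball by blast
  let ?S = "ball x0 r"
  \<comment> \<open>A null sequence of times strictly between \<open>0\<close> and \<open>e\<close>.\<close>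
  define \<tau> where "\<tau> n = e / real (n + 2)" for n
  have \<tau>0: "\<tau> n > 0" "\<bar>\<tau> n\<bar> < e" for n using e by (auto simp: \<tau>_def field_simps intro!: add_pos_nonneg)
  have "(\<lambda>n. 1 / real (n + 2)) \<longlonglongrightarrow> 0"
    using LIMSEQ_ignore_initial_segment[OF lim_1_over_n[where 'a=real], of 2] by simp
  from tendsto_mult_left[OF this, of e] have \<tau>lim: "\<tau> \<longlonglongrightarrow> 0" by (simp add: \<tau>_def[abs_def])
  define f where "f n x = (1 / \<tau> n) *\<^sub>R (G (\<tau> n) z x - x)" for n x
  have G0: "G 0 z x = x" if "x \<in> D" for x using G z that by (simp add: deformation_def)
  have flim: "(\<lambda>n. f n x) \<longlonglongrightarrow> V x" if x: "x \<in> D" for x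
  proof -
    have "((\<lambda>t. (1 / t) *\<^sub>R (G t z x - x)) \<longlongrightarrow> V x) (at 0)"
      using difference_quotient_tendsto[OF dG[OF x]] G0[OF x] by simp
    moreover have "filterlim \<tau> (at 0) sequentially"
      using \<tau>lim \<tau>0(1) by (auto simp: filterlim_at intro!: always_eventually) (metis less_irrefl)
    ultimately show ?thesis unfolding f_def by (rule filterlim_compose)
  qed
  obtain K where K: "K > 0" "\<And>(A::real^3^3) (h::real^3). norm (A *v h) \<le> norm A * norm h * K"
  proof -
    have "bilinear ((*v) :: real^3^3 \<Rightarrow> real^3 \<Rightarrow> real^3)"
      unfolding bilinear_def linear_iff
      by (simp add: algebra_simps scaleR_matrix_vector_assoc)
    from bounded_bilinear.pos_bounded[OF this[unfolded bilinear_conv_bounded_bilinear]]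
    show thesis using that by blast
  qed
  define f' where "f' n x h = ((1 / \<tau> n) *\<^sub>R (jacobian (G (\<tau> n) z) (at x) - mat 1)) *v h" for n x h
  have "\<exists>g. \<forall>x\<in>?S. (\<lambda>n. f n x) \<longlonglongrightarrow> g x \<and> (g has_derivative (\<lambda>h. J' x *v h)) (at x within ?S)"
  proof (rule has_derivative_sequence[where f' = f' and ?x0.0 = x0 and l = "V x0"])
    fix n x assume "x \<in> ?S"
    then have x: "x \<in> D" using r by auto
    then have "G (\<tau> n) z differentiable at x" using G z by (simp add: deformation_def)
    then have "(G (\<tau> n) z has_derivative (\<lambda>h. jacobian (G (\<tau> n) z) (at x) *v h)) (at x)"
      by (simp add: jacobian_works)
    then have "(f n has_derivative (\<lambda>h. (1 / \<tau> n) *\<^sub>R (jacobian (G (\<tau> n) z) (at x) *v h - h))) (at x)"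
      unfolding f_def by (intro derivative_intros)
    moreover have "(1 / \<tau> n) *\<^sub>R (jacobian (G (\<tau> n) z) (at x) *v h - h) = f' n x h" for h
      by (simp add: f'_def matrix_vector_mult_diff_rdistrib scaleR_matrix_vector_assoc[symmetric])
    ultimately show "(f n has_derivative f' n x) (at x within ?S)"
      by (simp add: has_derivative_at_withinI)
  next
    fix \<epsilon> :: real assume \<epsilon>: "\<epsilon> > 0"
    have "(\<lambda>n. B * \<tau> n * K) \<longlonglongrightarrow> B * 0 * K" by (intro tendsto_intros \<tau>lim)
    then have "\<forall>\<^sub>F n in sequentially. B * \<tau> n * K < \<epsilon>" using \<epsilon> by (intro order_tendstoD) auto
    then show "\<forall>\<^sub>F n in sequentially. \<forall>x\<in>?S. \<forall>h. norm (f' n x h - J' x *v h) \<le> \<epsilon> * norm h"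
    proof (rule eventually_mono, intro ballI allI)
      fix n x h assume n: "B * \<tau> n * K < \<epsilon>" and "x \<in> ?S"
      then have x: "x \<in> D" using r by auto
      have "\<tau> n * norm (f' n x h - J' x *v h)
          = norm (\<tau> n *\<^sub>R (((1 / \<tau> n) *\<^sub>R (jacobian (G (\<tau> n) z) (at x) - mat 1) - J' x) *v h))"
        using \<tau>0(1)[of n] by (simp add: f'_def matrix_vector_mult_diff_rdistrib)
      also have "\<dots> = norm ((jacobian (G (\<tau> n) z) (at x) - mat 1 - \<tau> n *\<^sub>R J' x) *v h)"
        using \<tau>0(1)[of n] by (simp add: scaleR_matrix_vector_assoc scaleR_diff_right)
      also have "\<dots> \<le> (B * (\<tau> n)\<^sup>2) * norm h * K"
        using exp[OF \<tau>0(2) x] K by (intro order_trans[OF K(2)] mult_right_mono) auto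
      also have "\<dots> = \<tau> n * ((B * \<tau> n * K) * norm h)" by (simp add: power2_eq_square)
      also have "\<dots> \<le> \<tau> n * (\<epsilon> * norm h)"
        using n \<tau>0(1)[of n] by (intro mult_left_mono mult_right_mono) auto
      finally show "norm (f' n x h - J' x *v h) \<le> \<epsilon> * norm h" using \<tau>0(1)[of n] by simp
    qed
  qed (use r flim[OF x0] in auto)
  then obtain g where g: "\<And>x. x \<in> ?S \<Longrightarrow> (\<lambda>n. f n x) \<longlonglongrightarrow> g x"
    "(g has_derivative (\<lambda>h. J' x0 *v h)) (at x0 within ?S)"
    using centre_in_ball[of x0 r] r(1) by blast
  have "(g has_derivative (\<lambda>h. J' x0 *v h)) (at x0)"
    using g(2) r(1) by (simp add: at_within_open[of x0 "?S"])
  then show ?thesis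
  proof (rule has_derivative_transform_within_open[OF _ open_ball])
    show "x0 \<in> ball x0 r" using r(1) by simp
    show "g x = V x" if "x \<in> ball x0 r" for x
      by (rule LIMSEQ_unique[OF g(1)[OF that] flim]) (use that r(2) in blast)
  qed
qed

text \<open>The derivative at \<open>t = 0\<close> of the coefficients of a deformation with velocity \<open>V\<close>. A map on coefficient
  functions sees their values on all of space; with the value \<open>0\<close> outside \<open>D\<close>, linearity of \<open>V\<close> in the
  parameters becomes an identity of functions.\<close>

definition coeff_deriv :: "(real^3) set \<Rightarrow> (real^3 \<Rightarrow> real^3) \<Rightarrow> real^3 \<Rightarrow> (real^3^3) \<times> (real^3^3)" where
  "coeff_deriv D V x =
     (if x \<in> D then (coeff_lin (jacobian V (at x)), - coeff_lin (jacobian V (at x))) else 0)"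

lemma coeff_deriv_bound:
  obtains b where "b > 0" "\<And>D V x. norm (coeff_deriv D V x) \<le> b * norm (jacobian V (at x))"
    "\<And>D V W x. norm (coeff_deriv D V x - coeff_deriv D W x)
        \<le> b * norm (jacobian V (at x) - jacobian W (at x))"
proof -
  obtain b where b: "b > 0" "\<And>H. norm (coeff_lin H) \<le> norm H * b"
    using bounded_linear.pos_bounded[OF bounded_linear_coeff_lin] by blast
  have *: "norm (coeff_lin H, - coeff_lin H) \<le> (2 * b) * norm H" for H
    using norm_Pair_le[of "coeff_lin H" "- coeff_lin H"] b(2)[of H] by (simp add: algebra_simps)
  have "coeff_lin (H - H') = coeff_lin H - coeff_lin H'" for H H'
    by (rule linear_diff[OF bounded_linear.linear[OF bounded_linear_coeff_lin]])
  then have "norm (coeff_lin H - coeff_lin H', coeff_lin H' - coeff_lin H) \<le> (2 * b) * norm (H - H')" for H H'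
    using *[of "H - H'"] by simp
  then show thesis using b * by (intro that[of "2 * b"]) (auto simp: coeff_deriv_def)
qed

lemma coeff_deriv_perturbation:
  assumes "continuous_on D (\<lambda>x. jacobian V (at x))" "\<And>x. x \<in> D \<Longrightarrow> norm (jacobian V (at x)) \<le> B"
  shows "coeff_deriv D V \<in> coeff_perturbations D"
proof -
  obtain b where b: "b > 0" "\<And>x. norm (coeff_deriv D V x) \<le> b * norm (jacobian V (at x))"
    by (rule coeff_deriv_bound) (rule that)
  have "continuous_on D (\<lambda>x. (coeff_lin (jacobian V (at x)), - coeff_lin (jacobian V (at x))))"
    by (intro continuous_intros bounded_linear.continuous_on[OF bounded_linear_coeff_lin] assms)
  then have "continuous_on D (coeff_deriv D V)"
    by (rule continuous_on_eq) (simp add: coeff_deriv_def)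
  moreover have "norm (coeff_deriv D V x) \<le> b * B" if "x \<in> D" for x
    using mult_left_mono[OF assms(2)[OF that], of b] b(1) by (intro order_trans[OF b(2)]) simp
  then have "bounded (coeff_deriv D V ` D)" by (auto simp: bounded_iff)
  moreover have "transpose (coeff_lin H) = coeff_lin H" for H
    by (simp add: coeff_lin_def vec_eq_iff transpose_def mat_def)
  then have "transpose (- coeff_lin H) = - coeff_lin H" for H
    using linear_neg[OF bounded_linear.linear[OF bounded_linear_transpose3]] by metis
  ultimately show ?thesis
    using \<open>\<And>H. transpose (coeff_lin H) = coeff_lin H\<close>
    by (simp add: coeff_perturbations_def coeff_deriv_def)
qed

lemma coeffs_perturbation:
  assumes \<delta>: "\<And>H. norm H \<le> \<delta> \<Longrightarrow>
        norm ((C_of (mat 1 + H), A_of (mat 1 + H)) - (mat 1, mat 1) - (coeff_lin H, - coeff_lin H))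
          \<le> c * (norm H)\<^sup>2"
    and C: "continuous_on {J. norm (J - mat 1) \<le> \<delta>} C_of"
    and A: "continuous_on {J. norm (J - mat 1) \<le> \<delta>} A_of"
    and "0 \<le> c"
    and J: "continuous_on D (\<lambda>x. jacobian (G t z) (at x))"
      "\<And>x. x \<in> D \<Longrightarrow> norm (jacobian (G t z) (at x) - mat 1) \<le> \<delta>"
  shows "(\<lambda>x. coeffs G t z x - identity_coeffs x) \<in> coeff_perturbations D"
proof -
  let ?J = "\<lambda>x. jacobian (G t z) (at x)"
  have coeffs: "coeffs G t z x = (C_of (?J x), A_of (?J x))" for x by (simp add: coeffs_def Let_def)
  have "continuous_on D (\<lambda>x. (C_of (?J x), A_of (?J x)))"
    using J by (intro continuous_on_Pair continuous_on_compose2[OF C J(1)]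
        continuous_on_compose2[OF A J(1)]) auto
  then have "continuous_on D (\<lambda>x. coeffs G t z x - identity_coeffs x)"
    unfolding coeffs identity_coeffs_def by (rule continuous_on_diff) (rule continuous_on_const)
  moreover have "bounded ((\<lambda>x. coeffs G t z x - identity_coeffs x) ` D)"
  proof -
    obtain b where b: "b > 0" "\<And>H. norm (coeff_lin H) \<le> norm H * b"
      using bounded_linear.pos_bounded[OF bounded_linear_coeff_lin] by blast
    have "norm (coeffs G t z x - identity_coeffs x) \<le> c * \<delta>\<^sup>2 + 2 * (\<delta> * b)" if "x \<in> D" for x
    proof -
      let ?H = "?J x - mat 1"
      have H: "norm ?H \<le> \<delta>" using J(2)[OF that] .
      have "norm (coeffs G t z x - identity_coeffs x - (coeff_lin ?H, - coeff_lin ?H)) \<le> c * (norm ?H)\<^sup>2"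
        using \<delta>[OF H] by (simp add: coeffs identity_coeffs_def)
      also have "\<dots> \<le> c * \<delta>\<^sup>2" using H \<open>0 \<le> c\<close> by (intro mult_left_mono power_mono) auto
      finally have "norm (coeffs G t z x - identity_coeffs x - (coeff_lin ?H, - coeff_lin ?H)) \<le> c * \<delta>\<^sup>2" .
      moreover have "norm (coeff_lin ?H, - coeff_lin ?H) \<le> 2 * (\<delta> * b)"
      proof -
        have "norm (coeff_lin ?H) \<le> \<delta> * b"
          using b(1) by (intro order_trans[OF b(2) mult_right_mono[OF H]]) simp
        moreover have "norm (coeff_lin ?H, - coeff_lin ?H) \<le> norm (coeff_lin ?H) + norm (coeff_lin ?H)"
          using norm_Pair_le[of "coeff_lin ?H" "- coeff_lin ?H"] by simp
        ultimately show ?thesis by linarith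
      qed
      ultimately show ?thesis
        using norm_triangle_sub[of "coeffs G t z x - identity_coeffs x" "(coeff_lin ?H, - coeff_lin ?H)"]
        by linarith
    qed
    then show ?thesis by (auto simp: bounded_iff)
  qed
  moreover have "transpose (C_of H - mat 1) = C_of H - mat 1" "transpose (A_of H - mat 1) = A_of H - mat 1" for H
  proof -
    have d: "transpose (X - Y) = transpose X - transpose Y" for X Y :: "real^3^3"
      by (rule linear_diff[OF bounded_linear.linear[OF bounded_linear_transpose3]])
    show "transpose (C_of H - mat 1) = C_of H - mat 1" "transpose (A_of H - mat 1) = A_of H - mat 1"
      by (simp_all add: d C_of_def A_of_def transpose_scalar matrix_transpose_mul)
  qed
  ultimately show ?thesis
    by (simp add: coeff_perturbations_def coeffs identity_coeffs_def)
qed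

text \<open>Along a deformation the coefficients are \<open>(I, I) + t h + O(t\<^sup>2)\<close>, uniformly in \<open>x\<close> and \<open>z\<close>,
  where \<open>h\<close> is a fixed linear image of the Jacobian of the deformation velocity.\<close>

proposition deformation_coeffs_expansion:
  assumes D: "open D" and G: "deformation D M G"
    and dG: "\<And>z x. z \<in> cube M \<Longrightarrow> x \<in> D \<Longrightarrow>
       ((\<lambda>t. G t z x) has_vector_derivative dG z x) (at 0)"
  obtains e B where "e > 0" "B > 0"
    "\<And>t z. \<bar>t\<bar> < e \<Longrightarrow> z \<in> cube M \<Longrightarrow>
       (\<lambda>x. coeffs G t z x - identity_coeffs x) \<in> coeff_perturbations D"
    "\<And>t z x. \<bar>t\<bar> < e \<Longrightarrow> z \<in> cube M \<Longrightarrow> x \<in> D \<Longrightarrow>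
       norm (coeffs G t z x - identity_coeffs x - t *\<^sub>R coeff_deriv D (dG z) x) \<le> B * t\<^sup>2"
    "\<And>z. z \<in> cube M \<Longrightarrow> coeff_deriv D (dG z) \<in> coeff_perturbations D"
    "\<And>z x. z \<in> cube M \<Longrightarrow> norm (coeff_deriv D (dG z) x) \<le> B"
    "\<And>z x. z \<in> cube M \<Longrightarrow> x \<in> D \<Longrightarrow> dG z differentiable (at x)"
proof -
  obtain e0 B0 J' where 0: "e0 > 0" "B0 > 0"
    "\<And>t z x. \<bar>t\<bar> < e0 \<Longrightarrow> z \<in> cube M \<Longrightarrow> x \<in> D \<Longrightarrow>
       norm (jacobian (G t z) (at x) - mat 1 - t *\<^sub>R J' z x) \<le> B0 * t\<^sup>2"
    "\<And>z x. z \<in> cube M \<Longrightarrow> x \<in> D \<Longrightarrow> norm (J' z x) \<le> B0"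
    by (rule deformation_jacobian_expansion[OF D G]) (rule that)
  have der: "(dG z has_derivative (\<lambda>h. J' z x *v h)) (at x)" if "z \<in> cube M" "x \<in> D" for z x
    by (rule jacobian_deformation_velocity[OF D G that dG[OF that(1)] 0(1) 0(3)[OF _ that(1)]])
  have jac: "jacobian (dG z) (at x) = J' z x" if "z \<in> cube M" "x \<in> D" for z x
    by (rule has_derivative_jacobian[OF der[OF that]])
  obtain \<delta> c where \<delta>: "0 < \<delta>" "0 < c"
    "\<And>H. norm H \<le> \<delta> \<Longrightarrow>
        norm ((C_of (mat 1 + H), A_of (mat 1 + H)) - (mat 1, mat 1) - (coeff_lin H, - coeff_lin H))
          \<le> c * (norm H)\<^sup>2"
    "continuous_on {J. norm (J - mat 1) \<le> \<delta>} C_of"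
    "continuous_on {J. norm (J - mat 1) \<le> \<delta>} A_of"
    by (rule coeffs_first_order) (rule that)
  obtain b where b: "b > 0" "\<And>H. norm (coeff_lin H) \<le> norm H * b"
    using bounded_linear.pos_bounded[OF bounded_linear_coeff_lin] by blast
  obtain b' where b': "b' > 0" "\<And>D V x. norm (coeff_deriv D V x) \<le> b' * norm (jacobian V (at x))"
    by (rule coeff_deriv_bound) (rule that)
  \<comment> \<open>For \<open>|t| < e\<close> the Jacobian differs from \<open>I\<close> by at most \<open>2 B0 |t| \<le> \<delta>\<close>.\<close>
  define e where "e = min e0 (min 1 (\<delta> / (2 * B0)))"
  have e: "0 < e" "e \<le> e0" "e \<le> 1" "e * (2 * B0) \<le> \<delta>"
  proof -
    show "0 < e" "e \<le> e0" "e \<le> 1" using 0 \<delta> by (auto simp: e_def)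
    have "e \<le> \<delta> / (2 * B0)" by (simp add: e_def)
    then show "e * (2 * B0) \<le> \<delta>" using 0 by (simp add: pos_le_divide_eq)
  qed
  \<comment> \<open>The first two terms bound the remainders of the coefficients and of the Jacobian, the last one bounds \<open>h\<close>.\<close>
  define B where "B = c * (2 * B0)\<^sup>2 + 2 * (B0 * b) + b' * B0"
  have Bnn: "0 < c * (2 * B0)\<^sup>2" "0 < 2 * (B0 * b)" "0 < b' * B0" using 0 \<delta> b b' by auto
  have H: "norm (jacobian (G t z) (at x) - mat 1) \<le> (2 * B0) * \<bar>t\<bar>"
    if "\<bar>t\<bar> < e" "z \<in> cube M" "x \<in> D" for t z x
  proof -
    let ?H = "jacobian (G t z) (at x) - mat 1"
    have "norm ?H \<le> norm (?H - t *\<^sub>R J' z x) + norm (t *\<^sub>R J' z x)"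
      by (metis add.commute norm_triangle_sub)
    also have "\<dots> \<le> B0 * t\<^sup>2 + \<bar>t\<bar> * B0"
      using 0(3)[of t z x] 0(4)[of z x] that e by (intro add_mono) (auto intro: mult_left_mono)
    also have "B0 * t\<^sup>2 \<le> B0 * \<bar>t\<bar>"
      using that e 0(2) mult_left_mono[of "\<bar>t\<bar>" 1 "\<bar>t\<bar>"]
      by (intro mult_left_mono) (auto simp: power2_eq_square abs_mult[symmetric])
    finally show ?thesis by simp
  qed
  have H\<delta>: "norm (jacobian (G t z) (at x) - mat 1) \<le> \<delta>"
    if "\<bar>t\<bar> < e" "z \<in> cube M" "x \<in> D" for t z x
  proof -
    have "(2 * B0) * \<bar>t\<bar> \<le> (2 * B0) * e" using that(1) 0(2) by (intro mult_left_mono) auto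
    then show ?thesis using H[OF that] e(4) by (simp only: mult.commute[of _ e])
  qed
  have contG: "continuous_on D (\<lambda>x. jacobian (G t z) (at x))" if "z \<in> cube M" for t z
    using G that by (simp add: deformation_def)
  show thesis
  proof (rule that[of e B])
    show "e > 0" by fact
    show "B > 0" unfolding B_def using Bnn by linarith
  next
    fix t z assume "\<bar>t\<bar> < e" "z \<in> cube M"
    then show "(\<lambda>x. coeffs G t z x - identity_coeffs x) \<in> coeff_perturbations D"
      using \<delta>(2) H\<delta> contG by (intro coeffs_perturbation[OF \<delta>(3-5)]) auto
  next
    fix t z x assume t: "\<bar>t\<bar> < e" and z: "z \<in> cube M" and x: "x \<in> D"
    let ?H = "jacobian (G t z) (at x) - mat 1"
    let ?T = "\<lambda>H. (coeff_lin H, - coeff_lin H)"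
    have lin: "?T (X - Y) = ?T X - ?T Y" "?T (r *\<^sub>R X) = r *\<^sub>R ?T X" for X Y r
      using linear_diff[OF bounded_linear.linear[OF bounded_linear_coeff_lin]]
        linear_scale[OF bounded_linear.linear[OF bounded_linear_coeff_lin]] by auto
    have "norm (coeffs G t z x - identity_coeffs x - ?T ?H) \<le> c * (norm ?H)\<^sup>2"
      using \<delta>(3)[OF H\<delta>[OF t z x]] by (simp add: coeffs_def Let_def identity_coeffs_def)
    also have "\<dots> \<le> c * ((2 * B0) * \<bar>t\<bar>)\<^sup>2"
      using H[OF t z x] \<delta>(2) by (intro mult_left_mono power_mono) auto
    finally have 1: "norm (coeffs G t z x - identity_coeffs x - ?T ?H) \<le> c * (2 * B0)\<^sup>2 * t\<^sup>2"
      by (simp add: power_mult_distrib)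
    have "norm (?T (?H - t *\<^sub>R J' z x)) \<le> 2 * (norm (?H - t *\<^sub>R J' z x) * b)"
      using norm_Pair_le[of "coeff_lin (?H - t *\<^sub>R J' z x)" "- coeff_lin (?H - t *\<^sub>R J' z x)"]
        b(2)[of "?H - t *\<^sub>R J' z x"] by simp
    also have "\<dots> \<le> 2 * ((B0 * t\<^sup>2) * b)"
      using 0(3)[of t z x] t z x e b(1) by (intro mult_left_mono mult_right_mono) auto
    finally have 2: "norm (?T ?H - t *\<^sub>R ?T (J' z x)) \<le> 2 * (B0 * b) * t\<^sup>2"
      unfolding lin by (simp add: mult_ac)
    have "coeffs G t z x - identity_coeffs x - t *\<^sub>R coeff_deriv D (dG z) x
      = (coeffs G t z x - identity_coeffs x - ?T ?H) + (?T ?H - t *\<^sub>R ?T (J' z x))"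
      using x jac[OF z x] by (simp add: coeff_deriv_def)
    then have "norm (coeffs G t z x - identity_coeffs x - t *\<^sub>R coeff_deriv D (dG z) x)
      \<le> c * (2 * B0)\<^sup>2 * t\<^sup>2 + 2 * (B0 * b) * t\<^sup>2"
      using norm_triangle_mono[OF 1 2] by metis
    also have "\<dots> \<le> B * t\<^sup>2"
      unfolding distrib_right[symmetric] using Bnn by (intro mult_right_mono) (auto simp: B_def)
    finally show "norm (coeffs G t z x - identity_coeffs x - t *\<^sub>R coeff_deriv D (dG z) x) \<le> B * t\<^sup>2" .
  next
    fix z assume z: "z \<in> cube M"
    have "continuous_on D (J' z)"
    proof (rule uniform_limit_theorem[OF _ _ trivial_limit_at])
      let ?q = "\<lambda>t x. (1 / t) *\<^sub>R (jacobian (G t z) (at x) - mat 1)"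
      show "\<forall>\<^sub>F t in at 0. continuous_on D (?q t)"
        by (intro always_eventually allI continuous_intros contG z)
      show "uniform_limit D ?q (J' z) (at 0)"
      proof (rule uniform_limitI)
        fix \<epsilon> :: real assume "\<epsilon> > 0"
        moreover have "((\<lambda>t::real. B0 * \<bar>t\<bar>) \<longlongrightarrow> B0 * \<bar>0\<bar>) (at 0)" by (intro tendsto_intros)
        ultimately have "\<forall>\<^sub>F t::real in at 0. B0 * \<bar>t\<bar> < \<epsilon>" by (intro order_tendstoD) auto
        moreover have "\<forall>\<^sub>F t::real in at 0. \<bar>t\<bar> < e0 \<and> t \<noteq> 0"
          using 0(1) by (auto simp: eventually_at intro!: exI[of _ e0])
        ultimately show "\<forall>\<^sub>F t in at 0. \<forall>x\<in>D. dist (?q t x) (J' z x) < \<epsilon>"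
        proof (eventually_elim, intro ballI)
          fix t x assume t: "B0 * \<bar>t\<bar> < \<epsilon>" "\<bar>t\<bar> < e0 \<and> t \<noteq> 0" and x: "x \<in> D"
          have "\<bar>t\<bar> * norm (?q t x - J' z x) = norm (jacobian (G t z) (at x) - mat 1 - t *\<^sub>R J' z x)"
            using t by (simp add: norm_scaleR[symmetric] scaleR_diff_right del: norm_scaleR)
          also have "\<dots> \<le> \<bar>t\<bar> * (B0 * \<bar>t\<bar>)"
            using 0(3)[of t z x] t z x by (simp add: power2_eq_square mult_ac abs_mult[symmetric])
          finally show "dist (?q t x) (J' z x) < \<epsilon>" using t by (simp add: dist_norm)
        qed
      qed
    qed
    then show "coeff_deriv D (dG z) \<in> coeff_perturbations D"
      using jac[OF z] 0(4)[OF z]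
      by (intro coeff_deriv_perturbation[of _ _ B0]) (auto cong: continuous_on_cong)
  next
    fix z x assume z: "z \<in> cube M"
    show "norm (coeff_deriv D (dG z) x) \<le> B"
    proof (cases "x \<in> D")
      case True
      have "norm (coeff_deriv D (dG z) x) \<le> b' * norm (J' z x)"
        using b'(2)[of D "dG z" x] jac[OF z True] by simp
      also have "\<dots> \<le> b' * B0" using 0(4)[OF z True] b'(1) by (intro mult_left_mono) auto
      finally show ?thesis using Bnn by (simp add: B_def)
    next
      case False
      then show ?thesis using Bnn by (simp add: coeff_deriv_def B_def)
    qed
  next
    fix z x assume "z \<in> cube M" "x \<in> D"
    then show "dG z differentiable (at x)" using der unfolding differentiable_def by blast
  qed
qed

lemma coeff_deriv_linear:
  assumes D: "open D" and V: "\<And>x. x \<in> D \<Longrightarrow> V x = a *\<^sub>R V1 x + b *\<^sub>R V2 x"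
    and diff: "\<And>x. x \<in> D \<Longrightarrow> V1 differentiable (at x)" "\<And>x. x \<in> D \<Longrightarrow> V2 differentiable (at x)"
  shows "coeff_deriv D V = (\<lambda>x. a *\<^sub>R coeff_deriv D V1 x + b *\<^sub>R coeff_deriv D V2 x)"
proof
  fix x
  show "coeff_deriv D V x = a *\<^sub>R coeff_deriv D V1 x + b *\<^sub>R coeff_deriv D V2 x"
  proof (cases "x \<in> D")
    case True
    let ?J1 = "jacobian V1 (at x)" and ?J2 = "jacobian V2 (at x)"
    have "(V1 has_derivative (\<lambda>h. ?J1 *v h)) (at x)" "(V2 has_derivative (\<lambda>h. ?J2 *v h)) (at x)"
      using diff[OF True] by (simp_all add: jacobian_works)
    then have "((\<lambda>x. a *\<^sub>R V1 x + b *\<^sub>R V2 x) has_derivative (\<lambda>h. a *\<^sub>R (?J1 *v h) + b *\<^sub>R (?J2 *v h))) (at x)"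
      by (intro derivative_intros)
    moreover have "a *\<^sub>R (?J1 *v h) + b *\<^sub>R (?J2 *v h) = (a *\<^sub>R ?J1 + b *\<^sub>R ?J2) *v h" for h
      by (simp add: matrix_vector_mult_add_rdistrib scaleR_matrix_vector_assoc)
    ultimately have "jacobian V (at x) = a *\<^sub>R ?J1 + b *\<^sub>R ?J2"
      by (intro jacobian_cong_open[OF D True V]) auto
    then show ?thesis
      using linear_add[OF bounded_linear.linear[OF bounded_linear_coeff_lin]]
        linear_scale[OF bounded_linear.linear[OF bounded_linear_coeff_lin]]
      by (simp add: coeff_deriv_def True)
  qed (simp add: coeff_deriv_def)
qed

section \<open>Square-integrable fields\<close>

lemma sq_integrable_norm_mult:
  assumes f: "sq_integrable \<mu> f" and g: "sq_integrable \<mu> g"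
  shows "integrable \<mu> (\<lambda>x. norm (f x) * norm (g x))"
proof (rule Bochner_Integration.integrable_bound)
  show "integrable \<mu> (\<lambda>x. (norm (f x))\<^sup>2 + (norm (g x))\<^sup>2)"
    using f g by (auto simp: sq_integrable_def)
  show "(\<lambda>x. norm (f x) * norm (g x)) \<in> borel_measurable \<mu>"
    using f g by (auto simp: sq_integrable_def)
  show "AE x in \<mu>. norm (norm (f x) * norm (g x)) \<le> norm ((norm (f x))\<^sup>2 + (norm (g x))\<^sup>2)"
  proof (rule AE_I2)
    fix x
    have "2 * norm (f x) * norm (g x) \<le> (norm (f x))\<^sup>2 + (norm (g x))\<^sup>2" by (rule sum_squares_bound)
    moreover have "0 \<le> norm (f x) * norm (g x)" by simp
    ultimately have "norm (f x) * norm (g x) \<le> (norm (f x))\<^sup>2 + (norm (g x))\<^sup>2" by linarith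
    then show "norm (norm (f x) * norm (g x)) \<le> norm ((norm (f x))\<^sup>2 + (norm (g x))\<^sup>2)" by simp
  qed
qed

text \<open>Weighting Young's inequality \<open>2 |f| |g| \<le> (b/a) |f|\<^sup>2 + (a/b) |g|\<^sup>2\<close> with numbers \<open>a, b\<close> slightly
  above the two norms avoids a case distinction for vanishing norms.\<close>

lemma sq_integrable_Cauchy_Schwarz:
  assumes f: "sq_integrable \<mu> f" and g: "sq_integrable \<mu> g"
  shows "(\<integral>x. norm (f x) * norm (g x) \<partial>\<mu>)
    \<le> sqrt (\<integral>x. (norm (f x))\<^sup>2 \<partial>\<mu>) * sqrt (\<integral>x. (norm (g x))\<^sup>2 \<partial>\<mu>)"
proof -
  define F where "F = (\<integral>x. (norm (f x))\<^sup>2 \<partial>\<mu>)"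
  define G where "G = (\<integral>x. (norm (g x))\<^sup>2 \<partial>\<mu>)"
  define I where "I = (\<integral>x. norm (f x) * norm (g x) \<partial>\<mu>)"
  have nn: "0 \<le> F" "0 \<le> G" by (auto simp: F_def G_def)
  have young: "I \<le> a * b" if a: "sqrt F < a" and b: "sqrt G < b" for a b
  proof -
    have ab: "0 < a" "0 < b"
      using a b real_sqrt_ge_zero[OF nn(1)] real_sqrt_ge_zero[OF nn(2)] by linarith+
    have "2 * (norm (f x) * norm (g x)) \<le> (b / a) * (norm (f x))\<^sup>2 + (a / b) * (norm (g x))\<^sup>2" for x
    proof -
      have "2 * (b * norm (f x)) * (a * norm (g x)) \<le> (b * norm (f x))\<^sup>2 + (a * norm (g x))\<^sup>2"
        by (rule sum_squares_bound)
      moreover have "2 * (b * norm (f x)) * (a * norm (g x)) = (2 * (norm (f x) * norm (g x))) * (a * b)"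
        by simp
      moreover have "(b * norm (f x))\<^sup>2 + (a * norm (g x))\<^sup>2
          = ((b / a) * (norm (f x))\<^sup>2 + (a / b) * (norm (g x))\<^sup>2) * (a * b)"
        using ab by (simp add: power2_eq_square distrib_right)
      ultimately have "(2 * (norm (f x) * norm (g x))) * (a * b)
          \<le> ((b / a) * (norm (f x))\<^sup>2 + (a / b) * (norm (g x))\<^sup>2) * (a * b)" by simp
      then show ?thesis using ab by simp
    qed
    then have "(\<integral>x. 2 * (norm (f x) * norm (g x)) \<partial>\<mu>)
        \<le> (\<integral>x. (b / a) * (norm (f x))\<^sup>2 + (a / b) * (norm (g x))\<^sup>2 \<partial>\<mu>)"
      using f g sq_integrable_norm_mult[OF f g]
      by (intro integral_mono) (auto simp: sq_integrable_def)
    also have "\<dots> = (b / a) * F + (a / b) * G"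
      using f g by (subst Bochner_Integration.integral_add) (auto simp: sq_integrable_def F_def G_def)
    finally have "2 * I \<le> (b / a) * F + (a / b) * G" by (simp add: I_def)
    also have "\<dots> \<le> (b / a) * a\<^sup>2 + (a / b) * b\<^sup>2"
      using a b ab nn by (intro add_mono mult_left_mono) (auto simp: sqrt_le_D less_imp_le real_le_lsqrt intro: real_sqrt_le_iff[THEN iffD1])
    also have "\<dots> = 2 * (a * b)" using ab by (simp add: power2_eq_square)
    finally show ?thesis by simp
  qed
  have "((\<lambda>e. (sqrt F + e) * (sqrt G + e)) \<longlongrightarrow> (sqrt F + 0) * (sqrt G + 0)) (at_right 0)"
    by (intro tendsto_intros)
  moreover have "\<forall>\<^sub>F e in at_right (0::real). I \<le> (sqrt F + e) * (sqrt G + e)"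
    by (rule eventually_at_right_less[THEN eventually_mono]) (simp add: young)
  ultimately have "I \<le> (sqrt F + 0) * (sqrt G + 0)"
    by (rule tendsto_lowerbound) simp
  then show ?thesis by (simp add: I_def F_def G_def)
qed

lemma sq_integrable_add:
  assumes f: "sq_integrable \<mu> f" and g: "sq_integrable \<mu> g"
  shows "sq_integrable \<mu> (\<lambda>x. f x + g x)"
  unfolding sq_integrable_def
proof
  show "(\<lambda>x. f x + g x) \<in> borel_measurable \<mu>" using f g by (auto simp: sq_integrable_def)
  show "integrable \<mu> (\<lambda>x. (norm (f x + g x))\<^sup>2)"
  proof (rule Bochner_Integration.integrable_bound)
    show "integrable \<mu> (\<lambda>x. 2 * (norm (f x))\<^sup>2 + 2 * (norm (g x))\<^sup>2)"
      using f g by (auto simp: sq_integrable_def)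
    show "(\<lambda>x. (norm (f x + g x))\<^sup>2) \<in> borel_measurable \<mu>"
      using f g by (auto simp: sq_integrable_def)
    show "AE x in \<mu>. norm ((norm (f x + g x))\<^sup>2) \<le> norm (2 * (norm (f x))\<^sup>2 + 2 * (norm (g x))\<^sup>2)"
    proof (rule AE_I2)
      fix x
      have "(norm (f x + g x))\<^sup>2 \<le> (norm (f x) + norm (g x))\<^sup>2"
        by (intro power_mono norm_triangle_ineq) simp
      also have "\<dots> \<le> 2 * (norm (f x))\<^sup>2 + 2 * (norm (g x))\<^sup>2"
        using sum_squares_bound[of "norm (f x)" "norm (g x)"] by (simp add: power2_sum)
      finally show "norm ((norm (f x + g x))\<^sup>2) \<le> norm (2 * (norm (f x))\<^sup>2 + 2 * (norm (g x))\<^sup>2)"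
        by simp
    qed
  qed
qed

lemma sq_integrable_scaleR:
  "sq_integrable \<mu> f \<Longrightarrow> sq_integrable \<mu> (\<lambda>x. c *\<^sub>R f x)"
  by (auto simp: sq_integrable_def power_mult_distrib)

lemma sq_integrable_inner:
  assumes f: "sq_integrable \<mu> f" and g: "sq_integrable \<mu> g"
  shows "integrable \<mu> (\<lambda>x. f x \<bullet> g x)"
proof (rule Bochner_Integration.integrable_bound[OF sq_integrable_norm_mult[OF f g]])
  show "(\<lambda>x. f x \<bullet> g x) \<in> borel_measurable \<mu>" using f g by (auto simp: sq_integrable_def)
qed (simp add: Cauchy_Schwarz_ineq2)

lemma sq_integrable_Minkowski:
  assumes f: "sq_integrable \<mu> f" and g: "sq_integrable \<mu> g"
  shows "sqrt (\<integral>x. (norm (f x + g x))\<^sup>2 \<partial>\<mu>)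
    \<le> sqrt (\<integral>x. (norm (f x))\<^sup>2 \<partial>\<mu>) + sqrt (\<integral>x. (norm (g x))\<^sup>2 \<partial>\<mu>)" (is "sqrt ?I \<le> sqrt ?F + sqrt ?G")
proof (rule real_le_lsqrt)
  have nn: "0 \<le> ?F" "0 \<le> ?G" by auto
  have "?I \<le> (\<integral>x. (norm (f x))\<^sup>2 + 2 * (norm (f x) * norm (g x)) + (norm (g x))\<^sup>2 \<partial>\<mu>)"
  proof (rule integral_mono)
    show "integrable \<mu> (\<lambda>x. (norm (f x + g x))\<^sup>2)"
      using sq_integrable_add[OF f g] by (simp add: sq_integrable_def)
    show "integrable \<mu> (\<lambda>x. (norm (f x))\<^sup>2 + 2 * (norm (f x) * norm (g x)) + (norm (g x))\<^sup>2)"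
      using f g sq_integrable_norm_mult[OF f g] by (auto simp: sq_integrable_def)
    show "(norm (f x + g x))\<^sup>2 \<le> (norm (f x))\<^sup>2 + 2 * (norm (f x) * norm (g x)) + (norm (g x))\<^sup>2" for x
      using power_mono[OF norm_triangle_ineq[of "f x" "g x"], of 2] by (simp add: power2_sum algebra_simps)
  qed
  also have "\<dots> = ?F + 2 * (\<integral>x. norm (f x) * norm (g x) \<partial>\<mu>) + ?G"
    using f g sq_integrable_norm_mult[OF f g]
    by (subst Bochner_Integration.integral_add | simp add: sq_integrable_def)+
  also have "\<dots> \<le> ?F + 2 * (sqrt ?F * sqrt ?G) + ?G"
    using sq_integrable_Cauchy_Schwarz[OF f g] by simp
  also have "\<dots> = (sqrt ?F + sqrt ?G)\<^sup>2" using nn by (simp add: power2_sum)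
  finally show "?I \<le> (sqrt ?F + sqrt ?G)\<^sup>2" .
qed (auto intro!: add_nonneg_nonneg)

lemma sq_integrable_imp_integrable:
  assumes "finite_measure \<mu>" "sq_integrable \<mu> f"
  shows "integrable \<mu> f"
proof -
  interpret finite_measure \<mu> by fact
  have "sq_integrable \<mu> (\<lambda>_. 1::real)" by (simp add: sq_integrable_def)
  from sq_integrable_norm_mult[OF assms(2) this] show ?thesis
    using assms(2) by (simp add: sq_integrable_def integrable_norm_iff)
qed

lemma bounded_sq_integrable:
  assumes "finite_measure \<mu>" "f \<in> borel_measurable \<mu>" "\<And>x. norm (f x) \<le> B"
  shows "sq_integrable \<mu> f"
proof -
  interpret finite_measure \<mu> by fact
  have "norm ((norm (f x))\<^sup>2) \<le> B\<^sup>2" for x using assms(3) by (simp add: power_mono)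
  then show ?thesis
    using assms(2) by (auto simp: sq_integrable_def intro!: integrable_const_bound[where B = "B\<^sup>2"])
qed

lemma sq_integrable_bounded_linear:
  assumes "bounded_linear h" "sq_integrable \<mu> f"
  shows "sq_integrable \<mu> (\<lambda>x. h (f x))"
proof -
  obtain K where K: "K > 0" "\<And>x. norm (h x) \<le> norm x * K"
    using bounded_linear.pos_bounded[OF assms(1)] by blast
  have m: "(\<lambda>x. h (f x)) \<in> borel_measurable \<mu>"
    using assms borel_measurable_continuous_onI[OF linear_continuous_on[OF assms(1)]]
    by (auto simp: sq_integrable_def intro: measurable_compose)
  have "integrable \<mu> (\<lambda>x. (norm (h (f x)))\<^sup>2)"
  proof (rule Bochner_Integration.integrable_bound)
    show "integrable \<mu> (\<lambda>x. K\<^sup>2 * (norm (f x))\<^sup>2)" using assms by (simp add: sq_integrable_def)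
    show "(\<lambda>x. (norm (h (f x)))\<^sup>2) \<in> borel_measurable \<mu>" using m by simp
    show "AE x in \<mu>. norm ((norm (h (f x)))\<^sup>2) \<le> norm (K\<^sup>2 * (norm (f x))\<^sup>2)"
      using power_mono[OF K(2) norm_ge_zero, of _ 2] by (intro AE_I2) (simp add: power_mult_distrib mult.commute)
  qed
  with m show ?thesis by (simp add: sq_integrable_def)
qed

section \<open>The fundamental lemma of the calculus of variations\<close>

lemma C1_fieldI:
  assumes "\<And>x. (f has_derivative f' x) (at x)" "\<And>v. continuous_on UNIV (\<lambda>x. f' x v)"
  shows "C1_field f"
proof -
  have "frechet_derivative f (at x) = f' x" for x
    using frechet_derivative_at[OF assms(1)] by simp
  then show ?thesis
    using assms by (auto simp: C1_field_def differentiable_def)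
qed

lemma has_field_derivative_sq_pos_part:
  "((\<lambda>s::real. (max 0 s)\<^sup>2) has_field_derivative 2 * max 0 s) (at s)"
proof (cases "s = 0")
  case True
  have "((\<lambda>h::real. (max 0 h)\<^sup>2 / h) \<longlongrightarrow> 0) (at 0)"
  proof (rule Lim_null_comparison)
    show "\<forall>\<^sub>F h in at (0::real). norm ((max 0 h)\<^sup>2 / h) \<le> \<bar>h\<bar>"
      by (intro always_eventually) (auto simp: max_def power2_eq_square)
    show "((\<lambda>h::real. \<bar>h\<bar>) \<longlongrightarrow> 0) (at 0)" by (rule tendsto_rabs_zero) (rule tendsto_ident_at)
  qed
  then show ?thesis using True by (simp add: DERIV_def)
next
  case False
  show ?thesis
  proof (cases "s > 0")
    case True
    have "((\<lambda>s::real. s\<^sup>2) has_field_derivative 2 * max 0 s) (at s)"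
      using True by (auto intro!: derivative_eq_intros simp: max_def)
    then show ?thesis
      by (rule has_field_derivative_transform_within_open[where S = "{0<..}"]) (use True in auto)
  next
    case False
    with \<open>s \<noteq> 0\<close> have "s < 0" by simp
    have "((\<lambda>s::real. 0) has_field_derivative 2 * max 0 s) (at s)"
      using \<open>s < 0\<close> by (auto intro!: derivative_eq_intros simp: max_def)
    then show ?thesis
      by (rule has_field_derivative_transform_within_open[where S = "{..<0}"]) (use \<open>s < 0\<close> in auto)
  qed
qed

text \<open>A \<open>C\<^sup>1\<close> function that is positive exactly on the ball: the square of a positive part is continuously
  differentiable.\<close>

definition ball_bump :: "'a::real_inner \<Rightarrow> real \<Rightarrow> 'a \<Rightarrow> real" where
  "ball_bump c r x = (max 0 (r\<^sup>2 - (x - c) \<bullet> (x - c)))\<^sup>2"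

lemma ball_bump_pos_iff: "0 < r \<Longrightarrow> 0 < ball_bump c r x \<longleftrightarrow> x \<in> ball c r"
proof -
  assume r: "0 < r"
  have "ball_bump c r x \<noteq> 0 \<longleftrightarrow> (norm (x - c))\<^sup>2 < r\<^sup>2"
    unfolding ball_bump_def power2_norm_eq_inner by (auto simp: max_def)
  also have "\<dots> \<longleftrightarrow> norm (x - c) < r"
    using r by (auto intro: power_strict_mono dest: power2_less_imp_less)
  finally show ?thesis
    unfolding ball_bump_def by (auto simp: dist_norm norm_minus_commute less_le)
qed

lemma ball_bump_nonneg: "0 \<le> ball_bump c r x" by (simp add: ball_bump_def)

lemma has_derivative_ball_bump:
  "(ball_bump c r has_derivative (\<lambda>h. 2 * max 0 (r\<^sup>2 - (x - c) \<bullet> (x - c)) * (- 2 * ((x - c) \<bullet> h)))) (at x)"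
proof -
  have "((\<lambda>x. r\<^sup>2 - (x - c) \<bullet> (x - c)) has_derivative (\<lambda>h. - 2 * ((x - c) \<bullet> h))) (at x)"
    by (auto intro!: derivative_eq_intros simp: inner_commute)
  from has_derivative_compose[OF this has_field_derivative_sq_pos_part[unfolded has_field_derivative_def]]
  show ?thesis unfolding ball_bump_def[abs_def] by (simp add: mult.commute)
qed

text \<open>The functions \<open>n b / (1 + n b)\<close>, where \<open>b\<close> is a sum of bumps, are \<open>C\<^sup>1\<close>, vanish outside the
  union of the balls and converge to its indicator.\<close>

lemma C1_field_bump_quotient:
  fixes c :: "'i \<Rightarrow> 'a::real_inner" and r :: "'i \<Rightarrow> real" and v :: "'b::real_normed_vector"
  assumes "finite I" "0 \<le> n"
  defines "b \<equiv> \<lambda>x. \<Sum>i\<in>I. ball_bump (c i) (r i) x"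
  shows "C1_field (\<lambda>x. (n * b x / (1 + n * b x)) *\<^sub>R v)"
proof -
  define b' where
    "b' x h = (\<Sum>i\<in>I. 2 * max 0 ((r i)\<^sup>2 - (x - c i) \<bullet> (x - c i)) * (- 2 * ((x - c i) \<bullet> h)))" for x h
  have b: "(b has_derivative b' x) (at x)" for x
    unfolding b_def b'_def[abs_def] by (intro has_derivative_sum has_derivative_ball_bump)
  have pos: "1 + n * b x > 0" for x
    using assms by (auto simp: b_def intro!: add_pos_nonneg mult_nonneg_nonneg sum_nonneg ball_bump_nonneg)
  have contb: "continuous_on UNIV b"
    using b by (intro continuous_at_imp_continuous_on ballI) (rule has_derivative_continuous)
  show ?thesis
  proof (rule C1_fieldI)
    fix x
    have "((\<lambda>x. 1 - 1 / (1 + n * b x)) has_derivative (\<lambda>h. n * b' x h / (1 + n * b x)\<^sup>2)) (at x)"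
      using pos[of x] by (auto intro!: derivative_eq_intros b simp: power2_eq_square field_simps)
    moreover have "1 - 1 / (1 + n * b x) = n * b x / (1 + n * b x)" for x
      using pos[of x] by (simp add: field_simps)
    ultimately show "((\<lambda>x. (n * b x / (1 + n * b x)) *\<^sub>R v) has_derivative
        (\<lambda>h. (n * b' x h / (1 + n * b x)\<^sup>2) *\<^sub>R v)) (at x)"
      by (intro has_derivative_scaleR_left) simp
  next
    show "continuous_on UNIV (\<lambda>x. (n * b' x h / (1 + n * b x)\<^sup>2) *\<^sub>R v)" for h
      using pos unfolding b'_def
      by (intro continuous_intros contb) (auto simp: less_imp_neq[THEN not_sym])
  qed
qed

text \<open>An open set is a countable union of closed balls contained in it, by Lindelof's theorem. The \<open>n\<close>-th
  function is the quotient \<open>n b / (1 + n b)\<close> for the sum \<open>b\<close> of the bumps of the first \<open>n + 1\<close> balls; its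
  support is contained in a finite union of closed balls and hence compact.\<close>

lemma indicator_open_limit_of_test_fields:
  fixes U :: "(real^3) set"
  assumes "open U" "U \<noteq> {}"
  obtains \<phi> :: "nat \<Rightarrow> real^3 \<Rightarrow> real" where
    "\<And>n. test_field U (\<phi> n)" "\<And>n x. 0 \<le> \<phi> n x \<and> \<phi> n x \<le> 1"
    "\<And>x. (\<lambda>n. \<phi> n x) \<longlonglongrightarrow> indicator U x"
proof -
  define F where "F = {(c, r). 0 < r \<and> cball c r \<subseteq> U}"
  have "open S" if "S \<in> (\<lambda>(c, r). ball c r) ` F" for S using that by auto
  then obtain B where B: "B \<subseteq> (\<lambda>(c, r). ball c r) ` F" "countable B" "\<Union>B = \<Union>((\<lambda>(c, r). ball c r) ` F)"
    by (rule Lindelof)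
  have "\<Union>((\<lambda>(c, r). ball c r) ` F) = U"
  proof
    show "\<Union>((\<lambda>(c, r). ball c r) ` F) \<subseteq> U" by (auto simp: F_def)
    show "U \<subseteq> \<Union>((\<lambda>(c, r). ball c r) ` F)"
    proof
      fix x assume "x \<in> U"
      then obtain r where "r > 0" "cball x r \<subseteq> U" using assms(1) open_contains_cball by blast
      then show "x \<in> \<Union>((\<lambda>(c, r). ball c r) ` F)" unfolding F_def by force
    qed
  qed
  then have UB: "\<Union>B = U" using B by simp
  obtain F' where F': "F' \<subseteq> F" "countable F'" "B = (\<lambda>(c, r). ball c r) ` F'"
    using countable_subset_image[of B "\<lambda>(c, r). ball c r" F] B(1,2) by blast
  have "F' \<noteq> {}" using UB F' assms(2) by auto
  define p where "p = from_nat_into F'"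
  have range: "range p = F'" unfolding p_def using F' \<open>F' \<noteq> {}\<close> by (rule_tac range_from_nat_into) auto
  define c where "c k = fst (p k)" for k
  define r where "r k = snd (p k)" for k
  have cr: "0 < r k" "cball (c k) (r k) \<subseteq> U" for k
  proof -
    have "p k \<in> F" using range F'(1) by blast
    then show "0 < r k" "cball (c k) (r k) \<subseteq> U" by (simp_all add: F_def c_def r_def case_prod_beta)
  qed
  have U: "U = (\<Union>k. ball (c k) (r k))"
    unfolding UB[symmetric] F'(3) range[symmetric] by (auto simp: c_def r_def split: prod.splits)
  define b where "b n x = (\<Sum>k\<in>{..n}. ball_bump (c k) (r k) x)" for n x
  define \<phi> where "\<phi> n x = real n * b n x / (1 + real n * b n x)" for n x
  have bnn: "0 \<le> b n x" for n x by (auto simp: b_def intro!: sum_nonneg ball_bump_nonneg)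
  show thesis
  proof
    fix n
    have "C1_field (\<lambda>x. (real n * b n x / (1 + real n * b n x)) *\<^sub>R (1::real))"
      unfolding b_def by (rule C1_field_bump_quotient) auto
    moreover have "\<phi> n x = 0" if "x \<notin> (\<Union>k\<in>{..n}. cball (c k) (r k))" for x
    proof -
      have "ball_bump (c k) (r k) x = 0" if "k \<in> {..n}" for k
        using ball_bump_pos_iff[OF cr(1), of "c k" k x] ball_bump_nonneg[of "c k" "r k" x]
          \<open>x \<notin> _\<close> that by (auto simp: less_le)
      then show ?thesis by (simp add: \<phi>_def b_def)
    qed
    ultimately show "test_field U (\<phi> n)"
      unfolding test_field_def
      using cr(2) by (intro conjI exI[of _ "\<Union>k\<in>{..n}. cball (c k) (r k)"])
        (auto simp: \<phi>_def[abs_def] intro!: compact_UN)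
  next
    fix n x show "0 \<le> \<phi> n x \<and> \<phi> n x \<le> 1"
    proof -
      have "0 \<le> real n * b n x" using bnn by simp
      then show ?thesis by (simp add: \<phi>_def divide_le_eq)
    qed
  next
    fix x
    show "(\<lambda>n. \<phi> n x) \<longlonglongrightarrow> indicator U x"
    proof (cases "x \<in> U")
      case True
      then obtain k where k: "x \<in> ball (c k) (r k)" using U by auto
      define \<beta> where "\<beta> = ball_bump (c k) (r k) x"
      have \<beta>: "\<beta> > 0" unfolding \<beta>_def using ball_bump_pos_iff[OF cr(1)] k by blast
      have "(\<lambda>n. 1 / (1 + real n * \<beta>)) \<longlonglongrightarrow> 0"
      proof -
        have "filterlim (\<lambda>n. \<beta> * real n) at_top sequentially"
          by (rule filterlim_tendsto_pos_mult_at_top[OF tendsto_const \<beta> filterlim_real_sequentially])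
        then have "filterlim (\<lambda>n. 1 + \<beta> * real n) at_top sequentially"
          by (rule filterlim_tendsto_add_at_top[OF tendsto_const])
        from tendsto_inverse_0_at_top[OF this] show ?thesis
          by (simp add: divide_inverse mult.commute)
      qed
      moreover have "\<forall>\<^sub>F n in sequentially. norm (1 - \<phi> n x) \<le> 1 / (1 + real n * \<beta>)"
        using eventually_ge_at_top[of k]
      proof eventually_elim
        case (elim n)
        have "\<beta> \<le> b n x" unfolding b_def \<beta>_def
          using elim by (intro member_le_sum) (auto simp: ball_bump_nonneg)
        then have "1 + real n * \<beta> \<le> 1 + real n * b n x" by (simp add: mult_left_mono)
        moreover have "0 < 1 + real n * \<beta>" using \<beta> by (simp add: add_pos_nonneg)
        moreover have "1 - \<phi> n x = 1 / (1 + real n * b n x)"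
        proof -
          have "0 \<le> real n * b n x" using bnn by simp
          then show ?thesis by (simp add: \<phi>_def field_simps)
        qed
        ultimately show ?case by (simp add: frac_le)
      qed
      ultimately have "(\<lambda>n. 1 - \<phi> n x) \<longlonglongrightarrow> 0" by (rule Lim_null_comparison[rotated])
      from tendsto_diff[OF tendsto_const[of 1] this] show ?thesis using True by simp
    next
      case False
      then have "ball_bump (c k) (r k) x = 0" for k
        using ball_bump_pos_iff[OF cr(1), of "c k" k x] ball_bump_nonneg[of "c k" "r k" x] U
        by (auto simp: less_le)
      then show ?thesis using False by (simp add: \<phi>_def b_def)
    qed
  qed
qed

lemma test_field_mono: "test_field U f \<Longrightarrow> U \<subseteq> D \<Longrightarrow> test_field D f"
  unfolding test_field_def by blast

lemma integral_over_open_eq_0: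
  fixes g :: "real^3 \<Rightarrow> real"
  assumes D: "open D" and g: "integrable (lebesgue_on D) g"
    and zero: "\<And>\<phi> :: real^3 \<Rightarrow> real. test_field D \<phi> \<Longrightarrow> (\<integral>x. \<phi> x * g x \<partial>lebesgue_on D) = 0"
    and U: "open U" "U \<subseteq> D"
  shows "(\<integral>x. indicator U x * g x \<partial>lebesgue_on D) = 0"
proof (cases "U = {}")
  case False
  obtain \<phi> :: "nat \<Rightarrow> real^3 \<Rightarrow> real" where \<phi>:
    "\<And>n. test_field U (\<phi> n)" "\<And>n x. 0 \<le> \<phi> n x \<and> \<phi> n x \<le> 1"
    "\<And>x. (\<lambda>n. \<phi> n x) \<longlonglongrightarrow> indicator U x"
    by (rule indicator_open_limit_of_test_fields[OF U(1) False]) (rule that)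
  have m: "\<phi> n \<in> borel_measurable (lebesgue_on D)" for n
  proof (rule continuous_imp_measurable_on_sets_lebesgue)
    show "continuous_on D (\<phi> n)"
      using \<phi>(1)[of n] unfolding test_field_def C1_field_def
      by (intro continuous_at_imp_continuous_on ballI differentiable_imp_continuous_within) auto
    show "D \<in> sets lebesgue" using D by simp
  qed
  have "(\<lambda>n. \<integral>x. \<phi> n x * g x \<partial>lebesgue_on D) \<longlonglongrightarrow> (\<integral>x. indicator U x * g x \<partial>lebesgue_on D)"
  proof (rule integral_dominated_convergence[where w = "\<lambda>x. \<bar>g x\<bar>"])
    show "(\<lambda>x. indicator U x * g x) \<in> borel_measurable (lebesgue_on D)"
      using g U by (intro borel_measurable_times borel_measurable_indicator)
        (auto simp: sets_restrict_space intro!: image_eqI[of _ _ U])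
    show "(\<lambda>x. \<phi> n x * g x) \<in> borel_measurable (lebesgue_on D)" for n using g m by simp
    show "integrable (lebesgue_on D) (\<lambda>x. \<bar>g x\<bar>)" using g by simp
    show "AE x in lebesgue_on D. (\<lambda>n. \<phi> n x * g x) \<longlonglongrightarrow> indicator U x * g x"
      by (intro AE_I2 tendsto_mult_right \<phi>)
    show "AE x in lebesgue_on D. norm (\<phi> n x * g x) \<le> \<bar>g x\<bar>" for n
      using \<phi>(2) by (intro AE_I2) (auto simp: abs_mult intro!: mult_left_le_one_le)
  qed
  moreover have "(\<integral>x. \<phi> n x * g x \<partial>lebesgue_on D) = 0" for n
    by (rule zero[OF test_field_mono[OF \<phi>(1) U(2)]])
  ultimately show ?thesis using LIMSEQ_unique[OF tendsto_const] by fastforce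
qed simp

text \<open>By outer regularity the integral of \<open>g\<close> over the set \<open>{g > 0}\<close> is a limit of integrals over open
  sets, and therefore zero.\<close>

lemma AE_le_0_if_orthogonal_to_test_fields:
  fixes g :: "real^3 \<Rightarrow> real"
  assumes D: "open D" and g: "integrable (lebesgue_on D) g"
    and zero: "\<And>\<phi> :: real^3 \<Rightarrow> real. test_field D \<phi> \<Longrightarrow> (\<integral>x. \<phi> x * g x \<partial>lebesgue_on D) = 0"
  shows "AE x in lebesgue_on D. g x \<le> 0"
proof -
  let ?M = "lebesgue_on D"
  define S where "S = {x \<in> space ?M. 0 < g x}"
  have SM: "S \<in> sets ?M" unfolding S_def using g by measurable
  have DS: "D \<in> sets lebesgue" using D by simp
  have SL: "S \<in> sets lebesgue" "S \<subseteq> D"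
    using SM DS by (auto simp: sets_restrict_space_iff S_def)
  obtain C T where C: "gdelta C" "T \<in> null_sets lebesgue" "S \<union> T = C" "disjnt S T"
    using lebesgue_set_almost_gdelta[OF SL(1)] by blast
  obtain W where W: "\<And>n::nat. open (W n)" "C = (\<Inter>n. W n)" using C(1) by (auto elim: gdelta.cases)
  define V where "V n = D \<inter> (\<Inter>k\<le>n. W k)" for n
  have V: "open (V n)" "V n \<subseteq> D" for n
    unfolding V_def using D W(1) by (auto intro!: open_Int open_INT)
  have "AE x in lebesgue. x \<notin> T" using C(2) by (simp add: AE_not_in)
  then have nT: "AE x in ?M. x \<notin> T" by (auto simp: AE_restrict_space_iff DS)
  have "(\<lambda>n. \<integral>x. indicator (V n) x * g x \<partial>?M) \<longlonglongrightarrow> (\<integral>x. indicator S x * g x \<partial>?M)"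
  proof (rule integral_dominated_convergence[where w = "\<lambda>x. \<bar>g x\<bar>"])
    show "(\<lambda>x. indicator S x * g x) \<in> borel_measurable ?M"
      using g SM by (intro borel_measurable_times borel_measurable_indicator) auto
    show "(\<lambda>x. indicator (V n) x * g x) \<in> borel_measurable ?M" for n
      using g V by (intro borel_measurable_times borel_measurable_indicator)
        (auto simp: sets_restrict_space intro!: image_eqI[of _ _ "V n"])
    show "integrable ?M (\<lambda>x. \<bar>g x\<bar>)" using g by simp
    show "AE x in ?M. (\<lambda>n. indicator (V n) x * g x) \<longlonglongrightarrow> indicator S x * g x"
      using nT AE_space
    proof eventually_elim
      case (elim x)
      have xD: "x \<in> D" using elim by simp
      show ?case
      proof (cases "x \<in> S")
        case True
        then have "x \<in> V n" for n using C W xD by (auto simp: V_def)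
        then show ?thesis using True by simp
      next
        case False
        then have "x \<notin> C" using C elim by auto
        then obtain m where m: "x \<notin> W m" using W by auto
        have "\<forall>\<^sub>F n in sequentially. indicator (V n) x * g x = indicator S x * g x"
          by (rule eventually_mono[OF eventually_ge_at_top[of m]]) (use False m in \<open>auto simp: V_def indicator_def\<close>)
        then show ?thesis by (rule tendsto_eventually)
      qed
    qed
    show "AE x in ?M. norm (indicator (V n) x * g x) \<le> \<bar>g x\<bar>" for n
      by (intro AE_I2) (auto simp: indicator_def)
  qed
  moreover have "(\<integral>x. indicator (V n) x * g x \<partial>?M) = 0" for n
    by (rule integral_over_open_eq_0[OF D g zero V])
  ultimately have "(\<integral>x. indicator S x * g x \<partial>?M) = 0"
    using LIMSEQ_unique[OF tendsto_const] by fastforce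
  moreover have "integrable ?M (\<lambda>x. indicator S x * g x)"
    using integrable_real_mult_indicator[OF SM g] by (simp add: mult.commute)
  moreover have "0 \<le> indicator S x * g x" for x by (auto simp: S_def indicator_def)
  ultimately have "AE x in ?M. indicator S x * g x = 0"
    by (subst (asm) integral_nonneg_eq_0_iff_AE) auto
  then show ?thesis
    using AE_space by eventually_elim (auto simp: S_def indicator_def split: if_splits)
qed

lemma test_field_scaleR:
  assumes "test_field D (\<phi> :: 'a::real_normed_vector \<Rightarrow> real)"
  shows "test_field D (\<lambda>x. \<phi> x *\<^sub>R v)"
proof -
  have "(\<phi> has_derivative frechet_derivative \<phi> (at x)) (at x)" for x
    using assms by (simp add: test_field_def C1_field_def frechet_derivative_works)
  then have "C1_field (\<lambda>x. \<phi> x *\<^sub>R v)"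
    using assms unfolding test_field_def C1_field_def[of \<phi>]
    by (intro C1_fieldI[where f' = "\<lambda>x h. frechet_derivative \<phi> (at x) h *\<^sub>R v"])
      (auto intro!: has_derivative_scaleR_left continuous_intros)
  then show ?thesis using assms by (auto simp: test_field_def)
qed

text \<open>The fundamental lemma for vector fields. It makes weak curls unique, and it shows that the mean of a
  random field vanishes if the means of its moments against test fields do.\<close>

proposition AE_eq_0_if_orthogonal_to_test_fields:
  fixes u :: "real^3 \<Rightarrow> real^3"
  assumes D: "open D" and u: "integrable (lebesgue_on D) u"
    and zero: "\<And>f. test_field D f \<Longrightarrow> L2_inner D u f = 0"
  shows "AE x in lebesgue_on D. u x = 0"
proof -
  have "AE x in lebesgue_on D. u x $ a = 0" for a
  proof -
    have g: "integrable (lebesgue_on D) (\<lambda>x. u x $ a)"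
      using integrable_inner_left[OF u, of "axis a 1"] by (simp add: inner_axis)
    have z: "(\<integral>x. \<phi> x * u x $ a \<partial>lebesgue_on D) = 0"
      if \<phi>: "test_field D (\<phi> :: real^3 \<Rightarrow> real)" for \<phi>
      using zero[OF test_field_scaleR[OF \<phi>, of "axis a 1"]]
      by (simp add: L2_inner_def inner_axis)
    have "AE x in lebesgue_on D. u x $ a \<le> 0"
      by (rule AE_le_0_if_orthogonal_to_test_fields[OF D g z])
    moreover have "AE x in lebesgue_on D. - (u x $ a) \<le> 0"
      using z g by (intro AE_le_0_if_orthogonal_to_test_fields[OF D]) auto
    ultimately show ?thesis by eventually_elim simp
  qed
  then have "AE x in lebesgue_on D. \<forall>a. u x $ a = 0" by (simp add: AE_all_countable)
  then show ?thesis by eventually_elim (simp add: vec_eq_iff)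
qed

section \<open>Weak curls\<close>

lemma finite_measure_domain: "open D \<Longrightarrow> bounded D \<Longrightarrow> finite_measure (lebesgue_on D)"
  for D :: "(real^3) set"
  by (intro finite_measure_lebesgue_on lmeasurable_open)

lemma compact_support_sq_integrable:
  fixes g :: "real^3 \<Rightarrow> 'b::euclidean_space"
  assumes D: "open D" "bounded D" and g: "continuous_on UNIV g" "compact K" "\<And>x. x \<notin> K \<Longrightarrow> g x = 0"
  shows "sq_integrable (lebesgue_on D) g" "\<exists>B. \<forall>x. norm (g x) \<le> B"
proof -
  have "bounded (g ` K)"
    using g by (intro compact_imp_bounded compact_continuous_image) (auto intro: continuous_on_subset)
  then obtain B where B: "\<And>x. x \<in> K \<Longrightarrow> norm (g x) \<le> B" by (auto simp: bounded_iff)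
  have bound: "norm (g x) \<le> max B 0" for x
    using B[of x] g(3)[of x] by (cases "x \<in> K") auto
  then show "\<exists>B. \<forall>x. norm (g x) \<le> B" by blast
  show "sq_integrable (lebesgue_on D) g"
  proof (rule bounded_sq_integrable[OF finite_measure_domain[OF D] _ bound])
    show "g \<in> borel_measurable (lebesgue_on D)"
      using g(1) D by (intro continuous_imp_measurable_on_sets_lebesgue) (auto intro: continuous_on_subset)
  qed
qed

lemma continuous_on_curl:
  assumes "C1_field f"
  shows "continuous_on UNIV (curl f)"
proof -
  have J: "continuous_on UNIV (\<lambda>x. jacobian f (at x) $ i $ j)" for i j
    using assms unfolding C1_field_def jacobian_def matrix_def
    by (auto intro!: continuous_intros)
  have "curl f = (\<lambda>x. (jacobian f (at x) $ 3 $ 2 - jacobian f (at x) $ 2 $ 3) *\<^sub>R axis 1 1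
      + (jacobian f (at x) $ 1 $ 3 - jacobian f (at x) $ 3 $ 1) *\<^sub>R axis 2 1
      + (jacobian f (at x) $ 2 $ 1 - jacobian f (at x) $ 1 $ 2) *\<^sub>R axis 3 1)"
    by (rule ext) (simp add: curl_def Let_def vec_eq_iff forall_3 vector_3 axis_def)
  then show ?thesis by (simp only:) (intro continuous_intros J)
qed

lemma curl_eq_0_outside_support:
  assumes "closed K" "\<And>x. x \<notin> K \<Longrightarrow> f x = 0" "x \<notin> K"
  shows "curl f x = 0"
proof -
  have "jacobian f (at x) = 0"
    by (rule jacobian_cong_open[where D = "- K" and g = "\<lambda>_. 0"]) (use assms in auto)
  then show ?thesis by (simp add: curl_def Let_def vec_eq_iff forall_3 vector_3)
qed

lemma test_field_sq_integrable:
  assumes D: "open D" "bounded D" and f: "test_field D f"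
  shows "sq_integrable (lebesgue_on D) f" "sq_integrable (lebesgue_on D) (curl f)"
    "\<exists>B. \<forall>x. norm (f x) \<le> B" "\<exists>B. \<forall>x. norm (curl f x) \<le> B"
proof -
  obtain K where K: "compact K" "\<And>x. x \<notin> K \<Longrightarrow> f x = 0" and C1: "C1_field f"
    using f unfolding test_field_def by blast
  have "continuous_on UNIV f"
    using C1 unfolding C1_field_def
    by (intro continuous_at_imp_continuous_on ballI differentiable_imp_continuous_within) auto
  from compact_support_sq_integrable[OF D this K]
  show "sq_integrable (lebesgue_on D) f" "\<exists>B. \<forall>x. norm (f x) \<le> B" by auto
  have "curl f x = 0" if "x \<notin> K" for x
    using curl_eq_0_outside_support[OF compact_imp_closed[OF K(1)] K(2) that] .
  from compact_support_sq_integrable[OF D continuous_on_curl[OF C1] K(1) this]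
  show "sq_integrable (lebesgue_on D) (curl f)" "\<exists>B. \<forall>x. norm (curl f x) \<le> B" by auto
qed

lemma L2_inner_lincomb:
  assumes "sq_integrable (lebesgue_on D) u" "sq_integrable (lebesgue_on D) u'"
    "sq_integrable (lebesgue_on D) f"
  shows "L2_inner D (\<lambda>x. a *\<^sub>R u x + b *\<^sub>R u' x) f = a * L2_inner D u f + b * L2_inner D u' f"
  unfolding L2_inner_def
  using sq_integrable_inner[OF assms(1,3)] sq_integrable_inner[OF assms(2,3)]
  by (simp add: inner_add_left)

lemma L2_inner_cong_AE:
  assumes "AE x in lebesgue_on D. u x = u' x" "u \<in> borel_measurable (lebesgue_on D)"
    "u' \<in> borel_measurable (lebesgue_on D)" "f \<in> borel_measurable (lebesgue_on D)"
  shows "L2_inner D u f = L2_inner D u' f"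
  unfolding L2_inner_def using assms by (intro integral_cong_AE) auto

lemma sq_integrable_cong_AE:
  assumes "sq_integrable \<mu> u" "AE x in \<mu>. u x = u' x" "u' \<in> borel_measurable \<mu>"
  shows "sq_integrable \<mu> u'"
proof -
  have "integrable \<mu> (\<lambda>x. (norm (u x))\<^sup>2) \<longleftrightarrow> integrable \<mu> (\<lambda>x. (norm (u' x))\<^sup>2)"
    using assms by (intro integrable_cong_AE) (auto simp: sq_integrable_def)
  then show ?thesis using assms by (simp add: sq_integrable_def)
qed

lemma has_weak_curl_lincomb:
  assumes D: "open D" "bounded D" and u: "has_weak_curl D u v" and u': "has_weak_curl D u' v'"
  shows "has_weak_curl D (\<lambda>x. a *\<^sub>R u x + b *\<^sub>R u' x) (\<lambda>x. a *\<^sub>R v x + b *\<^sub>R v' x)"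
  unfolding has_weak_curl_def
  using u u' test_field_sq_integrable[OF D]
  by (auto simp: has_weak_curl_def L2_inner_lincomb intro!: sq_integrable_add sq_integrable_scaleR)

lemma has_weak_curl_cong_AE:
  assumes D: "open D" "bounded D" and u: "has_weak_curl D u v"
    and "AE x in lebesgue_on D. u x = u' x" "u' \<in> borel_measurable (lebesgue_on D)"
    and "AE x in lebesgue_on D. v x = v' x" "v' \<in> borel_measurable (lebesgue_on D)"
  shows "has_weak_curl D u' v'"
  unfolding has_weak_curl_def
proof (intro conjI allI impI)
  show "sq_integrable (lebesgue_on D) u'" "sq_integrable (lebesgue_on D) v'"
    using assms by (auto simp: has_weak_curl_def intro: sq_integrable_cong_AE)
  fix f :: "real^3 \<Rightarrow> real^3" assume f: "test_field D f"
  have "L2_inner D v' f = L2_inner D v f"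
    using assms test_field_sq_integrable(1)[OF D f]
    by (intro L2_inner_cong_AE[symmetric]) (auto simp: has_weak_curl_def sq_integrable_def)
  also have "\<dots> = L2_inner D u (curl f)" using u f by (simp add: has_weak_curl_def)
  also have "\<dots> = L2_inner D u' (curl f)"
    using assms test_field_sq_integrable(2)[OF D f]
    by (intro L2_inner_cong_AE) (auto simp: has_weak_curl_def sq_integrable_def)
  finally show "L2_inner D v' f = L2_inner D u' (curl f)" .
qed

text \<open>By the fundamental lemma, the arbitrary choice of a weak curl in \<open>wcurl\<close> affects no norm.\<close>

lemma has_weak_curl_unique:
  assumes D: "open D" "bounded D" and u: "has_weak_curl D u v" and u': "has_weak_curl D u' v'"
    and eq: "AE x in lebesgue_on D. u x = u' x"
  shows "AE x in lebesgue_on D. v x = v' x"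
proof -
  have w: "has_weak_curl D (\<lambda>x. 1 *\<^sub>R u x + (-1) *\<^sub>R u' x) (\<lambda>x. 1 *\<^sub>R v x + (-1) *\<^sub>R v' x)"
    (is "has_weak_curl D ?u ?v") by (rule has_weak_curl_lincomb[OF D u u'])
  have "AE x in lebesgue_on D. ?v x = 0"
  proof (rule AE_eq_0_if_orthogonal_to_test_fields[OF D(1)])
    show "integrable (lebesgue_on D) ?v"
      using w finite_measure_domain[OF D] by (intro sq_integrable_imp_integrable) (auto simp: has_weak_curl_def)
    fix f :: "real^3 \<Rightarrow> real^3" assume f: "test_field D f"
    have "L2_inner D ?v f = L2_inner D ?u (curl f)" using w f by (simp only: has_weak_curl_def)
    also have "\<dots> = L2_inner D (\<lambda>_. 0) (curl f)"
      using w eq test_field_sq_integrable(2)[OF D f]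
      by (intro L2_inner_cong_AE) (auto simp: has_weak_curl_def sq_integrable_def)
    finally show "L2_inner D ?v f = 0" by (simp add: L2_inner_def)
  qed
  then show ?thesis by eventually_elim simp
qed

lemma wcurl_works: "u \<in> Hcurl D \<Longrightarrow> has_weak_curl D u (wcurl D u)"
  unfolding Hcurl_def wcurl_def mem_Collect_eq by (rule someI_ex[of "has_weak_curl D u"])

lemma HcurlI: "has_weak_curl D u v \<Longrightarrow> u \<in> Hcurl D"
  by (auto simp: Hcurl_def)

text \<open>The norm of \<open>H(curl)\<close> is the \<open>L\<^sup>2\<close> norm on the graph of the curl; this reduces its properties
  to those of \<open>L\<^sup>2\<close> norms.\<close>

lemma Hcurl_norm_graph:
  assumes D: "open D" "bounded D" and u: "has_weak_curl D u v"
  shows "sq_integrable (lebesgue_on D) (\<lambda>x. (u x, v x))"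
    "Hcurl_norm D u = sqrt (\<integral>x. (norm (u x, v x))\<^sup>2 \<partial>lebesgue_on D)"
proof -
  have sq: "sq_integrable (lebesgue_on D) u" "sq_integrable (lebesgue_on D) v"
    using u by (auto simp: has_weak_curl_def)
  have n: "(norm (u x, v x))\<^sup>2 = (norm (u x))\<^sup>2 + (norm (v x))\<^sup>2" for x
    by (simp add: norm_Pair)
  show "sq_integrable (lebesgue_on D) (\<lambda>x. (u x, v x))"
    unfolding sq_integrable_def n using sq by (auto simp: sq_integrable_def)
  let ?w = "wcurl D u"
  have w: "has_weak_curl D u ?w" by (rule wcurl_works[OF HcurlI[OF u]])
  have "AE x in lebesgue_on D. v x = ?w x" by (rule has_weak_curl_unique[OF D u w]) simp
  then have "L2_inner D ?w ?w = L2_inner D v v"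
    unfolding L2_inner_def using u w
    by (intro integral_cong_AE) (auto simp: has_weak_curl_def sq_integrable_def)
  then have "Hcurl_norm D u = sqrt (L2_inner D u u + L2_inner D v v)" by (simp add: Hcurl_norm_def)
  also have "L2_inner D u u + L2_inner D v v = (\<integral>x. (norm (u x, v x))\<^sup>2 \<partial>lebesgue_on D)"
    unfolding L2_inner_def n using sq by (simp add: sq_integrable_def power2_norm_eq_inner)
  finally show "Hcurl_norm D u = sqrt (\<integral>x. (norm (u x, v x))\<^sup>2 \<partial>lebesgue_on D)" .
qed

lemma Hcurl_norm_nonneg: "0 \<le> Hcurl_norm D u"
  unfolding Hcurl_norm_def L2_inner_def
  by (auto intro!: real_sqrt_ge_zero add_nonneg_nonneg)

lemma Hcurl_norm_sq:
  assumes D: "open D" "bounded D" and u: "has_weak_curl D u v"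
  shows "(Hcurl_norm D u)\<^sup>2 = (\<integral>x. (norm (u x))\<^sup>2 \<partial>lebesgue_on D) + (\<integral>x. (norm (v x))\<^sup>2 \<partial>lebesgue_on D)"
  using u unfolding Hcurl_norm_graph(2)[OF D u]
  by (simp add: norm_Pair has_weak_curl_def sq_integrable_def)

lemma Hcurl_lincomb:
  assumes D: "open D" "bounded D" and "u \<in> Hcurl D" "v \<in> Hcurl D"
  shows "(\<lambda>x. a *\<^sub>R u x + b *\<^sub>R v x) \<in> Hcurl D"
  using assms unfolding Hcurl_def by (auto intro: has_weak_curl_lincomb[OF D])

lemma Hcurl_norm_scale:
  assumes D: "open D" "bounded D" and u: "u \<in> Hcurl D"
  shows "Hcurl_norm D (\<lambda>x. a *\<^sub>R u x) = \<bar>a\<bar> * Hcurl_norm D u"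
proof -
  have w: "has_weak_curl D u (wcurl D u)" by (rule wcurl_works[OF u])
  have "has_weak_curl D (\<lambda>x. a *\<^sub>R u x + 0 *\<^sub>R u x) (\<lambda>x. a *\<^sub>R wcurl D u x + 0 *\<^sub>R wcurl D u x)"
    by (rule has_weak_curl_lincomb[OF D w w])
  then have "has_weak_curl D (\<lambda>x. a *\<^sub>R u x) (\<lambda>x. a *\<^sub>R wcurl D u x)" by simp
  from Hcurl_norm_graph(2)[OF D this]
  have "Hcurl_norm D (\<lambda>x. a *\<^sub>R u x)
      = sqrt (\<integral>x. a\<^sup>2 * (norm (u x, wcurl D u x))\<^sup>2 \<partial>lebesgue_on D)"
    by (simp add: scaleR_Pair[symmetric] power_mult_distrib del: scaleR_Pair)
  also have "\<dots> = \<bar>a\<bar> * Hcurl_norm D u"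
    by (simp add: Hcurl_norm_graph(2)[OF D w] real_sqrt_mult)
  finally show ?thesis .
qed

lemma Hcurl_norm_add:
  assumes D: "open D" "bounded D" and u: "u \<in> Hcurl D" "v \<in> Hcurl D"
  shows "Hcurl_norm D (\<lambda>x. u x + v x) \<le> Hcurl_norm D u + Hcurl_norm D v"
proof -
  note w = u[THEN wcurl_works]
  have "has_weak_curl D (\<lambda>x. u x + v x) (\<lambda>x. wcurl D u x + wcurl D v x)"
    using has_weak_curl_lincomb[OF D w, of 1 1] by simp
  from Hcurl_norm_graph(2)[OF D this] show ?thesis
    using sq_integrable_Minkowski[OF w[THEN Hcurl_norm_graph(1)[OF D]]]
    by (simp add: w[THEN Hcurl_norm_graph(2)[OF D]])
qed

lemma Hcurl_norm_cong_AE: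
  assumes D: "open D" "bounded D" and u: "u \<in> Hcurl D" "v \<in> Hcurl D"
    and eq: "AE x in lebesgue_on D. u x = v x"
  shows "Hcurl_norm D u = Hcurl_norm D v"
proof -
  note w = u[THEN wcurl_works]
  have "AE x in lebesgue_on D. (norm (u x, wcurl D u x))\<^sup>2 = (norm (v x, wcurl D v x))\<^sup>2"
    using eq has_weak_curl_unique[OF D w eq] by eventually_elim simp
  then have "(\<integral>x. (norm (u x, wcurl D u x))\<^sup>2 \<partial>lebesgue_on D) = (\<integral>x. (norm (v x, wcurl D v x))\<^sup>2 \<partial>lebesgue_on D)"
    using w[THEN Hcurl_norm_graph(1)[OF D]] by (intro integral_cong_AE) (auto simp: sq_integrable_def)
  then show ?thesis by (simp add: w[THEN Hcurl_norm_graph(2)[OF D]])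
qed

lemma Hcurl_cong_AE:
  assumes D: "open D" "bounded D" and u: "u \<in> Hcurl D"
    and eq: "AE x in lebesgue_on D. u x = v x" and v: "v \<in> borel_measurable (lebesgue_on D)"
  shows "v \<in> Hcurl D"
proof -
  note w = u[THEN wcurl_works]
  have "has_weak_curl D v (wcurl D u)"
    using w by (intro has_weak_curl_cong_AE[OF D w eq v]) (auto simp: has_weak_curl_def sq_integrable_def)
  then show ?thesis by (rule HcurlI)
qed

lemma zero_in_Hcurl: "(\<lambda>_. 0) \<in> Hcurl D"
  unfolding Hcurl_def has_weak_curl_def sq_integrable_def L2_inner_def by (auto intro!: exI[of _ "\<lambda>_. 0"])

lemma Hcurl_add: "\<lbrakk>open D; bounded D; u \<in> Hcurl D; v \<in> Hcurl D\<rbrakk> \<Longrightarrow> (\<lambda>x. u x + v x) \<in> Hcurl D"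
  using Hcurl_lincomb[of D u v 1 1] by simp

lemma Hcurl_diff: "\<lbrakk>open D; bounded D; u \<in> Hcurl D; v \<in> Hcurl D\<rbrakk> \<Longrightarrow> (\<lambda>x. u x - v x) \<in> Hcurl D"
  using Hcurl_lincomb[of D u v 1 "-1"] by simp

lemma Hcurl_scale: "\<lbrakk>open D; bounded D; u \<in> Hcurl D\<rbrakk> \<Longrightarrow> (\<lambda>x. a *\<^sub>R u x) \<in> Hcurl D"
  using Hcurl_lincomb[of D u u a 0] by simp

lemma Hcurl_norm_diff_commute:
  assumes D: "open D" "bounded D" and "u \<in> Hcurl D" "v \<in> Hcurl D"
  shows "Hcurl_norm D (\<lambda>x. u x - v x) = Hcurl_norm D (\<lambda>x. v x - u x)"
  using Hcurl_norm_scale[OF D Hcurl_diff[OF D assms(4,3)], of "-1"] by (simp add: algebra_simps)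

lemma Hcurl_sum:
  assumes D: "open D" "bounded D" and "\<And>k. k \<in> S \<Longrightarrow> u k \<in> Hcurl D"
  shows "(\<lambda>x. \<Sum>k\<in>S. u k x) \<in> Hcurl D"
  using assms(3) by (induction S rule: infinite_finite_induct) (auto intro: zero_in_Hcurl Hcurl_add[OF D])

lemma Hcurl_norm_sum:
  assumes D: "open D" "bounded D" and u: "\<And>k. k \<in> S \<Longrightarrow> u k \<in> Hcurl D"
  shows "Hcurl_norm D (\<lambda>x. \<Sum>k\<in>S. u k x) \<le> (\<Sum>k\<in>S. Hcurl_norm D (u k))"
proof -
  have z: "Hcurl_norm D (\<lambda>_. 0) = 0"
    using Hcurl_norm_scale[OF D zero_in_Hcurl, of 0] by simp
  show ?thesis
    using u
  proof (induction S rule: infinite_finite_induct)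
    case (insert k S)
    have "Hcurl_norm D (\<lambda>x. u k x + (\<Sum>j\<in>S. u j x)) \<le> Hcurl_norm D (u k) + Hcurl_norm D (\<lambda>x. \<Sum>j\<in>S. u j x)"
      using insert by (intro Hcurl_norm_add[OF D] Hcurl_sum[OF D]) auto
    with insert show ?case by simp
  qed (simp_all add: z)
qed

lemma L2_inner_le_Hcurl_norm:
  assumes D: "open D" "bounded D" and u: "u \<in> Hcurl D" and f: "sq_integrable (lebesgue_on D) f"
  shows "\<bar>L2_inner D u f\<bar> \<le> Hcurl_norm D u * sqrt (\<integral>x. (norm (f x))\<^sup>2 \<partial>lebesgue_on D)"
proof -
  note w = wcurl_works[OF u]
  have su: "sq_integrable (lebesgue_on D) u" using w by (simp add: has_weak_curl_def)
  have "\<bar>L2_inner D u f\<bar> \<le> (\<integral>x. norm (u x \<bullet> f x) \<partial>lebesgue_on D)"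
    unfolding L2_inner_def using integral_norm_bound[of "lebesgue_on D" "\<lambda>x. u x \<bullet> f x"] by simp
  also have "\<dots> \<le> (\<integral>x. norm (u x) * norm (f x) \<partial>lebesgue_on D)"
    using sq_integrable_inner[OF su f] sq_integrable_norm_mult[OF su f]
    by (intro integral_mono) (auto simp: Cauchy_Schwarz_ineq2)
  also have "\<dots> \<le> sqrt (\<integral>x. (norm (u x))\<^sup>2 \<partial>lebesgue_on D) * sqrt (\<integral>x. (norm (f x))\<^sup>2 \<partial>lebesgue_on D)"
    by (rule sq_integrable_Cauchy_Schwarz[OF su f])
  also have "\<dots> \<le> Hcurl_norm D u * sqrt (\<integral>x. (norm (f x))\<^sup>2 \<partial>lebesgue_on D)"
  proof (rule mult_right_mono)
    have "(\<integral>x. (norm (u x))\<^sup>2 \<partial>lebesgue_on D) \<le> (Hcurl_norm D u)\<^sup>2"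
      unfolding Hcurl_norm_sq[OF D w] by simp
    then show "sqrt (\<integral>x. (norm (u x))\<^sup>2 \<partial>lebesgue_on D) \<le> Hcurl_norm D u"
      by (rule real_le_lsqrt[OF Hcurl_norm_nonneg])
  qed simp
  finally show ?thesis .
qed

section \<open>The trajectory to first order\<close>

text \<open>Fields with \<open>m\<close> columns are measured column by column, as in the theorem.\<close>

definition col_Hcurl :: "(real^3) set \<Rightarrow> 'm \<Rightarrow> (real^3 \<Rightarrow> real^'m^3) set" where
  "col_Hcurl D i = {U. (\<lambda>x. column i (U x)) \<in> Hcurl D}"

definition col_norm :: "(real^3) set \<Rightarrow> 'm \<Rightarrow> (real^3 \<Rightarrow> real^'m^3) \<Rightarrow> real" where
  "col_norm D i U = Hcurl_norm D (\<lambda>x. column i (U x))"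

lemma column_linear:
  "column i (A + B) = column i A + column i B" "column i (A - B) = column i A - column i B"
  "column i (c *\<^sub>R A) = c *\<^sub>R column i A" "column i 0 = 0"
  for A B :: "real^'m^'n"
  by (simp_all add: column_def vec_eq_iff)

lemma column_sum: "column i (\<Sum>k\<in>S. A k) = (\<Sum>k\<in>S. column i (A k :: real^'m^'n))"
  by (induction S rule: infinite_finite_induct) (simp_all add: column_linear)

context
  fixes D :: "(real^3) set"
  assumes D: "open D" "bounded D"
begin

lemma col_Hcurl_diff: "U \<in> col_Hcurl D i \<Longrightarrow> V \<in> col_Hcurl D i \<Longrightarrow> (\<lambda>x. U x - V x) \<in> col_Hcurl D i"
  by (simp add: col_Hcurl_def column_linear Hcurl_diff[OF D])

lemma col_Hcurl_scale: "U \<in> col_Hcurl D i \<Longrightarrow> (\<lambda>x. c *\<^sub>R U x) \<in> col_Hcurl D i"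
  by (simp add: col_Hcurl_def column_linear Hcurl_scale[OF D])

lemma col_Hcurl_sum: "(\<And>k. k \<in> S \<Longrightarrow> U k \<in> col_Hcurl D i) \<Longrightarrow> (\<lambda>x. \<Sum>k\<in>S. U k x) \<in> col_Hcurl D i"
  by (simp add: col_Hcurl_def column_sum Hcurl_sum[OF D])

lemma col_norm_scale: "U \<in> col_Hcurl D i \<Longrightarrow> col_norm D i (\<lambda>x. c *\<^sub>R U x) = \<bar>c\<bar> * col_norm D i U"
  by (simp add: col_Hcurl_def col_norm_def column_linear Hcurl_norm_scale[OF D])

lemma col_norm_sum:
  "(\<And>k. k \<in> S \<Longrightarrow> U k \<in> col_Hcurl D i) \<Longrightarrow> col_norm D i (\<lambda>x. \<Sum>k\<in>S. U k x) \<le> (\<Sum>k\<in>S. col_norm D i (U k))"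
  by (simp add: col_Hcurl_def col_norm_def column_sum Hcurl_norm_sum[OF D])

lemma col_norm_add:
  "U \<in> col_Hcurl D i \<Longrightarrow> V \<in> col_Hcurl D i \<Longrightarrow> col_norm D i (\<lambda>x. U x + V x) \<le> col_norm D i U + col_norm D i V"
  by (simp add: col_Hcurl_def col_norm_def column_linear Hcurl_norm_add[OF D])

lemma col_norm_triangle:
  assumes "U \<in> col_Hcurl D i" "V \<in> col_Hcurl D i" "W \<in> col_Hcurl D i"
  shows "col_norm D i (\<lambda>x. U x - W x) \<le> col_norm D i (\<lambda>x. U x - V x) + col_norm D i (\<lambda>x. V x - W x)"
  using col_norm_add[OF col_Hcurl_diff[OF assms(1,2)] col_Hcurl_diff[OF assms(2,3)]] by simp

lemma col_norm_commute:
  "U \<in> col_Hcurl D i \<Longrightarrow> V \<in> col_Hcurl D i \<Longrightarrow> col_norm D i (\<lambda>x. U x - V x) = col_norm D i (\<lambda>x. V x - U x)"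
  unfolding col_Hcurl_def col_norm_def column_linear mem_Collect_eq by (rule Hcurl_norm_diff_commute[OF D])

lemma col_norm_cong_AE:
  assumes "U \<in> col_Hcurl D i" "V \<in> col_Hcurl D i" "AE x in lebesgue_on D. U x = V x"
  shows "col_norm D i U = col_norm D i V"
proof -
  have "AE x in lebesgue_on D. column i (U x) = column i (V x)" using assms(3) by eventually_elim simp
  with assms(1,2) show ?thesis
    unfolding col_Hcurl_def col_norm_def mem_Collect_eq by (rule Hcurl_norm_cong_AE[OF D])
qed

lemma col_norm_nonneg: "0 \<le> col_norm D i U"
  by (simp add: col_norm_def Hcurl_norm_nonneg)

end

lemma Hcurl0_subset: "u \<in> Hcurl0 D \<Longrightarrow> u \<in> Hcurl D"
  by (simp add: Hcurl0_def)

lemma coeff_perturbation_bounded: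
  assumes "h \<in> coeff_perturbations D" obtains B where "\<And>y. y \<in> D \<Longrightarrow> norm (h y) \<le> B"
proof -
  have "bounded (h ` D)" using assms by (simp add: coeff_perturbations_def)
  then show thesis using that unfolding bounded_iff by auto
qed

text \<open>The properties of the linear term \<open>(F1, L1)\<close> of a power series. \<open>F1\<close> is linear only almost everywhere,
  since its values represent classes of fields.\<close>

definition bounded_linear_coeff_maps ::
    "(real^3) set \<Rightarrow> real \<Rightarrow> ((real^3 \<Rightarrow> (real^3^3) \<times> (real^3^3)) \<Rightarrow> real^3 \<Rightarrow> real^'m^3) \<Rightarrow>
     ((real^3 \<Rightarrow> (real^3^3) \<times> (real^3^3)) \<Rightarrow> real^'m^'m) \<Rightarrow> bool" where
  "bounded_linear_coeff_maps D K F1 L1 \<longleftrightarrow>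
     (\<forall>g\<in>coeff_perturbations D. (\<forall>i. F1 g \<in> col_Hcurl D i \<and> col_norm D i (F1 g) \<le> K * sup_norm D g) \<and>
        norm (L1 g) \<le> K * sup_norm D g) \<and>
     (\<forall>g\<in>coeff_perturbations D. \<forall>g'\<in>coeff_perturbations D. \<forall>a b.
        (AE x in lebesgue_on D. F1 (\<lambda>x. a *\<^sub>R g x + b *\<^sub>R g' x) x = a *\<^sub>R F1 g x + b *\<^sub>R F1 g' x) \<and>
        L1 (\<lambda>x. a *\<^sub>R g x + b *\<^sub>R g' x) = a *\<^sub>R L1 g + b *\<^sub>R L1 g')"

lemma bounded_linear_coeff_mapsD:
  assumes "bounded_linear_coeff_maps D K F1 L1" and g: "g \<in> coeff_perturbations D"
  shows "F1 g \<in> col_Hcurl D i" "col_norm D i (F1 g) \<le> K * sup_norm D g" "norm (L1 g) \<le> K * sup_norm D g"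
    "g' \<in> coeff_perturbations D \<Longrightarrow>
       AE x in lebesgue_on D. F1 (\<lambda>x. a *\<^sub>R g x + b *\<^sub>R g' x) x = a *\<^sub>R F1 g x + b *\<^sub>R F1 g' x"
    "g' \<in> coeff_perturbations D \<Longrightarrow> L1 (\<lambda>x. a *\<^sub>R g x + b *\<^sub>R g' x) = a *\<^sub>R L1 g + b *\<^sub>R L1 g'"
  using assms(1)[unfolded bounded_linear_coeff_maps_def, THEN conjunct1, rule_format, OF g]
    assms(1)[unfolded bounded_linear_coeff_maps_def, THEN conjunct2, rule_format, OF g] by simp_all

lemma norm_le_sup_norm:
  assumes "h \<in> coeff_perturbations D" "x \<in> D"
  shows "norm (h x) \<le> sup_norm D h"
  unfolding sup_norm_def
proof (rule cSUP_upper[OF assms(2)])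
  obtain B where B: "\<And>y. y \<in> D \<Longrightarrow> norm (h y) \<le> B"
    by (rule coeff_perturbation_bounded[OF assms(1)]) (rule that)
  show "bdd_above ((\<lambda>x. norm (h x)) ` D)" by (rule bdd_aboveI2[where M = B]) (rule B)
qed

lemma sup_norm_nonneg:
  assumes "h \<in> coeff_perturbations D" "D \<noteq> {}" shows "0 \<le> sup_norm D h"
proof -
  obtain x where "x \<in> D" using assms(2) by blast
  from norm_le_sup_norm[OF assms(1) this] show ?thesis by (rule order_trans[OF norm_ge_zero])
qed

lemma sup_norm_le: "D \<noteq> {} \<Longrightarrow> (\<And>x. x \<in> D \<Longrightarrow> norm (h x) \<le> B) \<Longrightarrow> sup_norm D h \<le> B"
  unfolding sup_norm_def by (rule cSUP_least)

lemma coeff_perturbations_lincomb: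
  assumes "g \<in> coeff_perturbations D" "h \<in> coeff_perturbations D"
  shows "(\<lambda>x. a *\<^sub>R g x + b *\<^sub>R h x) \<in> coeff_perturbations D"
proof -
  have t: "transpose (a *\<^sub>R X + b *\<^sub>R Y) = a *\<^sub>R transpose X + b *\<^sub>R transpose Y" for X Y :: "real^3^3"
    by (simp add: transpose_def vec_eq_iff)
  obtain A where A: "\<And>y. y \<in> D \<Longrightarrow> norm (g y) \<le> A" by (rule coeff_perturbation_bounded[OF assms(1)]) (rule that)
  obtain B where B: "\<And>y. y \<in> D \<Longrightarrow> norm (h y) \<le> B" by (rule coeff_perturbation_bounded[OF assms(2)]) (rule that)
  have "norm (a *\<^sub>R g x + b *\<^sub>R h x) \<le> \<bar>a\<bar> * A + \<bar>b\<bar> * B" if "x \<in> D" for x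
    using A[OF that] B[OF that] by (intro norm_triangle_le add_mono) (auto intro: mult_left_mono)
  then have "bounded ((\<lambda>x. a *\<^sub>R g x + b *\<^sub>R h x) ` D)" by (auto simp: bounded_iff)
  with assms show ?thesis
    by (auto simp: coeff_perturbations_def t intro!: continuous_intros)
qed

text \<open>An analytic map is affine up to a quadratic error near \<open>(I, I)\<close>: for \<open>q \<le> 1/2\<close> the tail
  \<open>\<Sum>\<^sub>k\<^sub>\<ge>\<^sub>2 K q\<^sup>k\<close> of the power series is at most \<open>2 K q\<^sup>2\<close>.\<close>

lemma analytic_first_order:
  fixes F :: "(real^3 \<Rightarrow> (real^3^3) \<times> (real^3^3)) \<Rightarrow> real^3 \<Rightarrow> real^'m^3"
  assumes D: "open D" "bounded D" "D \<noteq> {}" and an: "analytic_at_identity D F L"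
  obtains r K F0 F1 L0 L1 where "r > 0" "K > 0"
    "\<And>i. F0 \<in> col_Hcurl D i"
    "bounded_linear_coeff_maps D K F1 L1"
    "\<And>i h. h \<in> coeff_perturbations D \<Longrightarrow> sup_norm D h \<le> r \<Longrightarrow>
       F (\<lambda>y. identity_coeffs y + h y) \<in> col_Hcurl D i \<and>
       col_norm D i (\<lambda>x. F (\<lambda>y. identity_coeffs y + h y) x - F0 x - F1 h x) \<le> K * (sup_norm D h)\<^sup>2"
    "\<And>h. h \<in> coeff_perturbations D \<Longrightarrow> sup_norm D h \<le> r \<Longrightarrow>
       norm (L (\<lambda>y. identity_coeffs y + h y) - L0 - L1 h) \<le> K * (sup_norm D h)\<^sup>2"
proof -
  note D' = D(1,2)
  let ?cp = "coeff_perturbations D"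
  obtain r K PF PL where r: "r > 0"
    and bnd: "\<forall>hs\<in>lists ?cp. (\<forall>i. (\<lambda>x. column i (PF hs x)) \<in> Hcurl0 D \<and>
             Hcurl_norm D (\<lambda>x. column i (PF hs x)) \<le> K * (\<Prod>h\<leftarrow>hs. sup_norm D h / r)) \<and>
        norm (PL hs) \<le> K * (\<Prod>h\<leftarrow>hs. sup_norm D h / r)"
    and lin: "\<forall>xs\<in>lists ?cp. \<forall>ys\<in>lists ?cp. \<forall>g\<in>?cp. \<forall>h\<in>?cp. \<forall>a b.
        (AE x in lebesgue_on D. PF (xs @ (\<lambda>x. a *\<^sub>R g x + b *\<^sub>R h x) # ys) x
            = a *\<^sub>R PF (xs @ g # ys) x + b *\<^sub>R PF (xs @ h # ys) x) \<and>
        PL (xs @ (\<lambda>x. a *\<^sub>R g x + b *\<^sub>R h x) # ys)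
            = a *\<^sub>R PL (xs @ g # ys) + b *\<^sub>R PL (xs @ h # ys)"
    and ser: "\<forall>h\<in>?cp. sup_norm D h < r \<longrightarrow>
        (\<forall>i. (\<lambda>x. column i (F (\<lambda>y. identity_coeffs y + h y) x)) \<in> Hcurl0 D \<and>
             (\<lambda>N. Hcurl_norm D (\<lambda>x. column i (F (\<lambda>y. identity_coeffs y + h y) x
                                              - (\<Sum>k<N. PF (replicate k h) x)))) \<longlonglongrightarrow> 0) \<and>
        (\<lambda>k. PL (replicate k h)) sums L (\<lambda>y. identity_coeffs y + h y)"
    using an unfolding analytic_at_identity_def by (elim exE conjE) (rule that)
  have bL: "norm (PL hs) \<le> K * (\<Prod>h\<leftarrow>hs. sup_norm D h / r)" if "hs \<in> lists ?cp" for hs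
    using bspec[OF bnd that] by (rule conjunct2)
  have linF: "AE x in lebesgue_on D. PF [\<lambda>x. a *\<^sub>R g x + b *\<^sub>R h x] x = a *\<^sub>R PF [g] x + b *\<^sub>R PF [h] x"
    and linL: "PL [\<lambda>x. a *\<^sub>R g x + b *\<^sub>R h x] = a *\<^sub>R PL [g] + b *\<^sub>R PL [h]"
    if "g \<in> ?cp" "h \<in> ?cp" for g h a b
    using lin[rule_format, of "[]" "[]" g h a b] that by simp_all
  have bF1: "PF hs \<in> col_Hcurl D i" "col_norm D i (PF hs) \<le> K * (\<Prod>h\<leftarrow>hs. sup_norm D h / r)"
    if "hs \<in> lists ?cp" for hs i
    using bspec[OF bnd that] by (auto simp: col_Hcurl_def col_norm_def Hcurl0_subset)
  have ser1: "F (\<lambda>y. identity_coeffs y + h y) \<in> col_Hcurl D i"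
    "(\<lambda>N. col_norm D i (\<lambda>x. F (\<lambda>y. identity_coeffs y + h y) x - (\<Sum>k<N. PF (replicate k h) x))) \<longlonglongrightarrow> 0"
    if "h \<in> ?cp" "sup_norm D h < r" for h i
    using ser[rule_format, OF that] by (auto simp: col_Hcurl_def col_norm_def Hcurl0_subset)
  have "0 \<le> norm (PL [])" by simp
  also have "\<dots> \<le> K" using bL[of "[]"] by simp
  finally have K: "0 \<le> K" .
  \<comment> \<open>The first summand serves the linear term, the second the tail \<open>2 K q\<^sup>2\<close> with \<open>q = |h| / r\<close>; the last one makes
    \<open>K'\<close> positive.\<close>
  define K' where "K' = K / r + 2 * K / r\<^sup>2 + 1"
  have K': "K / r \<le> K'" "2 * K / r\<^sup>2 \<le> K'" "0 < K'"
    using K r by (auto simp: K'_def add_nonneg_pos)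
  have pw: "(\<Prod>h'\<leftarrow>replicate k h. sup_norm D h' / r) = (sup_norm D h / r) ^ k" for k h
    by (simp add: map_replicate)
  have tail: "(\<Sum>k\<in>{2..<N}. K * q ^ k) \<le> 2 * K * q\<^sup>2" if q: "0 \<le> q" "q \<le> 1/2" for q N
  proof -
    have "(\<Sum>k\<in>{2..<2 + n}. q ^ k) \<le> 2 * q\<^sup>2 - 2 * q ^ (2 + n)" for n
    proof (induction n)
      case (Suc n)
      have "q * q ^ (2 + n) \<le> 1/2 * q ^ (2 + n)" using q by (intro mult_right_mono) auto
      with Suc show ?case by simp
    qed simp
    note geometric = this
    have "(\<Sum>k\<in>{2..<N}. q ^ k) \<le> 2 * q\<^sup>2"
    proof (cases "2 \<le> N")
      case True
      then have N: "N = 2 + (N - 2)" by simp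
      have "0 \<le> 2 * q ^ (2 + (N - 2))" using q by simp
      then show ?thesis using geometric[of "N - 2"] unfolding N[symmetric] by linarith
    qed (use q in auto)
    from mult_left_mono[OF this K] show ?thesis by (simp add: sum_distrib_left)
  qed
  show thesis
  proof (rule that[of "r / 2" K' "PF []" "\<lambda>h. PF [h]" "\<lambda>h. PL [h]" "PL []"])
    show "r / 2 > 0" "K' > 0" using r K' by auto
    show "PF [] \<in> col_Hcurl D i" for i using bF1 by simp
    have KK: "K * (sup_norm D h / r) \<le> K' * sup_norm D h" if "h \<in> ?cp" for h
      using mult_right_mono[OF K'(1) sup_norm_nonneg[OF that D(3)]] by simp
    have "PF [h] \<in> col_Hcurl D i" "col_norm D i (PF [h]) \<le> K' * sup_norm D h"
      "norm (PL [h]) \<le> K' * sup_norm D h" if h: "h \<in> ?cp" for h i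
      using bF1[of "[h]" i] bL[of "[h]"] h KK[OF h] by auto
    then show "bounded_linear_coeff_maps D K' (\<lambda>h. PF [h]) (\<lambda>h. PL [h])"
      using linF linL unfolding bounded_linear_coeff_maps_def by simp
    fix h assume h: "h \<in> ?cp"
    have s: "0 \<le> sup_norm D h" by (rule sup_norm_nonneg[OF h D(3)])
    assume sr: "sup_norm D h \<le> r / 2"
    define q where "q = sup_norm D h / r"
    have q: "0 \<le> q" "q \<le> 1/2" using s sr r by (auto simp: q_def field_simps)
    have sr': "sup_norm D h < r" using sr r by simp
    let ?h = "\<lambda>y. identity_coeffs y + h y"
    have rep: "replicate k h \<in> lists ?cp" for k using h by (induction k) auto
    have split: "(\<Sum>k<N. f k) = f 0 + f 1 + (\<Sum>k\<in>{2..<N}. f k)" if "2 \<le> N"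
      for f :: "nat \<Rightarrow> 'b::ab_group_add" and N
    proof -
      have "{..<N} = insert 0 (insert 1 {2..<N})" using that by auto
      then show ?thesis by (simp add: add.assoc)
    qed
    have K2: "2 * K * q\<^sup>2 \<le> K' * (sup_norm D h)\<^sup>2"
      using mult_right_mono[OF K'(2), of "(sup_norm D h)\<^sup>2"] by (simp add: q_def power_divide)
    show "F ?h \<in> col_Hcurl D i \<and>
       col_norm D i (\<lambda>x. F ?h x - PF [] x - PF [h] x) \<le> K' * (sup_norm D h)\<^sup>2" for i
    proof
      show Fh: "F ?h \<in> col_Hcurl D i" by (rule ser1[OF h sr'])
      have Pk: "PF (replicate k h) \<in> col_Hcurl D i" for k by (rule bF1[OF rep])
      have "col_norm D i (\<lambda>x. F ?h x - PF [] x - PF [h] x)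
          \<le> col_norm D i (\<lambda>x. F ?h x - (\<Sum>k<N. PF (replicate k h) x)) + 2 * K * q\<^sup>2" if N: "2 \<le> N" for N
      proof -
        let ?T = "\<lambda>x. \<Sum>k\<in>{2..<N}. PF (replicate k h) x"
        have "F ?h x - PF [] x - PF [h] x = (F ?h x - (\<Sum>k<N. PF (replicate k h) x)) + ?T x" for x
          unfolding split[OF N] by simp
        then have "col_norm D i (\<lambda>x. F ?h x - PF [] x - PF [h] x)
            = col_norm D i (\<lambda>x. (F ?h x - (\<Sum>k<N. PF (replicate k h) x)) + ?T x)" by (simp only:)
        also have "\<dots> \<le> col_norm D i (\<lambda>x. F ?h x - (\<Sum>k<N. PF (replicate k h) x)) + col_norm D i ?T"
          by (intro col_norm_add[OF D'] col_Hcurl_diff[OF D'] col_Hcurl_sum[OF D'] Fh Pk)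
        also have "col_norm D i ?T \<le> (\<Sum>k\<in>{2..<N}. col_norm D i (PF (replicate k h)))"
          by (intro col_norm_sum[OF D'] Pk)
        also have "\<dots> \<le> (\<Sum>k\<in>{2..<N}. K * q ^ k)"
          using bF1(2)[OF rep] by (intro sum_mono) (simp add: pw q_def)
        also have "\<dots> \<le> 2 * K * q\<^sup>2" by (rule tail[OF q])
        finally show ?thesis by simp
      qed
      then have "\<forall>\<^sub>F N in sequentially. col_norm D i (\<lambda>x. F ?h x - PF [] x - PF [h] x)
          \<le> col_norm D i (\<lambda>x. F ?h x - (\<Sum>k<N. PF (replicate k h) x)) + 2 * K * q\<^sup>2"
        by (auto simp: eventually_sequentially)
      moreover have "(\<lambda>N. col_norm D i (\<lambda>x. F ?h x - (\<Sum>k<N. PF (replicate k h) x)) + 2 * K * q\<^sup>2)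
          \<longlonglongrightarrow> 0 + 2 * K * q\<^sup>2"
        by (intro tendsto_add tendsto_const ser1[OF h sr'])
      ultimately have "col_norm D i (\<lambda>x. F ?h x - PF [] x - PF [h] x) \<le> 0 + 2 * K * q\<^sup>2"
        by (intro tendsto_lowerbound[where F = sequentially]) auto
      then show "col_norm D i (\<lambda>x. F ?h x - PF [] x - PF [h] x) \<le> K' * (sup_norm D h)\<^sup>2"
        using K2 by linarith
    qed
    have "(\<lambda>N. \<Sum>k<N. PL (replicate k h)) \<longlonglongrightarrow> L ?h"
      using ser[rule_format, OF h sr'] by (simp add: sums_def)
    then have "(\<lambda>N. norm ((\<Sum>k<N. PL (replicate k h)) - PL [] - PL [h])) \<longlonglongrightarrow> norm (L ?h - PL [] - PL [h])"
      by (intro tendsto_intros)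
    moreover have "norm ((\<Sum>k<N. PL (replicate k h)) - PL [] - PL [h]) \<le> 2 * K * q\<^sup>2" if N: "2 \<le> N" for N
    proof -
      have "norm ((\<Sum>k<N. PL (replicate k h)) - PL [] - PL [h]) = norm (\<Sum>k\<in>{2..<N}. PL (replicate k h))"
        unfolding split[OF N] by simp
      also have "\<dots> \<le> (\<Sum>k\<in>{2..<N}. K * q ^ k)"
        using bL[OF rep] by (intro sum_norm_le) (simp add: pw q_def)
      also have "\<dots> \<le> 2 * K * q\<^sup>2" by (rule tail[OF q])
      finally show ?thesis .
    qed
    ultimately have "norm (L ?h - PL [] - PL [h]) \<le> 2 * K * q\<^sup>2"
      by (intro LIMSEQ_le_const2) auto
    then show "norm (L ?h - PL [] - PL [h]) \<le> K' * (sup_norm D h)\<^sup>2" using K2 by linarith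
  qed
qed

lemma eventually_nhds_0D:
  assumes "\<forall>\<^sub>F t in nhds (0::real). Q t"
  shows "\<exists>d>0. \<forall>t. \<bar>t\<bar> < d \<longrightarrow> Q t"
  using assms by (simp add: eventually_nhds_metric dist_real_def)

text \<open>The derivative of the trajectory is the linear term of the power series at the derivative
  \<open>h\<close> of the coefficients, and the trajectory differs from its tangent by \<open>O(t\<^sup>2)\<close>, uniformly in the
  parameters.\<close>

proposition trajectory_first_order:
  fixes E :: "real \<Rightarrow> (nat \<Rightarrow> real) \<Rightarrow> real^3 \<Rightarrow> real^'m^3"
  assumes D: "open D" "bounded D" "D \<noteq> {}" and G: "deformation D M G"
    and dG: "\<And>y x. y \<in> cube M \<Longrightarrow> x \<in> D \<Longrightarrow>
               ((\<lambda>t. G t y x) has_vector_derivative dG y x) (at 0)"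
    and E0: "\<And>i. E0 \<in> col_Hcurl D i"
    and traj: "analytic_trajectory D M G E0 l E L"
    and dE: "\<And>y. y \<in> cube M \<Longrightarrow> has_Hcurl_derivative_at_0 D (\<lambda>t. E t y) (dE y)"
    and dL: "\<And>y. y \<in> cube M \<Longrightarrow> ((\<lambda>t. L t y) has_vector_derivative dL y) (at 0)"
  defines "h \<equiv> \<lambda>y. coeff_deriv D (dG y)"
  obtains e K F1 L1 where "e > 0" "K > 0"
    "\<And>y i. y \<in> cube M \<Longrightarrow> dE y \<in> col_Hcurl D i"
    "\<And>t y i. \<bar>t\<bar> < e \<Longrightarrow> y \<in> cube M \<Longrightarrow> col_norm D i (\<lambda>x. E t y x - E0 x - t *\<^sub>R dE y x) \<le> K * t\<^sup>2"
    "\<And>t y. \<bar>t\<bar> < e \<Longrightarrow> y \<in> cube M \<Longrightarrow> norm (L t y - l *\<^sub>R mat 1 - t *\<^sub>R dL y) \<le> K * t\<^sup>2"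
    "\<And>y i. y \<in> cube M \<Longrightarrow> col_norm D i (dE y) \<le> K"
    "\<And>y. y \<in> cube M \<Longrightarrow> norm (dL y) \<le> K"
    "\<And>y. y \<in> cube M \<Longrightarrow> h y \<in> coeff_perturbations D"
    "\<And>y i. y \<in> cube M \<Longrightarrow> col_norm D i (\<lambda>x. dE y x - F1 (h y) x) = 0"
    "\<And>y. y \<in> cube M \<Longrightarrow> dL y = L1 (h y)"
    "bounded_linear_coeff_maps D K F1 L1"
    "\<And>y x. y \<in> cube M \<Longrightarrow> x \<in> D \<Longrightarrow> dG y differentiable (at x)"
    "\<And>y. y \<in> cube M \<Longrightarrow> sup_norm D (h y) \<le> K"
proof -
  note D' = D(1,2)
  let ?cp = "coeff_perturbations D"
  obtain F \<Lambda> where F: "analytic_at_identity D F \<Lambda>"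
    and FE: "\<forall>\<^sub>F t in nhds 0. \<forall>z\<in>cube M.
           (AE x in lebesgue_on D. E t z x = F (coeffs G t z) x) \<and> L t z = \<Lambda> (coeffs G t z)"
    and ep: "\<forall>\<^sub>F t in nhds 0. \<forall>z\<in>cube M. eigenspace_problem D (coeffs G t z) (E t z) (L t z)"
    and init: "\<And>z. z \<in> cube M \<Longrightarrow> AE x in lebesgue_on D. E 0 z x = E0 x"
      "\<And>z. z \<in> cube M \<Longrightarrow> L 0 z = l *\<^sub>R mat 1"
    using traj unfolding analytic_trajectory_def by blast
  obtain e0 B where e0: "e0 > 0" and B: "B > 0"
    and cp: "\<And>t z. \<bar>t\<bar> < e0 \<Longrightarrow> z \<in> cube M \<Longrightarrow> (\<lambda>x. coeffs G t z x - identity_coeffs x) \<in> ?cp"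
    and exp: "\<And>t z x. \<bar>t\<bar> < e0 \<Longrightarrow> z \<in> cube M \<Longrightarrow> x \<in> D \<Longrightarrow>
       norm (coeffs G t z x - identity_coeffs x - t *\<^sub>R coeff_deriv D (dG z) x) \<le> B * t\<^sup>2"
    and hcp: "\<And>z. z \<in> cube M \<Longrightarrow> coeff_deriv D (dG z) \<in> ?cp"
    and hB: "\<And>z x. z \<in> cube M \<Longrightarrow> norm (coeff_deriv D (dG z) x) \<le> B"
    and diff: "\<And>z x. z \<in> cube M \<Longrightarrow> x \<in> D \<Longrightarrow> dG z differentiable (at x)"
    by (rule deformation_coeffs_expansion[OF D(1) G dG]) (assumption, assumption, rule that)
  obtain r K0 F0 F1 L0 L1 where r: "r > 0" and K0: "K0 > 0"
    and F0: "\<And>i. F0 \<in> col_Hcurl D i"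
    and lin: "bounded_linear_coeff_maps D K0 F1 L1"
    and Fexp: "\<And>i h. h \<in> ?cp \<Longrightarrow> sup_norm D h \<le> r \<Longrightarrow>
       F (\<lambda>y. identity_coeffs y + h y) \<in> col_Hcurl D i \<and>
       col_norm D i (\<lambda>x. F (\<lambda>y. identity_coeffs y + h y) x - F0 x - F1 h x) \<le> K0 * (sup_norm D h)\<^sup>2"
    and Lexp: "\<And>h. h \<in> ?cp \<Longrightarrow> sup_norm D h \<le> r \<Longrightarrow>
       norm (\<Lambda> (\<lambda>y. identity_coeffs y + h y) - L0 - L1 h) \<le> K0 * (sup_norm D h)\<^sup>2"
    by (rule analytic_first_order[OF D F]) (rule that)
  note F1 = bounded_linear_coeff_mapsD(1)[OF lin] and F1b = bounded_linear_coeff_mapsD(2)[OF lin]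
    and L1b = bounded_linear_coeff_mapsD(3)[OF lin] and F1lin = bounded_linear_coeff_mapsD(4)[OF lin]
    and L1lin = bounded_linear_coeff_mapsD(5)[OF lin]
  have "\<forall>\<^sub>F t in nhds 0. (\<forall>z\<in>cube M. eigenspace_problem D (coeffs G t z) (E t z) (L t z)) \<and>
      (\<forall>z\<in>cube M. (AE x in lebesgue_on D. E t z x = F (coeffs G t z) x) \<and> L t z = \<Lambda> (coeffs G t z))"
    by (rule eventually_conj[OF ep FE])
  then obtain e1 where e1_pos: "e1 > 0" and near: "\<And>t. \<bar>t\<bar> < e1 \<Longrightarrow>
      (\<forall>z\<in>cube M. eigenspace_problem D (coeffs G t z) (E t z) (L t z)) \<and>
      (\<forall>z\<in>cube M. (AE x in lebesgue_on D. E t z x = F (coeffs G t z) x) \<and> L t z = \<Lambda> (coeffs G t z))"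
    using eventually_nhds_0D by blast
  have e1: "e1 > 0"
    "\<And>t z. \<bar>t\<bar> < e1 \<Longrightarrow> z \<in> cube M \<Longrightarrow> eigenspace_problem D (coeffs G t z) (E t z) (L t z)"
    "\<And>t z. \<bar>t\<bar> < e1 \<Longrightarrow> z \<in> cube M \<Longrightarrow> AE x in lebesgue_on D. E t z x = F (coeffs G t z) x"
    "\<And>t z. \<bar>t\<bar> < e1 \<Longrightarrow> z \<in> cube M \<Longrightarrow> L t z = \<Lambda> (coeffs G t z)"
    using e1_pos near by blast+
  \<comment> \<open>For \<open>|t| < e\<close> the coefficients differ from \<open>(I, I)\<close> by at most \<open>2 B |t| \<le> r\<close>.\<close>
  define e where "e = min (min e0 e1) (min 1 (r / (2 * B)))"
  have e: "0 < e" "e \<le> e0" "e \<le> e1" "e \<le> 1" "2 * B * e \<le> r"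
  proof -
    show "0 < e" "e \<le> e0" "e \<le> e1" "e \<le> 1" using e0 e1(1) r B by (auto simp: e_def)
    have "e \<le> r / (2 * B)" by (simp add: e_def)
    then show "2 * B * e \<le> r" using B by (simp add: pos_le_divide_eq mult.commute)
  qed
  define ht where "ht t z = (\<lambda>x. coeffs G t z x - identity_coeffs x)" for t z
  \<comment> \<open>The part \<open>ht - t h\<close> of the coefficients beyond first order; its factors \<open>1\<close> and \<open>- t\<close> show it as a linear
    combination to which the linearity of \<open>F1\<close> and \<open>L1\<close> applies.\<close>
  define s where "s t z = (\<lambda>x. 1 *\<^sub>R ht t z x + (- t) *\<^sub>R h z x)" for t z
  have hcp': "h z \<in> ?cp" if "z \<in> cube M" for z using hcp[OF that] by (simp add: h_def)
  have htcp: "ht t z \<in> ?cp" if "\<bar>t\<bar> < e" "z \<in> cube M" for t z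
    unfolding ht_def using that e by (intro cp) auto
  have scp: "s t z \<in> ?cp" if "\<bar>t\<bar> < e" "z \<in> cube M" for t z
    unfolding s_def by (rule coeff_perturbations_lincomb[OF htcp[OF that] hcp'[OF that(2)]])
  have sb: "sup_norm D (s t z) \<le> B * t\<^sup>2" if "\<bar>t\<bar> < e" "z \<in> cube M" for t z
    using exp[of t z] that e by (intro sup_norm_le[OF D(3)]) (simp add: s_def ht_def h_def)
  have hsup: "sup_norm D (h z) \<le> B" if "z \<in> cube M" for z
    using hB[OF that] by (intro sup_norm_le[OF D(3)]) (simp add: h_def)
  have htb: "sup_norm D (ht t z) \<le> 2 * B * \<bar>t\<bar>" if t: "\<bar>t\<bar> < e" and z: "z \<in> cube M" for t z
  proof (rule sup_norm_le[OF D(3)])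
    fix x assume x: "x \<in> D"
    have "ht t z x = s t z x + t *\<^sub>R h z x" by (simp add: s_def)
    then have "norm (ht t z x) \<le> norm (s t z x) + norm (t *\<^sub>R h z x)" by (metis norm_triangle_ineq)
    also have "norm (s t z x) \<le> B * t\<^sup>2"
      by (rule order_trans[OF norm_le_sup_norm[OF scp[OF t z] x] sb[OF t z]])
    also have "norm (t *\<^sub>R h z x) \<le> \<bar>t\<bar> * B" using hB[OF z, of x] by (simp add: h_def mult_left_mono)
    also have "B * t\<^sup>2 \<le> B * \<bar>t\<bar>"
    proof (rule mult_left_mono)
      have "\<bar>t\<bar> * \<bar>t\<bar> \<le> 1 * \<bar>t\<bar>" using t e(4) by (intro mult_right_mono) auto
      then show "t\<^sup>2 \<le> \<bar>t\<bar>" by (simp add: power2_eq_square abs_mult[symmetric])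
    qed (use B in simp)
    finally show "norm (ht t z x) \<le> 2 * B * \<bar>t\<bar>" by (simp add: mult.commute[of "\<bar>t\<bar>" B] mult.assoc)
  qed
  have htr: "sup_norm D (ht t z) \<le> r" if t: "\<bar>t\<bar> < e" and z: "z \<in> cube M" for t z
  proof -
    have "2 * B * \<bar>t\<bar> \<le> 2 * B * e" using t B by (intro mult_left_mono) auto
    then show ?thesis using htb[OF t z] e(5) by linarith
  qed
  have sq: "K0 * (sup_norm D (ht t z))\<^sup>2 \<le> K0 * (2 * B)\<^sup>2 * t\<^sup>2" if "\<bar>t\<bar> < e" "z \<in> cube M" for t z
  proof -
    have "(sup_norm D (ht t z))\<^sup>2 \<le> (2 * B * \<bar>t\<bar>)\<^sup>2"
      by (rule power_mono[OF htb[OF that] sup_norm_nonneg[OF htcp[OF that] D(3)]])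
    then have "K0 * (sup_norm D (ht t z))\<^sup>2 \<le> K0 * (2 * B * \<bar>t\<bar>)\<^sup>2" using K0 by (intro mult_left_mono) auto
    then show ?thesis by (simp add: power_mult_distrib mult.assoc)
  qed
  have coeffs: "(\<lambda>y. identity_coeffs y + ht t z y) = coeffs G t z" for t z by (simp add: ht_def)
  have EH: "E t z \<in> col_Hcurl D i" if "\<bar>t\<bar> < e" "z \<in> cube M" for t z i
    using e1(2)[of t z] that e by (auto simp: eigenspace_problem_def col_Hcurl_def Hcurl0_subset)
  have dEH: "dE z \<in> col_Hcurl D i" if "z \<in> cube M" for z i
    using dE[OF that] by (simp add: has_Hcurl_derivative_at_0_def col_Hcurl_def)
  have F1h: "F1 (h z) \<in> col_Hcurl D i" if "z \<in> cube M" for z i by (rule F1[OF hcp'[OF that]])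
  note cI = col_Hcurl_diff[OF D'] col_Hcurl_scale[OF D'] EH F0 F1 E0 dEH F1h htcp scp hcp'

  define K1 where "K1 = K0 * (2 * B)\<^sup>2 + K0 * B"
  have K1: "0 < K1" using K0 B by (auto simp: K1_def intro!: add_pos_pos mult_pos_pos)

  \<comment> \<open>The error consists of the quadratic error of \<open>F\<close> and of \<open>F1 s\<close>, both \<open>O(t\<^sup>2)\<close>.\<close>
  have A: "col_norm D i (\<lambda>x. E t z x - (F0 x - (-t) *\<^sub>R F1 (h z) x)) \<le> K1 * t\<^sup>2"
    if t: "\<bar>t\<bar> < e" and z: "z \<in> cube M" for t z i
  proof -
    let ?F = "F (coeffs G t z)"
    have FH: "?F \<in> col_Hcurl D i" and Fb: "col_norm D i (\<lambda>x. ?F x - F0 x - F1 (ht t z) x) \<le> K0 * (2 * B)\<^sup>2 * t\<^sup>2"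
      using Fexp[OF htcp[OF t z] htr[OF t z], of i] sq[OF t z] unfolding coeffs by auto
    have AEs: "AE x in lebesgue_on D. F1 (s t z) x = 1 *\<^sub>R F1 (ht t z) x + (-t) *\<^sub>R F1 (h z) x"
      unfolding s_def by (rule F1lin[OF htcp[OF t z] hcp'[OF z]])
    have AEE: "AE x in lebesgue_on D. E t z x = ?F x" using e1(3) t z e by auto
    have R1: "(\<lambda>x. ?F x - F0 x - F1 (ht t z) x) \<in> col_Hcurl D i"
      and R2: "F1 (s t z) \<in> col_Hcurl D i"
      by (intro cI FH t z)+
    have R3: "(\<lambda>x. (?F x - F0 x - F1 (ht t z) x) - (-1) *\<^sub>R F1 (s t z) x) \<in> col_Hcurl D i"
      by (intro cI FH t z)
    have "AE x in lebesgue_on D. E t z x - (F0 x - (-t) *\<^sub>R F1 (h z) x)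
        = (?F x - F0 x - F1 (ht t z) x) - (-1) *\<^sub>R F1 (s t z) x"
      using AEs AEE by eventually_elim (simp add: algebra_simps)
    then have "col_norm D i (\<lambda>x. E t z x - (F0 x - (-t) *\<^sub>R F1 (h z) x))
        = col_norm D i (\<lambda>x. (?F x - F0 x - F1 (ht t z) x) - (-1) *\<^sub>R F1 (s t z) x)"
      by (rule col_norm_cong_AE[OF D' _ R3, rotated]) (intro cI t z)
    also have "\<dots> = col_norm D i (\<lambda>x. (?F x - F0 x - F1 (ht t z) x) + F1 (s t z) x)" by simp
    also have "\<dots> \<le> col_norm D i (\<lambda>x. ?F x - F0 x - F1 (ht t z) x) + col_norm D i (F1 (s t z))"
      by (rule col_norm_add[OF D' R1 R2])
    also have "col_norm D i (F1 (s t z)) \<le> K0 * B * t\<^sup>2"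
      using order_trans[OF F1b[OF scp[OF t z]] mult_left_mono[OF sb[OF t z], of K0]] K0 by (simp add: mult.assoc)
    finally show ?thesis using Fb by (simp add: K1_def distrib_right)
  qed
  \<comment> \<open>At \<open>t = 0\<close> the estimate identifies the constant term of the power series with the initial value.\<close>
  have E00: "col_norm D i (\<lambda>x. F0 x - E0 x) = 0" if z: "z \<in> cube M" for z i
  proof -
    have 0: "\<bar>0\<bar> < e" using e(1) by simp
    have "col_norm D i (\<lambda>x. E 0 z x - F0 x) \<le> 0" using A[OF 0 z, of i] by simp
    moreover have "col_norm D i (\<lambda>x. E 0 z x - F0 x) = col_norm D i (\<lambda>x. E0 x - F0 x)"
      using init(1)[OF z] by (intro col_norm_cong_AE[OF D'] cI 0 z) auto
    ultimately show ?thesis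
      using col_norm_commute[OF D' F0 E0, of i] col_norm_nonneg[OF D', of i "\<lambda>x. F0 x - E0 x"] by simp
  qed
  have A': "col_norm D i (\<lambda>x. (E t z x - E0 x) - t *\<^sub>R F1 (h z) x) \<le> K1 * t\<^sup>2"
    if t: "\<bar>t\<bar> < e" and z: "z \<in> cube M" for t z i
  proof -
    have "col_norm D i (\<lambda>x. (E t z x - E0 x) - t *\<^sub>R F1 (h z) x)
        = col_norm D i (\<lambda>x. (E t z x - (F0 x - (-t) *\<^sub>R F1 (h z) x)) + (F0 x - E0 x))" by (simp add: algebra_simps)
    also have "\<dots> \<le> col_norm D i (\<lambda>x. E t z x - (F0 x - (-t) *\<^sub>R F1 (h z) x)) + col_norm D i (\<lambda>x. F0 x - E0 x)"
      by (intro col_norm_add[OF D'] cI t z)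
    finally show ?thesis using A[OF t z, of i] E00[OF z, of i] by simp
  qed
  \<comment> \<open>The difference quotients converge to \<open>dE\<close> by assumption and to \<open>F1 h\<close> by the estimate.\<close>
  have dEF1: "col_norm D i (\<lambda>x. dE z x - F1 (h z) x) = 0" if z: "z \<in> cube M" for z i
  proof -
    have 0: "\<bar>0\<bar> < e" using e(1) by simp
    let ?Q = "\<lambda>t x. (1 / t) *\<^sub>R (E t z x - E 0 z x)"
    have lim: "((\<lambda>t. col_norm D i (\<lambda>x. ?Q t x - dE z x)) \<longlongrightarrow> 0) (at 0)"
      using dE[OF z] by (simp add: has_Hcurl_derivative_at_0_def col_norm_def divide_inverse)
    have bound: "col_norm D i (\<lambda>x. dE z x - F1 (h z) x) \<le> col_norm D i (\<lambda>x. ?Q t x - dE z x) + K1 * \<bar>t\<bar>"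
      if t: "\<bar>t\<bar> < e" "t \<noteq> 0" for t
    proof -
      have QH: "?Q t \<in> col_Hcurl D i" by (intro cI t 0 z)
      have "AE x in lebesgue_on D. ?Q t x - F1 (h z) x = (1 / t) *\<^sub>R ((E t z x - E0 x) - t *\<^sub>R F1 (h z) x)"
        using init(1)[OF z] by eventually_elim (use t in \<open>simp add: scaleR_diff_right\<close>)
      then have "col_norm D i (\<lambda>x. ?Q t x - F1 (h z) x)
          = col_norm D i (\<lambda>x. (1 / t) *\<^sub>R ((E t z x - E0 x) - t *\<^sub>R F1 (h z) x))"
        by (rule col_norm_cong_AE[OF D', rotated 2]) (intro cI t 0 z)+
      also have "\<dots> = \<bar>1 / t\<bar> * col_norm D i (\<lambda>x. (E t z x - E0 x) - t *\<^sub>R F1 (h z) x)"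
        by (rule col_norm_scale[OF D']) (intro cI t 0 z)
      also have "\<dots> \<le> \<bar>1 / t\<bar> * (K1 * t\<^sup>2)" by (intro mult_left_mono A' t z) simp
      also have "\<dots> = K1 * \<bar>t\<bar>" using t by (simp add: power2_eq_square abs_mult[symmetric] field_simps)
      finally have "col_norm D i (\<lambda>x. ?Q t x - F1 (h z) x) \<le> K1 * \<bar>t\<bar>" .
      then show ?thesis
        using col_norm_triangle[OF D' dEH[OF z, of i] QH F1h[OF z, of i]]
          col_norm_commute[OF D' dEH[OF z, of i] QH] by simp
    qed
    have "((\<lambda>t. col_norm D i (\<lambda>x. ?Q t x - dE z x) + K1 * \<bar>t\<bar>) \<longlongrightarrow> 0 + K1 * \<bar>0\<bar>) (at 0)"
      by (intro tendsto_intros lim)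
    moreover have "\<forall>\<^sub>F t in at 0. col_norm D i (\<lambda>x. dE z x - F1 (h z) x)
        \<le> col_norm D i (\<lambda>x. ?Q t x - dE z x) + K1 * \<bar>t\<bar>"
      unfolding eventually_at using e(1) bound by (intro exI[of _ e]) (auto simp: dist_norm)
    ultimately have "col_norm D i (\<lambda>x. dE z x - F1 (h z) x) \<le> 0 + K1 * \<bar>0\<bar>"
      by (intro tendsto_lowerbound[where F = "at (0::real)"]) auto
    then show ?thesis using col_norm_nonneg[OF D', of i "\<lambda>x. dE z x - F1 (h z) x"] by simp
  qed
  have Etay: "col_norm D i (\<lambda>x. E t z x - E0 x - t *\<^sub>R dE z x) \<le> K1 * t\<^sup>2"
    if t: "\<bar>t\<bar> < e" and z: "z \<in> cube M" for t z i
  proof -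
    have "col_norm D i (\<lambda>x. E t z x - E0 x - t *\<^sub>R dE z x)
        = col_norm D i (\<lambda>x. ((E t z x - E0 x) - t *\<^sub>R F1 (h z) x) + (-t) *\<^sub>R (dE z x - F1 (h z) x))"
      by (simp add: algebra_simps)
    also have "\<dots> \<le> col_norm D i (\<lambda>x. (E t z x - E0 x) - t *\<^sub>R F1 (h z) x)
        + col_norm D i (\<lambda>x. (-t) *\<^sub>R (dE z x - F1 (h z) x))"
      by (intro col_norm_add[OF D'] cI t z)
    also have "col_norm D i (\<lambda>x. (-t) *\<^sub>R (dE z x - F1 (h z) x)) = 0"
      using col_norm_scale[OF D' col_Hcurl_diff[OF D' dEH[OF z] F1h[OF z]], where c = "-t" and i = i] dEF1[OF z, of i] by simp
    finally show ?thesis using A'[OF t z, of i] by simp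
  qed
  have dEb: "col_norm D i (dE z) \<le> K0 * B" if z: "z \<in> cube M" for z i
  proof -
    have "col_norm D i (\<lambda>x. (dE z x - F1 (h z) x) + F1 (h z) x)
      \<le> col_norm D i (\<lambda>x. dE z x - F1 (h z) x) + col_norm D i (F1 (h z))"
      by (intro col_norm_add[OF D'] cI z)
    then have "col_norm D i (dE z) \<le> col_norm D i (F1 (h z))" using dEF1[OF z, of i] by simp
    also have "\<dots> \<le> K0 * sup_norm D (h z)" by (rule F1b[OF hcp'[OF z]])
    also have "\<dots> \<le> K0 * B" using hsup[OF z] K0 by (intro mult_left_mono) auto
    finally show ?thesis .
  qed

  have LA: "norm (L t z - L0 - t *\<^sub>R L1 (h z)) \<le> K1 * t\<^sup>2" if t: "\<bar>t\<bar> < e" and z: "z \<in> cube M" for t z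
  proof -
    have "L1 (s t z) = 1 *\<^sub>R L1 (ht t z) + (-t) *\<^sub>R L1 (h z)"
      unfolding s_def by (rule L1lin[OF htcp[OF t z] hcp'[OF z]])
    then have "L t z - L0 - t *\<^sub>R L1 (h z) = (\<Lambda> (coeffs G t z) - L0 - L1 (ht t z)) + L1 (s t z)"
      using e1(4)[of t z] t z e by simp
    then have "norm (L t z - L0 - t *\<^sub>R L1 (h z))
        \<le> norm (\<Lambda> (coeffs G t z) - L0 - L1 (ht t z)) + norm (L1 (s t z))" by (metis norm_triangle_ineq)
    also have "norm (\<Lambda> (coeffs G t z) - L0 - L1 (ht t z)) \<le> K0 * (2 * B)\<^sup>2 * t\<^sup>2"
      using Lexp[OF htcp[OF t z] htr[OF t z]] sq[OF t z] unfolding coeffs by linarith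
    also have "norm (L1 (s t z)) \<le> K0 * B * t\<^sup>2"
      using order_trans[OF L1b[OF scp[OF t z]] mult_left_mono[OF sb[OF t z], of K0]] K0 by (simp add: mult.assoc)
    finally show ?thesis by (simp add: K1_def distrib_right)
  qed
  have L00: "L0 = l *\<^sub>R mat 1" if z: "z \<in> cube M" for z
    using LA[of 0 z] z e(1) init(2)[OF z] by simp
  have dLL1: "dL z = L1 (h z)" if z: "z \<in> cube M" for z
  proof -
    have "((\<lambda>t. (1 / t) *\<^sub>R (L t z - L 0 z)) \<longlongrightarrow> L1 (h z)) (at 0)"
    proof (rule LIM_zero_cancel, rule Lim_null_comparison)
      show "\<forall>\<^sub>F t in at 0. norm ((1 / t) *\<^sub>R (L t z - L 0 z) - L1 (h z)) \<le> K1 * \<bar>t\<bar>"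
        unfolding eventually_at
      proof (intro exI[of _ e] conjI ballI impI)
        fix t :: real assume "t \<noteq> 0 \<and> dist t 0 < e"
        then have t: "\<bar>t\<bar> < e" "t \<noteq> 0" by (auto simp: dist_norm)
        have "(1 / t) *\<^sub>R (L t z - L 0 z) - L1 (h z) = (1 / t) *\<^sub>R (L t z - L0 - t *\<^sub>R L1 (h z))"
          using t L00[OF z] init(2)[OF z] by (simp add: scaleR_diff_right)
        then have "norm ((1 / t) *\<^sub>R (L t z - L 0 z) - L1 (h z)) \<le> \<bar>1 / t\<bar> * (K1 * t\<^sup>2)"
          using mult_left_mono[OF LA[OF t(1) z], of "\<bar>1 / t\<bar>"] by simp
        also have "\<dots> = K1 * \<bar>t\<bar>" using t by (simp add: power2_eq_square abs_mult[symmetric] field_simps)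
        finally show "norm ((1 / t) *\<^sub>R (L t z - L 0 z) - L1 (h z)) \<le> K1 * \<bar>t\<bar>" .
      qed (rule e)
      have "((\<lambda>t. K1 * \<bar>t\<bar>) \<longlongrightarrow> K1 * \<bar>0\<bar>) (at 0)" by (intro tendsto_intros)
      then show "((\<lambda>t. K1 * \<bar>t\<bar>) \<longlongrightarrow> 0) (at 0)" by simp
    qed
    from tendsto_unique[OF _ difference_quotient_tendsto[OF dL[OF z]] this] show ?thesis by simp
  qed

  define K where "K = K1 + K0 * B + K0 + B"
  have pos: "0 < K0 * B" using K0 B by simp
  have K: "K1 \<le> K" "K0 * B \<le> K" "K0 \<le> K" "B \<le> K" "0 < K" using K0 B K1 pos unfolding K_def by linarith+
  have KK: "K1 * t\<^sup>2 \<le> K * t\<^sup>2" for t using K(1) by (rule mult_right_mono) simp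
  have KS: "K0 * sup_norm D g \<le> K * sup_norm D g" if "g \<in> ?cp" for g
    using K(3) sup_norm_nonneg[OF that D(3)] by (rule mult_right_mono)
  show thesis
  proof (rule that[of e K F1 L1])
    show "e > 0" "K > 0" by fact+
    show "col_norm D i (\<lambda>x. E t y x - E0 x - t *\<^sub>R dE y x) \<le> K * t\<^sup>2" if "\<bar>t\<bar> < e" "y \<in> cube M" for t y i
      using Etay[OF that] KK by (rule order_trans)
    show "norm (L t y - l *\<^sub>R mat 1 - t *\<^sub>R dL y) \<le> K * t\<^sup>2" if "\<bar>t\<bar> < e" "y \<in> cube M" for t y
      using order_trans[OF LA[OF that] KK] L00[OF that(2)] dLL1[OF that(2)] by simp
    show "col_norm D i (dE y) \<le> K" if "y \<in> cube M" for y i using dEb[OF that] K(2) by (rule order_trans)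
    show "norm (dL y) \<le> K" if "y \<in> cube M" for y
    proof -
      have "norm (dL y) \<le> K0 * sup_norm D (h y)" using L1b[OF hcp'[OF that]] dLL1[OF that] by simp
      also have "\<dots> \<le> K0 * B" using hsup[OF that] K0 by (intro mult_left_mono) auto
      finally show ?thesis using K(2) by simp
    qed
    show "bounded_linear_coeff_maps D K F1 L1"
      unfolding bounded_linear_coeff_maps_def
      by (intro conjI ballI allI F1 F1lin L1lin order_trans[OF F1b KS] order_trans[OF L1b KS])
    show "sup_norm D (h y) \<le> K" if "y \<in> cube M" for y using hsup[OF that] K(4) by (rule order_trans)
  qed (fact dEH hcp' dEF1 dLL1 diff)+
qed

section \<open>Centered parameters\<close>

definition truncate_param :: "nat \<Rightarrow> (nat \<Rightarrow> real) \<Rightarrow> nat \<Rightarrow> real" where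
  "truncate_param N y i = (if i < N then y i else 0)"

lemma truncate_param_cube: "y \<in> cube M \<Longrightarrow> truncate_param N y \<in> cube M"
  by (auto simp: cube_def truncate_param_def)

lemma truncate_param_finite:
  assumes "y \<in> cube (enat m)" "m \<le> N" shows "truncate_param N y = y"
  using assms by (intro ext) (auto simp: cube_def truncate_param_def)

lemma truncate_param_tendsto: "(\<lambda>N. truncate_param N y) \<longlonglongrightarrow> y"
proof (rule topological_tendstoI)
  fix S :: "(nat \<Rightarrow> real) set" assume "open S" "y \<in> S"
  then have "openin (product_topology (\<lambda>_. euclidean) UNIV) S" by (simp add: open_fun_def)
  from product_topology_open_contains_basis[OF this \<open>y \<in> S\<close>]
  obtain X where X: "y \<in> Pi\<^sub>E UNIV X" "finite {i. X i \<noteq> UNIV}" "Pi\<^sub>E UNIV X \<subseteq> S"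
    by auto
  have "\<forall>\<^sub>F N in sequentially. \<forall>i\<in>{i. X i \<noteq> UNIV}. i < N"
    by (rule eventually_ball_finite[OF X(2)]) (simp add: eventually_gt_at_top)
  then show "\<forall>\<^sub>F N in sequentially. truncate_param N y \<in> S"
  proof eventually_elim
    case (elim N)
    have "truncate_param N y i \<in> X i" for i
      using elim X(1) by (cases "X i = UNIV") (auto simp: truncate_param_def PiE_iff)
    then show ?case using X(3) by (auto simp: PiE_iff)
  qed
qed

text \<open>A functional that is linear on the cube and continuous along truncations is the bounded limit
  of finite linear combinations of the coordinates, whose means vanish.\<close>

proposition mean_zero_if_linear_on_cube:
  fixes \<psi> :: "(nat \<Rightarrow> real) \<Rightarrow> 'b::euclidean_space"
  assumes P: "prob_space P"
    and z: "z \<in> measurable P (Pi\<^sub>M UNIV (\<lambda>_. borel))" "\<And>w. w \<in> space P \<Longrightarrow> z w \<in> cube M"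
    and centered: "\<And>i. (\<integral>w. z w i \<partial>P) = 0"
    and lin: "linear_on_cube M \<psi>"
    and bound: "\<And>y. y \<in> cube M \<Longrightarrow> norm (\<psi> y) \<le> B"
    and cont: "\<And>y. y \<in> cube M \<Longrightarrow> (\<lambda>N. \<psi> (truncate_param N y)) \<longlonglongrightarrow> \<psi> y"
    and meas: "(\<lambda>w. \<psi> (z w)) \<in> borel_measurable P"
  shows "(\<integral>w. \<psi> (z w) \<partial>P) = 0"
proof -
  interpret prob_space P by fact
  \<comment> \<open>Coordinates beyond \<open>M\<close> vanish on the cube, so the corresponding unit vector is replaced by \<open>0\<close>.\<close>
  define unit :: "nat \<Rightarrow> nat \<Rightarrow> real" where
    "unit i j = (if j = i \<and> enat i < M then 1 else 0)" for i j
  have unit: "unit i \<in> cube M" for i by (auto simp: cube_def unit_def)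
  have zero: "(\<lambda>_. 0) \<in> cube M" by (auto simp: cube_def)
  have "\<psi> (\<lambda>_. 0) = 0"
    using lin[unfolded linear_on_cube_def, rule_format, OF zero zero, of 0 0] zero by simp
  then have expand: "\<psi> (truncate_param N y) = (\<Sum>i<N. y i *\<^sub>R \<psi> (unit i))" if y: "y \<in> cube M" for y N
  proof (induction N)
    case 0
    then show ?case by (simp add: truncate_param_def[abs_def])
  next
    case (Suc N)
    have eq: "truncate_param (Suc N) y = (\<lambda>i. 1 * truncate_param N y i + y N * unit N i)"
      using y by (intro ext) (auto simp: truncate_param_def unit_def cube_def less_Suc_eq)
    have "(\<lambda>i. 1 * truncate_param N y i + y N * unit N i) \<in> cube M"
      unfolding eq[symmetric] by (rule truncate_param_cube[OF y])
    then have "\<psi> (truncate_param (Suc N) y) = 1 *\<^sub>R \<psi> (truncate_param N y) + y N *\<^sub>R \<psi> (unit N)"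
      unfolding eq
      using lin[unfolded linear_on_cube_def, rule_format, OF truncate_param_cube[OF y] unit] by blast
    with Suc show ?case by simp
  qed
  have zi [measurable]: "(\<lambda>w. z w i) \<in> borel_measurable P" for i
    using measurable_compose[OF z(1) measurable_component_singleton[of i UNIV]] by simp
  have int: "integrable P (\<lambda>w. z w i)" for i
  proof (rule integrable_const_bound[where B = 1])
    show "AE w in P. norm (z w i) \<le> 1"
      using z(2) by (intro AE_I2) (auto simp: cube_def split: if_splits; metis abs_zero zero_le_one)
  qed simp
  have "(\<lambda>N. \<integral>w. \<psi> (truncate_param N (z w)) \<partial>P) \<longlonglongrightarrow> (\<integral>w. \<psi> (z w) \<partial>P)"
  proof (rule integral_dominated_convergence[where w = "\<lambda>_. B"])
    show "(\<lambda>w. \<psi> (truncate_param N (z w))) \<in> borel_measurable P" for N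
      by (subst measurable_cong[OF expand[OF z(2)]]) simp_all
    show "AE w in P. (\<lambda>N. \<psi> (truncate_param N (z w))) \<longlonglongrightarrow> \<psi> (z w)"
      using cont z(2) by (intro AE_I2) auto
    show "AE w in P. norm (\<psi> (truncate_param N (z w))) \<le> B" for N
      using bound truncate_param_cube z(2) by (intro AE_I2) auto
  qed (simp_all add: meas)
  moreover have "(\<integral>w. \<psi> (truncate_param N (z w)) \<partial>P) = 0" for N
  proof -
    have "(\<integral>w. \<psi> (truncate_param N (z w)) \<partial>P) = (\<integral>w. (\<Sum>i<N. z w i *\<^sub>R \<psi> (unit i)) \<partial>P)"
      using expand z(2) by (intro Bochner_Integration.integral_cong) auto
    also have "\<dots> = (\<Sum>i<N. (\<integral>w. z w i \<partial>P) *\<^sub>R \<psi> (unit i))"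
      using int by simp
    finally show ?thesis by (simp add: centered)
  qed
  ultimately show ?thesis using LIMSEQ_unique[OF tendsto_const] by fastforce
qed

text \<open>For finite \<open>M\<close> truncations are eventually trivial; for infinite \<open>M\<close> they converge in the product topology,
  in which the Jacobian of \<open>V\<close> is continuous uniformly in \<open>x\<close>.\<close>

lemma coeff_deriv_truncation:
  assumes D: "D \<noteq> {}" and lin: "linear_param_field D M V" and y: "y \<in> cube M"
  shows "(\<lambda>N. sup_norm D (\<lambda>x. coeff_deriv D (V (truncate_param N y)) x - coeff_deriv D (V y) x)) \<longlonglongrightarrow> 0"
proof (cases M)
  case (enat m)
  have "\<forall>\<^sub>F N in sequentially.
      sup_norm D (\<lambda>x. coeff_deriv D (V (truncate_param N y)) x - coeff_deriv D (V y) x) = 0"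
    using eventually_ge_at_top[of m]
    by eventually_elim (use truncate_param_finite y enat D in \<open>simp add: sup_norm_def\<close>)
  then show ?thesis by (rule tendsto_eventually)
next
  case infinity
  obtain b where b: "b > 0" "\<And>D V W x. norm (coeff_deriv D V x - coeff_deriv D W x)
        \<le> b * norm (jacobian V (at x) - jacobian W (at x))"
    by (rule coeff_deriv_bound) (rule that)
  have ul: "uniform_limit D (\<lambda>w x. jacobian (V w) (at x)) (\<lambda>x. jacobian (V y) (at x)) (at y within cube M)"
    using lin y infinity by (simp add: linear_param_field_def)
  show ?thesis
  proof (rule tendstoI)
    fix \<epsilon> :: real assume \<epsilon>: "\<epsilon> > 0"
    then have "\<forall>\<^sub>F w in at y within cube M. \<forall>x\<in>D. dist (jacobian (V w) (at x)) (jacobian (V y) (at x)) < \<epsilon> / (2 * b)"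
      using b(1) by (intro uniform_limitD[OF ul]) simp
    then have "\<forall>\<^sub>F w in nhds y. w \<noteq> y \<longrightarrow> w \<in> cube M \<longrightarrow>
        (\<forall>x\<in>D. dist (jacobian (V w) (at x)) (jacobian (V y) (at x)) < \<epsilon> / (2 * b))"
      by (simp add: eventually_at_filter)
    from eventually_compose_filterlim[OF this truncate_param_tendsto]
    show "\<forall>\<^sub>F N in sequentially. dist
        (sup_norm D (\<lambda>x. coeff_deriv D (V (truncate_param N y)) x - coeff_deriv D (V y) x)) 0 < \<epsilon>"
    proof eventually_elim
      case (elim N)
      let ?w = "truncate_param N y"
      have J: "norm (jacobian (V ?w) (at x) - jacobian (V y) (at x)) \<le> \<epsilon> / (2 * b)" if "x \<in> D" for x
      proof (cases "?w = y")
        case True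
        have "0 \<le> \<epsilon> / (2 * b)" using \<epsilon> b(1) by simp
        then show ?thesis by (simp add: True)
      next
        case False
        then show ?thesis using elim truncate_param_cube[OF y] that by (auto simp: dist_norm less_imp_le)
      qed
      have *: "norm (coeff_deriv D (V ?w) x - coeff_deriv D (V y) x) \<le> \<epsilon> / 2" if "x \<in> D" for x
      proof -
        have "b * norm (jacobian (V ?w) (at x) - jacobian (V y) (at x)) \<le> b * (\<epsilon> / (2 * b))"
          using J[OF that] b(1) by (intro mult_left_mono) auto
        also have "\<dots> = \<epsilon> / 2" using b(1) by simp
        finally show ?thesis by (rule order_trans[OF b(2)])
      qed
      obtain x0 where x0: "x0 \<in> D" using D by blast
      have "bdd_above ((\<lambda>x. norm (coeff_deriv D (V ?w) x - coeff_deriv D (V y) x)) ` D)"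
        by (rule bdd_aboveI2[OF *])
      from order_trans[OF norm_ge_zero cSUP_upper[OF x0 this]]
      have "0 \<le> sup_norm D (\<lambda>x. coeff_deriv D (V ?w) x - coeff_deriv D (V y) x)" by (simp add: sup_norm_def)
      moreover have "sup_norm D (\<lambda>x. coeff_deriv D (V ?w) x - coeff_deriv D (V y) x) \<le> \<epsilon> / 2"
        using * by (rule sup_norm_le[OF D])
      ultimately show ?case using \<epsilon> by (simp add: dist_real_def)
    qed
  qed
qed

lemma coeff_deriv_linear_on_cube:
  assumes D: "open D" and lin: "linear_param_field D M V"
    and diff: "\<And>y x. y \<in> cube M \<Longrightarrow> x \<in> D \<Longrightarrow> V y differentiable (at x)"
    and "w \<in> cube M" "y \<in> cube M" "(\<lambda>i. a * w i + b * y i) \<in> cube M"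
  shows "coeff_deriv D (V (\<lambda>i. a * w i + b * y i))
      = (\<lambda>x. a *\<^sub>R coeff_deriv D (V w) x + b *\<^sub>R coeff_deriv D (V y) x)"
proof (rule coeff_deriv_linear[OF D _ diff diff])
  show "V (\<lambda>i. a * w i + b * y i) x = a *\<^sub>R V w x + b *\<^sub>R V y x" if "x \<in> D" for x
    using lin assms that by (auto simp: linear_param_field_def linear_on_cube_def)
qed (use assms in auto)

section \<open>Means and covariances of random fields\<close>

lemma borel_measurable_vecI:
  fixes f :: "'a \<Rightarrow> 'b::euclidean_space^'n"
  assumes "\<And>a. (\<lambda>x. f x $ a) \<in> borel_measurable M"
  shows "f \<in> borel_measurable M"
  unfolding borel_measurable_euclidean_space[of f]
proof
  fix i :: "'b^'n" assume "i \<in> Basis"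
  then obtain a b where "i = axis a b" by (auto simp: Basis_vec_def)
  then show "(\<lambda>x. f x \<bullet> i) \<in> borel_measurable M" using assms by (simp add: inner_axis)
qed

lemma borel_measurable_vec_nth:
  fixes f :: "'a \<Rightarrow> 'b::euclidean_space^'n"
  assumes "f \<in> borel_measurable M"
  shows "(\<lambda>x. f x $ a) \<in> borel_measurable M"
proof -
  have "(\<lambda>v :: 'b^'n. v $ a) \<in> borel_measurable borel"
    by (intro borel_measurable_continuous_onI continuous_intros)
  then show ?thesis by (rule measurable_compose[OF assms])
qed

lemma borel_measurable_column:
  fixes f :: "'a \<Rightarrow> real^'m^'n"
  assumes "f \<in> borel_measurable M" shows "(\<lambda>x. column i (f x)) \<in> borel_measurable M"
  by (intro borel_measurable_vecI) (simp add: column_def borel_measurable_vec_nth assms)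

text \<open>The bound \<open>c\<close> is uniform in the sample \<open>w\<close>, as it is for the trajectory, whose parameters range over a
  cube; hence all second moments are finite.\<close>

definition random_L2 :: "'w measure \<Rightarrow> (real^3) set \<Rightarrow> real \<Rightarrow> ('w \<Rightarrow> real^3 \<Rightarrow> real^3) \<Rightarrow> bool" where
  "random_L2 P D c u \<longleftrightarrow> (\<lambda>(w, x). u w x) \<in> borel_measurable (P \<Otimes>\<^sub>M lebesgue_on D) \<and>
     (\<forall>w\<in>space P. sq_integrable (lebesgue_on D) (u w) \<and>
        (\<integral>x. (norm (u w x))\<^sup>2 \<partial>lebesgue_on D) \<le> c\<^sup>2)"

text \<open>A random field with a jointly measurable choice \<open>v\<close> of its weak curls, so that the mean of \<open>v\<close> makes sense
  pointwise.\<close>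

definition random_curl ::
    "'w measure \<Rightarrow> (real^3) set \<Rightarrow> ('w \<Rightarrow> real^3 \<Rightarrow> real^3) \<Rightarrow> ('w \<Rightarrow> real^3 \<Rightarrow> real^3) \<Rightarrow> bool" where
  "random_curl P D u v \<longleftrightarrow> (\<lambda>(w, x). u w x) \<in> borel_measurable (P \<Otimes>\<^sub>M lebesgue_on D) \<and>
     (\<lambda>(w, x). v w x) \<in> borel_measurable (P \<Otimes>\<^sub>M lebesgue_on D) \<and>
     (\<forall>w\<in>space P. has_weak_curl D (u w) (v w))"

lemma prod_mult_integrable:
  fixes f g :: "_ \<Rightarrow> real"
  assumes "sigma_finite_measure M1" "sigma_finite_measure M2"
    and f: "integrable M1 f" and g: "integrable M2 g"
  shows "integrable (M1 \<Otimes>\<^sub>M M2) (\<lambda>(x, y). f x * g y)"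
    "(\<integral>p. (case p of (x, y) \<Rightarrow> f x * g y) \<partial>(M1 \<Otimes>\<^sub>M M2)) = (\<integral>x. f x \<partial>M1) * (\<integral>y. g y \<partial>M2)"
proof -
  interpret pair_sigma_finite M1 M2 using assms by (simp add: pair_sigma_finite_def)
  have [measurable]: "f \<in> borel_measurable M1" "g \<in> borel_measurable M2" using f g by auto
  show int: "integrable (M1 \<Otimes>\<^sub>M M2) (\<lambda>(x, y). f x * g y)"
  proof (rule Fubini_integrable)
    show "integrable M1 (\<lambda>x. \<integral>y. norm (case (x, y) of (x, y) \<Rightarrow> f x * g y) \<partial>M2)"
      using f by (simp add: abs_mult)
    show "AE x in M1. integrable M2 (\<lambda>y. case (x, y) of (x, y) \<Rightarrow> f x * g y)"
      using g by simp
  qed measurable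
  show "(\<integral>p. (case p of (x, y) \<Rightarrow> f x * g y) \<partial>(M1 \<Otimes>\<^sub>M M2)) = (\<integral>x. f x \<partial>M1) * (\<integral>y. g y \<partial>M2)"
    using integral_fst[OF int] by simp
qed

lemma AE_prod_fst:
  assumes "sigma_finite_measure M2" "AE x in M1. Q x"
  shows "AE p in M1 \<Otimes>\<^sub>M M2. Q (fst p)"
proof -
  interpret sigma_finite_measure M2 by fact
  obtain N where N: "N \<in> null_sets M1" "{x \<in> space M1. \<not> Q x} \<subseteq> N"
    using assms(2) by (auto elim!: AE_E simp: null_sets_def)
  show ?thesis
  proof (rule AE_I')
    show "N \<times> space M2 \<in> null_sets (M1 \<Otimes>\<^sub>M M2)" using N(1) by (rule times_in_null_sets1) simp
    show "{p \<in> space (M1 \<Otimes>\<^sub>M M2). \<not> Q (fst p)} \<subseteq> N \<times> space M2"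
      using N(2) by (auto simp: space_pair_measure)
  qed
qed

lemma AE_prod_snd:
  assumes "sigma_finite_measure M2" "AE y in M2. Q y"
  shows "AE p in M1 \<Otimes>\<^sub>M M2. Q (snd p)"
proof -
  interpret sigma_finite_measure M2 by fact
  obtain N where N: "N \<in> null_sets M2" "{y \<in> space M2. \<not> Q y} \<subseteq> N"
    using assms(2) by (auto elim!: AE_E simp: null_sets_def)
  show ?thesis
  proof (rule AE_I')
    show "space M1 \<times> N \<in> null_sets (M1 \<Otimes>\<^sub>M M2)" using N(1) by (intro times_in_null_sets2) simp
    show "{p \<in> space (M1 \<Otimes>\<^sub>M M2). \<not> Q (snd p)} \<subseteq> space M1 \<times> N"
      using N(2) by (auto simp: space_pair_measure)
  qed
qed

context
  fixes P :: "'w measure" and D :: "(real^3) set"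
  assumes P: "prob_space P" and D: "open D" "bounded D"
begin

interpretation P: prob_space P by (rule P)
interpretation DD: finite_measure "lebesgue_on D" by (rule finite_measure_domain[OF D])
interpretation PD: pair_sigma_finite P "lebesgue_on D" ..
interpretation DPair: pair_sigma_finite "lebesgue_on D" "lebesgue_on D" ..

lemma random_L2_swap:
  "(\<lambda>(w, x). u w x) \<in> borel_measurable (P \<Otimes>\<^sub>M lebesgue_on D) \<Longrightarrow>
   (\<lambda>(x, w). u w x) \<in> borel_measurable (lebesgue_on D \<Otimes>\<^sub>M P)"
  using measurable_pair_swap[of "\<lambda>(w, x). u w x" P "lebesgue_on D" borel] by (simp add: case_prod_beta)

lemma random_L2_integrable:
  assumes u: "random_L2 P D c u"
  shows "integrable (P \<Otimes>\<^sub>M lebesgue_on D) (\<lambda>(w, x). (norm (u w x))\<^sup>2)"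
    "(\<integral>w. (\<integral>x. (norm (u w x))\<^sup>2 \<partial>lebesgue_on D) \<partial>P) \<le> c\<^sup>2"
proof -
  have m [measurable]: "(\<lambda>(w, x). u w x) \<in> borel_measurable (P \<Otimes>\<^sub>M lebesgue_on D)"
    using u by (simp add: random_L2_def)
  have b: "\<And>w. w \<in> space P \<Longrightarrow> (\<integral>x. (norm (u w x))\<^sup>2 \<partial>lebesgue_on D) \<le> c\<^sup>2"
    and s: "\<And>w. w \<in> space P \<Longrightarrow> sq_integrable (lebesgue_on D) (u w)"
    using u by (auto simp: random_L2_def)
  have I: "integrable P (\<lambda>w. \<integral>x. (norm (u w x))\<^sup>2 \<partial>lebesgue_on D)"
  proof (rule P.integrable_const_bound[where B = "c\<^sup>2"])
    show "AE w in P. norm (\<integral>x. (norm (u w x))\<^sup>2 \<partial>lebesgue_on D) \<le> c\<^sup>2"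
      using b by (intro AE_I2) simp
  qed measurable
  show "integrable (P \<Otimes>\<^sub>M lebesgue_on D) (\<lambda>(w, x). (norm (u w x))\<^sup>2)"
  proof (rule PD.Fubini_integrable)
    show "integrable P (\<lambda>w. \<integral>x. norm (case (w, x) of (w, x) \<Rightarrow> (norm (u w x))\<^sup>2) \<partial>lebesgue_on D)"
      using I by simp
    show "AE w in P. integrable (lebesgue_on D) (\<lambda>x. case (w, x) of (w, x) \<Rightarrow> (norm (u w x))\<^sup>2)"
      using s by (intro AE_I2) (simp add: sq_integrable_def)
  qed measurable
  have "(\<integral>w. (\<integral>x. (norm (u w x))\<^sup>2 \<partial>lebesgue_on D) \<partial>P) \<le> (\<integral>w. c\<^sup>2 \<partial>P)"
    using I b by (intro integral_mono) auto
  then show "(\<integral>w. (\<integral>x. (norm (u w x))\<^sup>2 \<partial>lebesgue_on D) \<partial>P) \<le> c\<^sup>2" by (simp add: P.prob_space)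
qed

lemma random_L2_slices:
  assumes u: "random_L2 P D c u"
  shows "AE x in lebesgue_on D. sq_integrable P (\<lambda>w. u w x)"
    "integrable (lebesgue_on D) (\<lambda>x. \<integral>w. (norm (u w x))\<^sup>2 \<partial>P)"
    "(\<integral>x. (\<integral>w. (norm (u w x))\<^sup>2 \<partial>P) \<partial>lebesgue_on D)
      = (\<integral>w. (\<integral>x. (norm (u w x))\<^sup>2 \<partial>lebesgue_on D) \<partial>P)"
    "(\<integral>x. (\<integral>w. (norm (u w x))\<^sup>2 \<partial>P) \<partial>lebesgue_on D) \<le> c\<^sup>2"
proof -
  have m [measurable]: "(\<lambda>(w, x). u w x) \<in> borel_measurable (P \<Otimes>\<^sub>M lebesgue_on D)"
    using u by (simp add: random_L2_def)
  have sl: "(\<lambda>w. u w x) \<in> borel_measurable P" if "x \<in> space (lebesgue_on D)" for x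
    using measurable_compose[OF measurable_Pair2'[OF that] m] by simp
  note I = random_L2_integrable[OF u]
  show "AE x in lebesgue_on D. sq_integrable P (\<lambda>w. u w x)"
    using PD.AE_integrable_snd[OF I(1)] AE_space
    by eventually_elim (simp add: sq_integrable_def sl)
  show "integrable (lebesgue_on D) (\<lambda>x. \<integral>w. (norm (u w x))\<^sup>2 \<partial>P)" by (rule PD.integrable_snd[OF I(1)])
  show eq: "(\<integral>x. (\<integral>w. (norm (u w x))\<^sup>2 \<partial>P) \<partial>lebesgue_on D)
      = (\<integral>w. (\<integral>x. (norm (u w x))\<^sup>2 \<partial>lebesgue_on D) \<partial>P)"
    using PD.Fubini_integral[OF I(1)] by simp
  then show "(\<integral>x. (\<integral>w. (norm (u w x))\<^sup>2 \<partial>P) \<partial>lebesgue_on D) \<le> c\<^sup>2" using I(2) by simp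
qed

lemma norm_weighted_mean_le:
  fixes q :: "'w \<Rightarrow> real" and v :: "'w \<Rightarrow> 'b::euclidean_space"
  assumes q: "sq_integrable P q" and v: "sq_integrable P v"
  shows "integrable P (\<lambda>w. q w *\<^sub>R v w)"
    "(norm (\<integral>w. q w *\<^sub>R v w \<partial>P))\<^sup>2 \<le> (\<integral>w. (q w)\<^sup>2 \<partial>P) * (\<integral>w. (norm (v w))\<^sup>2 \<partial>P)"
proof -
  show "integrable P (\<lambda>w. q w *\<^sub>R v w)"
    using sq_integrable_norm_mult[OF q v] q v
    by (subst integrable_norm_iff[symmetric]) (auto simp: sq_integrable_def)
  have "norm (\<integral>w. q w *\<^sub>R v w \<partial>P) \<le> (\<integral>w. norm (q w) * norm (v w) \<partial>P)"
    using integral_norm_bound[of P "\<lambda>w. q w *\<^sub>R v w"] by simp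
  also have "\<dots> \<le> sqrt (\<integral>w. (q w)\<^sup>2 \<partial>P) * sqrt (\<integral>w. (norm (v w))\<^sup>2 \<partial>P)"
    using sq_integrable_Cauchy_Schwarz[OF q v] by simp
  finally have "(norm (\<integral>w. q w *\<^sub>R v w \<partial>P))\<^sup>2 \<le> (sqrt (\<integral>w. (q w)\<^sup>2 \<partial>P) * sqrt (\<integral>w. (norm (v w))\<^sup>2 \<partial>P))\<^sup>2"
    by (rule power_mono) simp
  then show "(norm (\<integral>w. q w *\<^sub>R v w \<partial>P))\<^sup>2 \<le> (\<integral>w. (q w)\<^sup>2 \<partial>P) * (\<integral>w. (norm (v w))\<^sup>2 \<partial>P)"
    by (simp add: power_mult_distrib)
qed

lemma weighted_mean_L2:
  assumes q: "sq_integrable P q" and u: "random_L2 P D c u"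
  defines "m \<equiv> \<lambda>x. \<integral>w. q w *\<^sub>R u w x \<partial>P"
  shows "m \<in> borel_measurable (lebesgue_on D)"
    "AE x in lebesgue_on D. (norm (m x))\<^sup>2 \<le> (\<integral>w. (q w)\<^sup>2 \<partial>P) * (\<integral>w. (norm (u w x))\<^sup>2 \<partial>P)"
    "sq_integrable (lebesgue_on D) m"
proof -
  have [measurable]: "(\<lambda>(x, w). u w x) \<in> borel_measurable (lebesgue_on D \<Otimes>\<^sub>M P)" "q \<in> borel_measurable P"
    using u q by (auto simp: random_L2_def sq_integrable_def intro: random_L2_swap)
  show m: "m \<in> borel_measurable (lebesgue_on D)" unfolding m_def by measurable
  show b: "AE x in lebesgue_on D. (norm (m x))\<^sup>2 \<le> (\<integral>w. (q w)\<^sup>2 \<partial>P) * (\<integral>w. (norm (u w x))\<^sup>2 \<partial>P)"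
    using random_L2_slices(1)[OF u] unfolding m_def
    by eventually_elim (rule norm_weighted_mean_le(2)[OF q])
  have "integrable (lebesgue_on D) (\<lambda>x. (norm (m x))\<^sup>2)"
  proof (rule Bochner_Integration.integrable_bound)
    show "integrable (lebesgue_on D) (\<lambda>x. (\<integral>w. (q w)\<^sup>2 \<partial>P) * (\<integral>w. (norm (u w x))\<^sup>2 \<partial>P))"
      using random_L2_slices(2)[OF u] by simp
    show "AE x in lebesgue_on D. norm ((norm (m x))\<^sup>2) \<le> norm ((\<integral>w. (q w)\<^sup>2 \<partial>P) * (\<integral>w. (norm (u w x))\<^sup>2 \<partial>P))"
      using b by eventually_elim simp
  qed (use m in simp)
  with m show "sq_integrable (lebesgue_on D) m" by (simp add: sq_integrable_def)
qed

text \<open>Fubini's theorem; the joint integrability of \<open>q(w) u(w,x) \<bullet> f(x)\<close> follows from \<open>|q| |u| \<le> q\<^sup>2 + |u|\<^sup>2\<close>.\<close>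

lemma weighted_mean_inner:
  assumes q: "sq_integrable P q" and u: "random_L2 P D c u"
    and f: "f \<in> borel_measurable (lebesgue_on D)" "\<And>x. norm (f x) \<le> B"
  shows "L2_inner D (\<lambda>x. \<integral>w. q w *\<^sub>R u w x \<partial>P) f = (\<integral>w. q w * L2_inner D (u w) f \<partial>P)"
proof -
  have [measurable]: "(\<lambda>(w, x). u w x) \<in> borel_measurable (P \<Otimes>\<^sub>M lebesgue_on D)" "q \<in> borel_measurable P"
    "f \<in> borel_measurable (lebesgue_on D)"
    using u q f by (auto simp: random_L2_def sq_integrable_def)
  have B: "0 \<le> B" using order_trans[OF norm_ge_zero f(2)] .
  have "integrable (P \<Otimes>\<^sub>M lebesgue_on D) (\<lambda>(w, x). (q w)\<^sup>2 * 1)"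
    using q by (intro prod_mult_integrable) (auto simp: sq_integrable_def P.sigma_finite_measure_axioms
        DD.sigma_finite_measure_axioms)
  then have q2: "integrable (P \<Otimes>\<^sub>M lebesgue_on D) (\<lambda>(w, x). (q w)\<^sup>2)" by simp
  have I: "integrable (P \<Otimes>\<^sub>M lebesgue_on D) (\<lambda>(w, x). q w * (u w x \<bullet> f x))"
  proof (rule Bochner_Integration.integrable_bound)
    show "integrable (P \<Otimes>\<^sub>M lebesgue_on D) (\<lambda>p. B * ((case p of (w, x) \<Rightarrow> (q w)\<^sup>2)
        + (case p of (w, x) \<Rightarrow> (norm (u w x))\<^sup>2)))"
      using q2 random_L2_integrable(1)[OF u] by simp
    show "AE p in P \<Otimes>\<^sub>M lebesgue_on D. norm (case p of (w, x) \<Rightarrow> q w * (u w x \<bullet> f x))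
      \<le> norm (B * ((case p of (w, x) \<Rightarrow> (q w)\<^sup>2) + (case p of (w, x) \<Rightarrow> (norm (u w x))\<^sup>2)))"
    proof (rule AE_I2, clarsimp simp: split_paired_all)
      fix w x
      have "\<bar>q w\<bar> * \<bar>u w x \<bullet> f x\<bar> \<le> \<bar>q w\<bar> * (norm (u w x) * B)"
        using Cauchy_Schwarz_ineq2[of "u w x" "f x"] mult_left_mono[OF f(2)[of x], of "norm (u w x)"]
        by (intro mult_left_mono) auto
      also have "\<dots> = B * (\<bar>q w\<bar> * norm (u w x))" by simp
      also have "\<dots> \<le> B * ((q w)\<^sup>2 + (norm (u w x))\<^sup>2)"
      proof (rule mult_left_mono[OF _ B])
        have "0 \<le> \<bar>q w\<bar> * norm (u w x)" by simp
        then show "\<bar>q w\<bar> * norm (u w x) \<le> (q w)\<^sup>2 + (norm (u w x))\<^sup>2"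
          using sum_squares_bound[of "\<bar>q w\<bar>" "norm (u w x)"] unfolding power2_abs by linarith
      qed
      also have "\<dots> = \<bar>B\<bar> * \<bar>(q w)\<^sup>2 + (norm (u w x))\<^sup>2\<bar>" using B by simp
      finally show "\<bar>q w * (u w x \<bullet> f x)\<bar> \<le> \<bar>B * ((q w)\<^sup>2 + (norm (u w x))\<^sup>2)\<bar>" by (simp only: abs_mult)
    qed
  qed measurable
  have "L2_inner D (\<lambda>x. \<integral>w. q w *\<^sub>R u w x \<partial>P) f = (\<integral>x. (\<integral>w. q w * (u w x \<bullet> f x) \<partial>P) \<partial>lebesgue_on D)"
    unfolding L2_inner_def
  proof (rule integral_cong_AE)
    show "AE x in lebesgue_on D. (\<integral>w. q w *\<^sub>R u w x \<partial>P) \<bullet> f x = (\<integral>w. q w * (u w x \<bullet> f x) \<partial>P)"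
      using random_L2_slices(1)[OF u]
    proof eventually_elim
      case (elim x)
      show ?case
        using integral_inner_left[of "f x" P "\<lambda>w. q w *\<^sub>R u w x"] norm_weighted_mean_le(1)[OF q elim] by simp
    qed
    show "(\<lambda>x. (\<integral>w. q w *\<^sub>R u w x \<partial>P) \<bullet> f x) \<in> borel_measurable (lebesgue_on D)"
      using weighted_mean_L2(1)[OF q u] by measurable
    have [measurable]: "(\<lambda>(x, w). u w x) \<in> borel_measurable (lebesgue_on D \<Otimes>\<^sub>M P)"
      using u by (auto simp: random_L2_def intro: random_L2_swap)
    show "(\<lambda>x. \<integral>w. q w * (u w x \<bullet> f x) \<partial>P) \<in> borel_measurable (lebesgue_on D)" by measurable
  qed
  also have "\<dots> = (\<integral>w. (\<integral>x. q w * (u w x \<bullet> f x) \<partial>lebesgue_on D) \<partial>P)"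
    by (rule PD.Fubini_integral[OF I])
  finally show ?thesis by (simp add: L2_inner_def)
qed

text \<open>A weak curl is defined by pairings with test fields, which commute with the mean. The weight \<open>q = 1\<close>
  gives the mean of the field; an entry of a second field at a fixed point gives a column of a kernel.\<close>

lemma weighted_mean_weak_curl:
  assumes q: "sq_integrable P q" and u: "random_L2 P D c u" and v: "random_L2 P D c v"
    and curl: "\<And>w. w \<in> space P \<Longrightarrow> has_weak_curl D (u w) (v w)"
  shows "has_weak_curl D (\<lambda>x. \<integral>w. q w *\<^sub>R u w x \<partial>P) (\<lambda>x. \<integral>w. q w *\<^sub>R v w x \<partial>P)"
  unfolding has_weak_curl_def
proof (intro conjI allI impI weighted_mean_L2(3)[OF q u] weighted_mean_L2(3)[OF q v])
  fix f :: "real^3 \<Rightarrow> real^3" assume f: "test_field D f"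
  note t = test_field_sq_integrable[OF D f]
  obtain B1 B2 where B: "\<And>x. norm (f x) \<le> B1" "\<And>x. norm (curl f x) \<le> B2" using t(3,4) by blast
  have "L2_inner D (\<lambda>x. \<integral>w. q w *\<^sub>R v w x \<partial>P) f = (\<integral>w. q w * L2_inner D (v w) f \<partial>P)"
    using t(1) by (intro weighted_mean_inner[OF q v _ B(1)]) (simp add: sq_integrable_def)
  also have "\<dots> = (\<integral>w. q w * L2_inner D (u w) (curl f) \<partial>P)"
    using curl f by (intro Bochner_Integration.integral_cong) (auto simp: has_weak_curl_def)
  also have "\<dots> = L2_inner D (\<lambda>x. \<integral>w. q w *\<^sub>R u w x \<partial>P) (curl f)"
    using t(2) by (intro weighted_mean_inner[OF q u _ B(2), symmetric]) (simp add: sq_integrable_def)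
  finally show "L2_inner D (\<lambda>x. \<integral>w. q w *\<^sub>R v w x \<partial>P) f = L2_inner D (\<lambda>x. \<integral>w. q w *\<^sub>R u w x \<partial>P) (curl f)" .
qed

lemma random_curl_L2:
  assumes uv: "random_curl P D u v" and b: "\<And>w. w \<in> space P \<Longrightarrow> Hcurl_norm D (u w) \<le> c"
  shows "random_L2 P D c u" "random_L2 P D c v"
proof -
  have "(\<integral>x. (norm (u w x))\<^sup>2 \<partial>lebesgue_on D) \<le> c\<^sup>2 \<and> (\<integral>x. (norm (v w x))\<^sup>2 \<partial>lebesgue_on D) \<le> c\<^sup>2"
    if w: "w \<in> space P" for w
  proof -
    have "(\<integral>x. (norm (u w x))\<^sup>2 \<partial>lebesgue_on D) + (\<integral>x. (norm (v w x))\<^sup>2 \<partial>lebesgue_on D) = (Hcurl_norm D (u w))\<^sup>2"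
      using uv w by (intro Hcurl_norm_sq[OF D, symmetric]) (simp add: random_curl_def)
    also have "\<dots> \<le> c\<^sup>2" by (rule power_mono[OF b[OF w] Hcurl_norm_nonneg])
    finally have sum: "(\<integral>x. (norm (u w x))\<^sup>2 \<partial>lebesgue_on D) + (\<integral>x. (norm (v w x))\<^sup>2 \<partial>lebesgue_on D) \<le> c\<^sup>2" .
    have "0 \<le> (\<integral>x. (norm (u w x))\<^sup>2 \<partial>lebesgue_on D)" "0 \<le> (\<integral>x. (norm (v w x))\<^sup>2 \<partial>lebesgue_on D)"
      by (simp_all del: power2_norm_eq_inner)
    with sum show ?thesis by linarith
  qed
  then show "random_L2 P D c u" "random_L2 P D c v"
    using uv by (auto simp: random_L2_def random_curl_def has_weak_curl_def)
qed

text \<open>By Jensen's inequality, applied pointwise to the field and to its curl and then integrated over \<open>D\<close>, taking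
  means does not increase the norm of \<open>H(curl)\<close>.\<close>

lemma mean_Hcurl:
  assumes uv: "random_curl P D u v" and b: "\<And>w. w \<in> space P \<Longrightarrow> Hcurl_norm D (u w) \<le> c" and c: "0 \<le> c"
  shows "has_weak_curl D (\<lambda>x. \<integral>w. u w x \<partial>P) (\<lambda>x. \<integral>w. v w x \<partial>P)"
    "Hcurl_norm D (\<lambda>x. \<integral>w. u w x \<partial>P) \<le> c"
proof -
  note u = random_curl_L2(1)[OF uv b] and v = random_curl_L2(2)[OF uv b]
  have one: "sq_integrable P (\<lambda>_. 1::real)" by (simp add: sq_integrable_def)
  show wc: "has_weak_curl D (\<lambda>x. \<integral>w. u w x \<partial>P) (\<lambda>x. \<integral>w. v w x \<partial>P)"
    using weighted_mean_weak_curl[OF one u v] uv by (simp add: random_curl_def)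
  have le: "(\<integral>x. (norm (\<integral>w. u w x \<partial>P))\<^sup>2 \<partial>lebesgue_on D)
      \<le> (\<integral>w. (\<integral>x. (norm (u w x))\<^sup>2 \<partial>lebesgue_on D) \<partial>P)" if u: "random_L2 P D c u" for u
    unfolding random_L2_slices(3)[OF u, symmetric]
  proof (rule integral_mono_AE)
    show "integrable (lebesgue_on D) (\<lambda>x. (norm (\<integral>w. u w x \<partial>P))\<^sup>2)"
      using weighted_mean_L2(3)[OF one u] by (simp add: sq_integrable_def)
    show "AE x in lebesgue_on D. (norm (\<integral>w. u w x \<partial>P))\<^sup>2 \<le> (\<integral>w. (norm (u w x))\<^sup>2 \<partial>P)"
      using weighted_mean_L2(2)[OF one u] by (simp add: P.prob_space)
  qed (rule random_L2_slices(2)[OF u])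
  have int: "integrable P (\<lambda>w. \<integral>x. (norm (u w x))\<^sup>2 \<partial>lebesgue_on D)" if u: "random_L2 P D c u" for u
    by (rule PD.integrable_fst[OF random_L2_integrable(1)[OF u]])
  have "(Hcurl_norm D (\<lambda>x. \<integral>w. u w x \<partial>P))\<^sup>2
      \<le> (\<integral>w. (\<integral>x. (norm (u w x))\<^sup>2 \<partial>lebesgue_on D) \<partial>P) + (\<integral>w. (\<integral>x. (norm (v w x))\<^sup>2 \<partial>lebesgue_on D) \<partial>P)"
    unfolding Hcurl_norm_sq[OF D wc] by (intro add_mono le u v)
  also have "\<dots> = (\<integral>w. (\<integral>x. (norm (u w x))\<^sup>2 \<partial>lebesgue_on D) + (\<integral>x. (norm (v w x))\<^sup>2 \<partial>lebesgue_on D) \<partial>P)"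
    using int[OF u] int[OF v] by simp
  also have "\<dots> = (\<integral>w. (Hcurl_norm D (u w))\<^sup>2 \<partial>P)"
    using uv by (intro Bochner_Integration.integral_cong) (auto simp: Hcurl_norm_sq[OF D] random_curl_def)
  also have "\<dots> \<le> (\<integral>w. c\<^sup>2 \<partial>P)"
  proof (rule integral_mono)
    have "integrable P (\<lambda>w. (\<integral>x. (norm (u w x))\<^sup>2 \<partial>lebesgue_on D) + (\<integral>x. (norm (v w x))\<^sup>2 \<partial>lebesgue_on D))"
      using int[OF u] int[OF v] by simp
    also have "?this \<longleftrightarrow> integrable P (\<lambda>w. (Hcurl_norm D (u w))\<^sup>2)"
      using uv by (intro Bochner_Integration.integrable_cong) (auto simp: Hcurl_norm_sq[OF D] random_curl_def)
    finally show "integrable P (\<lambda>w. (Hcurl_norm D (u w))\<^sup>2)" .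
    show "(Hcurl_norm D (u w))\<^sup>2 \<le> c\<^sup>2" if "w \<in> space P" for w
      by (rule power_mono[OF b[OF that] Hcurl_norm_nonneg])
  qed simp
  finally have "(Hcurl_norm D (\<lambda>x. \<integral>w. u w x \<partial>P))\<^sup>2 \<le> c\<^sup>2" by (simp add: P.prob_space)
  then show "Hcurl_norm D (\<lambda>x. \<integral>w. u w x \<partial>P) \<le> c" using c by (rule power2_le_imp_le)
qed

end

section \<open>Covariance kernels\<close>

text \<open>The mean of \<open>u(x) v(y)\<^sup>T\<close>. For centered columns of a random field this is a block of its covariance.\<close>

definition correlation_kernel :: "'w measure \<Rightarrow> ('w \<Rightarrow> real^3 \<Rightarrow> real^3) \<Rightarrow> ('w \<Rightarrow> real^3 \<Rightarrow> real^3) \<Rightarrow>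
    real^3 \<Rightarrow> real^3 \<Rightarrow> real^3^3" where
  "correlation_kernel P u v x y = (\<chi> a b. \<integral>w. u w x $ a * v w y $ b \<partial>P)"

lemma sq_integrable_vec_nth: "sq_integrable \<mu> (v :: 'c \<Rightarrow> real^'n) \<Longrightarrow> sq_integrable \<mu> (\<lambda>w. v w $ b)"
  by (rule sq_integrable_bounded_linear) (rule bounded_linear_vec_nth)

lemma column_borel_slices:
  fixes K :: "real^3 \<Rightarrow> real^3 \<Rightarrow> real^3^3"
  assumes K: "(\<lambda>(x, y). K x y) \<in> borel_measurable (M \<Otimes>\<^sub>M N)"
  shows "y \<in> space N \<Longrightarrow> (\<lambda>x. column b (K x y)) \<in> borel_measurable M"
    "x \<in> space M \<Longrightarrow> (\<lambda>y. row a (K x y)) \<in> borel_measurable N"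
proof -
  show "(\<lambda>x. column b (K x y)) \<in> borel_measurable M" if "y \<in> space N"
    using measurable_compose[OF measurable_Pair2'[OF that] K] by (intro borel_measurable_column) simp
  show "(\<lambda>y. row a (K x y)) \<in> borel_measurable N" if "x \<in> space M"
    using borel_measurable_vec_nth[OF measurable_compose[OF measurable_Pair1'[OF that] K], of a]
    by (simp add: row_def)
qed

lemma L2_sq2_add_le:
  assumes "sq_integrable2 D K" "sq_integrable2 D K'"
  shows "L2_sq2 D (\<lambda>x y. K x y + K' x y) \<le> 2 * L2_sq2 D K + 2 * L2_sq2 D K'"
proof -
  let ?M = "lebesgue_on D \<Otimes>\<^sub>M lebesgue_on D"
  have i: "integrable ?M (\<lambda>p. (norm (case p of (x, y) \<Rightarrow> K x y))\<^sup>2)"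
    "integrable ?M (\<lambda>p. (norm (case p of (x, y) \<Rightarrow> K' x y))\<^sup>2)"
    using assms by (auto simp: sq_integrable2_def sq_integrable_def)
  have "sq_integrable ?M (\<lambda>p. (case p of (x, y) \<Rightarrow> K x y) + (case p of (x, y) \<Rightarrow> K' x y))"
    using assms by (intro sq_integrable_add) (auto simp: sq_integrable2_def)
  then have s: "integrable ?M (\<lambda>p. (norm ((case p of (x, y) \<Rightarrow> K x y) + (case p of (x, y) \<Rightarrow> K' x y)))\<^sup>2)"
    by (simp add: sq_integrable_def)
  have "(\<integral>p. (norm ((case p of (x, y) \<Rightarrow> K x y) + (case p of (x, y) \<Rightarrow> K' x y)))\<^sup>2 \<partial>?M)
      \<le> (\<integral>p. 2 * (norm (case p of (x, y) \<Rightarrow> K x y))\<^sup>2 + 2 * (norm (case p of (x, y) \<Rightarrow> K' x y))\<^sup>2 \<partial>?M)"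
  proof (rule integral_mono[OF s])
    show "integrable ?M (\<lambda>p. 2 * (norm (case p of (x, y) \<Rightarrow> K x y))\<^sup>2 + 2 * (norm (case p of (x, y) \<Rightarrow> K' x y))\<^sup>2)"
      using i by simp
    fix p
    define A where "A = (case p of (x, y) \<Rightarrow> K x y)"
    define B where "B = (case p of (x, y) \<Rightarrow> K' x y)"
    have "(norm (A + B))\<^sup>2 \<le> (norm A + norm B)\<^sup>2" by (intro power_mono norm_triangle_ineq) simp
    also have "\<dots> \<le> 2 * (norm A)\<^sup>2 + 2 * (norm B)\<^sup>2"
      using sum_squares_bound[of "norm A" "norm B"] by (simp add: power2_sum)
    finally show "(norm ((case p of (x, y) \<Rightarrow> K x y) + (case p of (x, y) \<Rightarrow> K' x y)))\<^sup>2
        \<le> 2 * (norm (case p of (x, y) \<Rightarrow> K x y))\<^sup>2 + 2 * (norm (case p of (x, y) \<Rightarrow> K' x y))\<^sup>2"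
      by (simp add: A_def B_def)
  qed
  also have "\<dots> = 2 * (\<integral>p. (norm (case p of (x, y) \<Rightarrow> K x y))\<^sup>2 \<partial>?M) + 2 * (\<integral>p. (norm (case p of (x, y) \<Rightarrow> K' x y))\<^sup>2 \<partial>?M)"
    using i by simp
  finally show ?thesis by (simp add: L2_sq2_def case_prod_beta')
qed

lemma sq_integrable2_add:
  assumes "sq_integrable2 D K" "sq_integrable2 D K'"
  shows "sq_integrable2 D (\<lambda>x y. K x y + K' x y)"
  using sq_integrable_add[OF assms[unfolded sq_integrable2_def]]
  by (simp add: sq_integrable2_def case_prod_beta')

lemma column_add: "column b (A + B) = column b A + column b B"
  and row_add: "row a (A + B) = row a A + row a B" for A B :: "real^'m^'n"
  by (simp_all add: column_def row_def vec_eq_iff)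

context
  fixes D :: "(real^3) set"
  assumes D: "open D" "bounded D"
begin

interpretation DD: finite_measure "lebesgue_on D" by (rule finite_measure_domain[OF D])
interpretation DPair: pair_sigma_finite "lebesgue_on D" "lebesgue_on D" ..

text \<open>The curls in \<open>x\<close> and in \<open>y\<close> refer to slices of a kernel, but equality of kernels is meant up to null sets of
  the product; Fubini's theorem relates the two.\<close>

lemma AE_pair_eq_slices:
  fixes K K' :: "real^3 \<Rightarrow> real^3 \<Rightarrow> 'b::euclidean_space"
  assumes "(\<lambda>(x, y). K x y) \<in> borel_measurable (lebesgue_on D \<Otimes>\<^sub>M lebesgue_on D)"
    "(\<lambda>(x, y). K' x y) \<in> borel_measurable (lebesgue_on D \<Otimes>\<^sub>M lebesgue_on D)"
  shows "(AE p in lebesgue_on D \<Otimes>\<^sub>M lebesgue_on D. K (fst p) (snd p) = K' (fst p) (snd p))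
      \<longleftrightarrow> (AE x in lebesgue_on D. AE y in lebesgue_on D. K x y = K' x y)"
    "(AE p in lebesgue_on D \<Otimes>\<^sub>M lebesgue_on D. K (fst p) (snd p) = K' (fst p) (snd p))
      \<longleftrightarrow> (AE y in lebesgue_on D. AE x in lebesgue_on D. K x y = K' x y)"
proof -
  have [measurable]: "(\<lambda>p. K (fst p) (snd p)) \<in> borel_measurable (lebesgue_on D \<Otimes>\<^sub>M lebesgue_on D)"
    "(\<lambda>p. K' (fst p) (snd p)) \<in> borel_measurable (lebesgue_on D \<Otimes>\<^sub>M lebesgue_on D)"
    using assms by (simp_all add: case_prod_beta')
  have m: "{p \<in> space (lebesgue_on D \<Otimes>\<^sub>M lebesgue_on D). K (fst p) (snd p) = K' (fst p) (snd p)}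
      \<in> sets (lebesgue_on D \<Otimes>\<^sub>M lebesgue_on D)"
    by measurable
  show 1: "(AE p in lebesgue_on D \<Otimes>\<^sub>M lebesgue_on D. K (fst p) (snd p) = K' (fst p) (snd p))
      \<longleftrightarrow> (AE x in lebesgue_on D. AE y in lebesgue_on D. K x y = K' x y)"
    using DPair.AE_pair_iff[OF m] by simp
  show "(AE p in lebesgue_on D \<Otimes>\<^sub>M lebesgue_on D. K (fst p) (snd p) = K' (fst p) (snd p))
      \<longleftrightarrow> (AE y in lebesgue_on D. AE x in lebesgue_on D. K x y = K' x y)"
    unfolding 1 by (rule DPair.AE_commute[OF m])
qed

lemma sq_integrable2_cong_AE:
  assumes "sq_integrable2 D K"
    "AE p in lebesgue_on D \<Otimes>\<^sub>M lebesgue_on D. K (fst p) (snd p) = K' (fst p) (snd p)"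
    "(\<lambda>(x, y). K' x y) \<in> borel_measurable (lebesgue_on D \<Otimes>\<^sub>M lebesgue_on D)"
  shows "sq_integrable2 D K'"
  using assms unfolding sq_integrable2_def
  by (elim sq_integrable_cong_AE) (auto simp: case_prod_beta)

lemma L2_sq2_cong_AE:
  assumes "sq_integrable2 D K" "sq_integrable2 D K'"
    "AE p in lebesgue_on D \<Otimes>\<^sub>M lebesgue_on D. K (fst p) (snd p) = K' (fst p) (snd p)"
  shows "L2_sq2 D K = L2_sq2 D K'"
proof -
  have [measurable]: "(\<lambda>p. K (fst p) (snd p)) \<in> borel_measurable (lebesgue_on D \<Otimes>\<^sub>M lebesgue_on D)"
    "(\<lambda>p. K' (fst p) (snd p)) \<in> borel_measurable (lebesgue_on D \<Otimes>\<^sub>M lebesgue_on D)"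
    using assms by (simp_all add: sq_integrable2_def sq_integrable_def case_prod_beta')
  show ?thesis
    unfolding L2_sq2_def case_prod_beta using assms(3) by (intro integral_cong_AE) auto
qed

lemma has_curl_x_cong_AE:
  assumes KS: "has_curl_x D K S"
    and K: "AE p in lebesgue_on D \<Otimes>\<^sub>M lebesgue_on D. K (fst p) (snd p) = K' (fst p) (snd p)"
      "(\<lambda>(x, y). K' x y) \<in> borel_measurable (lebesgue_on D \<Otimes>\<^sub>M lebesgue_on D)"
    and S: "AE p in lebesgue_on D \<Otimes>\<^sub>M lebesgue_on D. S (fst p) (snd p) = S' (fst p) (snd p)"
      "(\<lambda>(x, y). S' x y) \<in> borel_measurable (lebesgue_on D \<Otimes>\<^sub>M lebesgue_on D)"
  shows "has_curl_x D K' S'"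
proof -
  have sq: "sq_integrable2 D K" "sq_integrable2 D S" using KS by (auto simp: has_curl_x_def)
  then have m: "(\<lambda>(x, y). K x y) \<in> borel_measurable (lebesgue_on D \<Otimes>\<^sub>M lebesgue_on D)"
    "(\<lambda>(x, y). S x y) \<in> borel_measurable (lebesgue_on D \<Otimes>\<^sub>M lebesgue_on D)"
    by (auto simp: sq_integrable2_def sq_integrable_def)
  have 1: "AE y in lebesgue_on D. AE x in lebesgue_on D. K x y = K' x y"
    using K(1) AE_pair_eq_slices(2)[OF m(1) K(2)] by blast
  have 2: "AE y in lebesgue_on D. AE x in lebesgue_on D. S x y = S' x y"
    using S(1) AE_pair_eq_slices(2)[OF m(2) S(2)] by blast
  have 3: "AE y in lebesgue_on D. \<forall>b. has_weak_curl D (\<lambda>x. column b (K x y)) (\<lambda>x. column b (S x y))"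
    using KS by (simp add: has_curl_x_def)
  have "AE y in lebesgue_on D. \<forall>b. has_weak_curl D (\<lambda>x. column b (K' x y)) (\<lambda>x. column b (S' x y))"
    using 1 2 3 AE_space
  proof eventually_elim
    case (elim y)
    show ?case
    proof
      fix b
      show "has_weak_curl D (\<lambda>x. column b (K' x y)) (\<lambda>x. column b (S' x y))"
      proof (rule has_weak_curl_cong_AE[OF D elim(3)[rule_format, of b]])
        show "AE x in lebesgue_on D. column b (K x y) = column b (K' x y)"
          using elim(1) by eventually_elim simp
        show "AE x in lebesgue_on D. column b (S x y) = column b (S' x y)"
          using elim(2) by eventually_elim simp
      qed (rule column_borel_slices[OF K(2) elim(4)] column_borel_slices[OF S(2) elim(4)])+
    qed
  qed
  then show ?thesis
    using sq_integrable2_cong_AE[OF sq(1) K] sq_integrable2_cong_AE[OF sq(2) S] by (simp add: has_curl_x_def)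
qed

lemma has_curl_y_cong_AE:
  assumes KS: "has_curl_y D K S"
    and K: "AE p in lebesgue_on D \<Otimes>\<^sub>M lebesgue_on D. K (fst p) (snd p) = K' (fst p) (snd p)"
      "(\<lambda>(x, y). K' x y) \<in> borel_measurable (lebesgue_on D \<Otimes>\<^sub>M lebesgue_on D)"
  shows "has_curl_y D K' S"
proof -
  have sq: "sq_integrable2 D K" "sq_integrable2 D S" using KS by (auto simp: has_curl_y_def)
  then have m: "(\<lambda>(x, y). K x y) \<in> borel_measurable (lebesgue_on D \<Otimes>\<^sub>M lebesgue_on D)"
    "(\<lambda>(x, y). S x y) \<in> borel_measurable (lebesgue_on D \<Otimes>\<^sub>M lebesgue_on D)"
    by (auto simp: sq_integrable2_def sq_integrable_def)
  have 1: "AE x in lebesgue_on D. AE y in lebesgue_on D. K x y = K' x y"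
    using K(1) AE_pair_eq_slices(1)[OF m(1) K(2)] by blast
  have 3: "AE x in lebesgue_on D. \<forall>a. has_weak_curl D (\<lambda>y. row a (K x y)) (\<lambda>y. row a (S x y))"
    using KS by (simp add: has_curl_y_def)
  have "AE x in lebesgue_on D. \<forall>a. has_weak_curl D (\<lambda>y. row a (K' x y)) (\<lambda>y. row a (S x y))"
    using 1 3 AE_space
  proof eventually_elim
    case (elim x)
    show ?case
    proof
      fix a
      show "has_weak_curl D (\<lambda>y. row a (K' x y)) (\<lambda>y. row a (S x y))"
      proof (rule has_weak_curl_cong_AE[OF D elim(2)[rule_format, of a]])
        show "AE y in lebesgue_on D. row a (K x y) = row a (K' x y)"
          using elim(1) by eventually_elim simp
      qed (auto intro: column_borel_slices[OF K(2) elim(3)] column_borel_slices[OF m(2) elim(3)])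
    qed
  qed
  then show ?thesis
    using sq_integrable2_cong_AE[OF sq(1) K] sq by (simp add: has_curl_y_def)
qed

lemma has_curl_x_unique:
  assumes S: "has_curl_x D K S" and S': "has_curl_x D K S'"
  shows "AE p in lebesgue_on D \<Otimes>\<^sub>M lebesgue_on D. S (fst p) (snd p) = S' (fst p) (snd p)"
proof -
  have m: "(\<lambda>(x, y). S x y) \<in> borel_measurable (lebesgue_on D \<Otimes>\<^sub>M lebesgue_on D)"
    "(\<lambda>(x, y). S' x y) \<in> borel_measurable (lebesgue_on D \<Otimes>\<^sub>M lebesgue_on D)"
    using S S' by (auto simp: has_curl_x_def sq_integrable2_def sq_integrable_def)
  have "AE y in lebesgue_on D. \<forall>b. has_weak_curl D (\<lambda>x. column b (K x y)) (\<lambda>x. column b (S x y))"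
    "AE y in lebesgue_on D. \<forall>b. has_weak_curl D (\<lambda>x. column b (K x y)) (\<lambda>x. column b (S' x y))"
    using S S' by (auto simp: has_curl_x_def)
  then have "AE y in lebesgue_on D. AE x in lebesgue_on D. S x y = S' x y"
  proof eventually_elim
    case (elim y)
    have "AE x in lebesgue_on D. \<forall>b. column b (S x y) = column b (S' x y)"
      unfolding AE_all_countable
      using has_weak_curl_unique[OF D elim(1)[rule_format] elim(2)[rule_format]] by simp
    then show ?case by eventually_elim (simp add: column_def vec_eq_iff)
  qed
  then show ?thesis using AE_pair_eq_slices(2)[OF m] by blast
qed

lemma has_curl_y_unique:
  assumes S: "has_curl_y D K S" and S': "has_curl_y D K S'"
  shows "AE p in lebesgue_on D \<Otimes>\<^sub>M lebesgue_on D. S (fst p) (snd p) = S' (fst p) (snd p)"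
proof -
  have m: "(\<lambda>(x, y). S x y) \<in> borel_measurable (lebesgue_on D \<Otimes>\<^sub>M lebesgue_on D)"
    "(\<lambda>(x, y). S' x y) \<in> borel_measurable (lebesgue_on D \<Otimes>\<^sub>M lebesgue_on D)"
    using S S' by (auto simp: has_curl_y_def sq_integrable2_def sq_integrable_def)
  have "AE x in lebesgue_on D. \<forall>a. has_weak_curl D (\<lambda>y. row a (K x y)) (\<lambda>y. row a (S x y))"
    "AE x in lebesgue_on D. \<forall>a. has_weak_curl D (\<lambda>y. row a (K x y)) (\<lambda>y. row a (S' x y))"
    using S S' by (auto simp: has_curl_y_def)
  then have "AE x in lebesgue_on D. AE y in lebesgue_on D. S x y = S' x y"
  proof eventually_elim
    case (elim x)
    have "AE y in lebesgue_on D. \<forall>a. row a (S x y) = row a (S' x y)"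
      unfolding AE_all_countable
      using has_weak_curl_unique[OF D elim(1)[rule_format] elim(2)[rule_format]] by simp
    then show ?case by eventually_elim (simp add: row_def vec_eq_iff)
  qed
  then show ?thesis using AE_pair_eq_slices(1)[OF m] by blast
qed

lemma has_curl_x_add:
  assumes "has_curl_x D K S" "has_curl_x D K' S'"
  shows "has_curl_x D (\<lambda>x y. K x y + K' x y) (\<lambda>x y. S x y + S' x y)"
proof -
  have "AE y in lebesgue_on D. \<forall>b. has_weak_curl D (\<lambda>x. column b (K x y)) (\<lambda>x. column b (S x y))"
    "AE y in lebesgue_on D. \<forall>b. has_weak_curl D (\<lambda>x. column b (K' x y)) (\<lambda>x. column b (S' x y))"
    using assms by (auto simp: has_curl_x_def)
  then have "AE y in lebesgue_on D. \<forall>b. has_weak_curl D (\<lambda>x. column b (K x y + K' x y)) (\<lambda>x. column b (S x y + S' x y))"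
  proof eventually_elim
    case (elim y)
    show ?case
    proof
      fix b
      show "has_weak_curl D (\<lambda>x. column b (K x y + K' x y)) (\<lambda>x. column b (S x y + S' x y))"
        using has_weak_curl_lincomb[OF D elim(1)[rule_format, of b] elim(2)[rule_format, of b], of 1 1]
        by (simp add: column_add)
    qed
  qed
  then show ?thesis using assms by (simp add: has_curl_x_def sq_integrable2_add)
qed

lemma has_curl_y_add:
  assumes "has_curl_y D K S" "has_curl_y D K' S'"
  shows "has_curl_y D (\<lambda>x y. K x y + K' x y) (\<lambda>x y. S x y + S' x y)"
proof -
  have "AE x in lebesgue_on D. \<forall>a. has_weak_curl D (\<lambda>y. row a (K x y)) (\<lambda>y. row a (S x y))"
    "AE x in lebesgue_on D. \<forall>a. has_weak_curl D (\<lambda>y. row a (K' x y)) (\<lambda>y. row a (S' x y))"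
    using assms by (auto simp: has_curl_y_def)
  then have "AE x in lebesgue_on D. \<forall>a. has_weak_curl D (\<lambda>y. row a (K x y + K' x y)) (\<lambda>y. row a (S x y + S' x y))"
  proof eventually_elim
    case (elim x)
    show ?case
    proof
      fix a
      show "has_weak_curl D (\<lambda>y. row a (K x y + K' x y)) (\<lambda>y. row a (S x y + S' x y))"
        using has_weak_curl_lincomb[OF D elim(1)[rule_format, of a] elim(2)[rule_format, of a], of 1 1]
        by (simp add: row_add)
    qed
  qed
  then show ?thesis using assms by (simp add: has_curl_y_def sq_integrable2_add)
qed

text \<open>The curls that the definition of the norm chooses agree almost everywhere with any other curls of the
  kernel, so the norm can be computed from these.\<close>

lemma Hcurl2_norm_eq:
  assumes x: "has_curl_x D K Sx" and y: "has_curl_y D K Sy" and xy: "has_curl_x D Sy Sxy"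
  shows "K \<in> Hcurl2 D"
    "Hcurl2_norm D K = sqrt (L2_sq2 D K + L2_sq2 D Sx + L2_sq2 D Sy + L2_sq2 D Sxy)"
proof -
  have cx: "has_curl_x D K (curl_x D K)" unfolding curl_x_def by (rule someI[of "has_curl_x D K", OF x])
  have cy: "has_curl_y D K (curl_y D K)" unfolding curl_y_def by (rule someI[of "has_curl_y D K", OF y])
  have ex: "AE p in lebesgue_on D \<Otimes>\<^sub>M lebesgue_on D. curl_x D K (fst p) (snd p) = Sx (fst p) (snd p)"
    by (rule has_curl_x_unique[OF cx x])
  have ey: "AE p in lebesgue_on D \<Otimes>\<^sub>M lebesgue_on D. Sy (fst p) (snd p) = curl_y D K (fst p) (snd p)"
    by (rule has_curl_y_unique[OF y cy])
  have xy': "has_curl_x D (curl_y D K) Sxy"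
    by (rule has_curl_x_cong_AE[OF xy ey])
      (use cy xy in \<open>auto simp: has_curl_x_def has_curl_y_def sq_integrable2_def sq_integrable_def\<close>)
  have cxy: "has_curl_x D (curl_y D K) (curl_x D (curl_y D K))"
    unfolding curl_x_def by (rule someI[of "has_curl_x D (curl_y D K)", OF xy'])
  have exy: "AE p in lebesgue_on D \<Otimes>\<^sub>M lebesgue_on D.
      curl_x D (curl_y D K) (fst p) (snd p) = Sxy (fst p) (snd p)"
    by (rule has_curl_x_unique[OF cxy xy'])
  show "K \<in> Hcurl2 D" using x y xy' by (auto simp: Hcurl2_def)
  have "L2_sq2 D (curl_x D K) = L2_sq2 D Sx"
    by (rule L2_sq2_cong_AE[OF _ _ ex]) (use cx x in \<open>auto simp: has_curl_x_def\<close>)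
  moreover have "L2_sq2 D Sy = L2_sq2 D (curl_y D K)"
    by (rule L2_sq2_cong_AE[OF _ _ ey]) (use cy y in \<open>auto simp: has_curl_y_def\<close>)
  moreover have "L2_sq2 D (curl_x D (curl_y D K)) = L2_sq2 D Sxy"
    by (rule L2_sq2_cong_AE[OF _ _ exy]) (use cxy xy in \<open>auto simp: has_curl_x_def\<close>)
  ultimately show "Hcurl2_norm D K = sqrt (L2_sq2 D K + L2_sq2 D Sx + L2_sq2 D Sy + L2_sq2 D Sxy)"
    by (simp add: Hcurl2_norm_def)
qed

end

context
  fixes P :: "'w measure" and D :: "(real^3) set"
  assumes P: "prob_space P" and D: "open D" "bounded D"
begin

interpretation P: prob_space P by (rule P)
interpretation DD: finite_measure "lebesgue_on D" by (rule finite_measure_domain[OF D])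
interpretation PD: pair_sigma_finite P "lebesgue_on D" ..
interpretation DPair: pair_sigma_finite "lebesgue_on D" "lebesgue_on D" ..

lemma triple_measurable:
  assumes "(\<lambda>(w, x). f w x) \<in> borel_measurable (P \<Otimes>\<^sub>M lebesgue_on D)"
  shows "(\<lambda>(p, w). f w (fst p)) \<in> borel_measurable ((lebesgue_on D \<Otimes>\<^sub>M lebesgue_on D) \<Otimes>\<^sub>M P)"
    "(\<lambda>(p, w). f w (snd p)) \<in> borel_measurable ((lebesgue_on D \<Otimes>\<^sub>M lebesgue_on D) \<Otimes>\<^sub>M P)"
proof -
  have "(\<lambda>q. (snd q, fst (fst q))) \<in> (lebesgue_on D \<Otimes>\<^sub>M lebesgue_on D) \<Otimes>\<^sub>M P \<rightarrow>\<^sub>M P \<Otimes>\<^sub>M lebesgue_on D"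
    "(\<lambda>q. (snd q, snd (fst q))) \<in> (lebesgue_on D \<Otimes>\<^sub>M lebesgue_on D) \<Otimes>\<^sub>M P \<rightarrow>\<^sub>M P \<Otimes>\<^sub>M lebesgue_on D"
    by measurable
  from this[THEN measurable_compose, OF assms]
  show "(\<lambda>(p, w). f w (fst p)) \<in> borel_measurable ((lebesgue_on D \<Otimes>\<^sub>M lebesgue_on D) \<Otimes>\<^sub>M P)"
    "(\<lambda>(p, w). f w (snd p)) \<in> borel_measurable ((lebesgue_on D \<Otimes>\<^sub>M lebesgue_on D) \<Otimes>\<^sub>M P)"
    by (simp_all add: case_prod_beta')
qed

lemma correlation_kernel_measurable:
  assumes "random_L2 P D c u" "random_L2 P D c' v"
  shows "(\<lambda>(x, y). correlation_kernel P u v x y) \<in> borel_measurable (lebesgue_on D \<Otimes>\<^sub>M lebesgue_on D)"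
proof (intro borel_measurable_vecI)
  fix a b
  have [measurable]:
    "(\<lambda>(p, w). u w (fst p)) \<in> borel_measurable ((lebesgue_on D \<Otimes>\<^sub>M lebesgue_on D) \<Otimes>\<^sub>M P)"
    "(\<lambda>(p, w). v w (snd p)) \<in> borel_measurable ((lebesgue_on D \<Otimes>\<^sub>M lebesgue_on D) \<Otimes>\<^sub>M P)"
    using assms by (auto simp: random_L2_def intro: triple_measurable)
  have "(\<lambda>q. u (snd q) (fst (fst q)) $ a) \<in> borel_measurable ((lebesgue_on D \<Otimes>\<^sub>M lebesgue_on D) \<Otimes>\<^sub>M P)"
    "(\<lambda>q. v (snd q) (snd (fst q)) $ b) \<in> borel_measurable ((lebesgue_on D \<Otimes>\<^sub>M lebesgue_on D) \<Otimes>\<^sub>M P)"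
    by (intro borel_measurable_vec_nth; simp add: case_prod_beta'[symmetric])+
  then have "(\<lambda>(p, w). u w (fst p) $ a * v w (snd p) $ b)
      \<in> borel_measurable ((lebesgue_on D \<Otimes>\<^sub>M lebesgue_on D) \<Otimes>\<^sub>M P)"
    by (simp add: case_prod_beta')
  then have "(\<lambda>p. \<integral>w. u w (fst p) $ a * v w (snd p) $ b \<partial>P) \<in> borel_measurable (lebesgue_on D \<Otimes>\<^sub>M lebesgue_on D)"
    by (rule P.borel_measurable_lebesgue_integral)
  then show "(\<lambda>p. (case p of (x, y) \<Rightarrow> correlation_kernel P u v x y) $ a $ b) \<in> borel_measurable (lebesgue_on D \<Otimes>\<^sub>M lebesgue_on D)"
    by (simp add: correlation_kernel_def case_prod_beta')
qed

text \<open>Each of the nine entries is bounded by the Cauchy-Schwarz inequality in \<open>w\<close>.\<close>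

lemma norm_correlation_kernel_le:
  assumes u: "sq_integrable P (\<lambda>w. u w x)" and v: "sq_integrable P (\<lambda>w. v w y)"
  shows "(norm (correlation_kernel P u v x y))\<^sup>2 \<le> 81 * ((\<integral>w. (norm (u w x))\<^sup>2 \<partial>P) * (\<integral>w. (norm (v w y))\<^sup>2 \<partial>P))"
proof -
  define U where "U = (\<integral>w. (norm (u w x))\<^sup>2 \<partial>P)"
  define V where "V = (\<integral>w. (norm (v w y))\<^sup>2 \<partial>P)"
  have UV: "0 \<le> U" "0 \<le> V" by (simp_all add: U_def V_def)
  have e: "\<bar>correlation_kernel P u v x y $ a $ b\<bar> \<le> sqrt U * sqrt V" for a b
  proof -
    have "\<bar>correlation_kernel P u v x y $ a $ b\<bar> \<le> (\<integral>w. norm (u w x $ a * v w y $ b) \<partial>P)"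
      using integral_norm_bound[of P "\<lambda>w. u w x $ a * v w y $ b"] by (simp add: correlation_kernel_def)
    also have "\<dots> \<le> (\<integral>w. norm (u w x) * norm (v w y) \<partial>P)"
    proof (rule integral_mono)
      show "integrable P (\<lambda>w. norm (u w x $ a * v w y $ b))"
        using sq_integrable_norm_mult[OF sq_integrable_vec_nth[OF u] sq_integrable_vec_nth[OF v]]
        by (simp add: abs_mult)
      show "norm (u w x $ a * v w y $ b) \<le> norm (u w x) * norm (v w y)" for w
        by (simp add: abs_mult mult_mono component_le_norm_cart)
    qed (rule sq_integrable_norm_mult[OF u v])
    also have "\<dots> \<le> sqrt U * sqrt V"
      unfolding U_def V_def by (rule sq_integrable_Cauchy_Schwarz[OF u v])
    finally show ?thesis .
  qed
  have "norm (correlation_kernel P u v x y) \<le> (\<Sum>a\<in>UNIV. norm (correlation_kernel P u v x y $ a))"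
    unfolding norm_vec_def by (rule L2_set_le_sum) simp
  also have "\<dots> \<le> (\<Sum>a\<in>(UNIV::3 set). \<Sum>b\<in>(UNIV::3 set). sqrt U * sqrt V)"
    by (intro sum_mono order_trans[OF norm_le_l1_cart] e)
  also have "\<dots> = 9 * (sqrt U * sqrt V)" by simp
  finally have "(norm (correlation_kernel P u v x y))\<^sup>2 \<le> (9 * (sqrt U * sqrt V))\<^sup>2" by (rule power_mono) simp
  also have "\<dots> = 81 * (U * V)" using UV by (simp add: power_mult_distrib)
  finally show ?thesis by (simp add: U_def V_def)
qed

text \<open>The pointwise bound is a product of a function of \<open>x\<close> and a function of \<open>y\<close>, so its integral over \<open>D \<times> D\<close>
  factors.\<close>

lemma correlation_kernel_L2:
  assumes u: "random_L2 P D c u" and v: "random_L2 P D c' v"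
  shows "sq_integrable2 D (correlation_kernel P u v)" "L2_sq2 D (correlation_kernel P u v) \<le> 81 * (c * c')\<^sup>2"
proof -
  let ?M = "lebesgue_on D \<Otimes>\<^sub>M lebesgue_on D"
  let ?U = "\<lambda>x. \<integral>w. (norm (u w x))\<^sup>2 \<partial>P" and ?V = "\<lambda>y. \<integral>w. (norm (v w y))\<^sup>2 \<partial>P"
  note m = correlation_kernel_measurable[OF u v]
  have UV: "integrable ?M (\<lambda>(x, y). ?U x * ?V y)"
    "(\<integral>p. (case p of (x, y) \<Rightarrow> ?U x * ?V y) \<partial>?M) = (\<integral>x. ?U x \<partial>lebesgue_on D) * (\<integral>y. ?V y \<partial>lebesgue_on D)"
    by (intro prod_mult_integrable DD.sigma_finite_measure_axioms
        random_L2_slices(2)[OF P D u] random_L2_slices(2)[OF P D v])+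
  have b: "AE p in ?M. (norm (case p of (x, y) \<Rightarrow> correlation_kernel P u v x y))\<^sup>2 \<le> 81 * (case p of (x, y) \<Rightarrow> ?U x * ?V y)"
    using AE_prod_fst[OF DD.sigma_finite_measure_axioms random_L2_slices(1)[OF P D u]]
      AE_prod_snd[OF DD.sigma_finite_measure_axioms random_L2_slices(1)[OF P D v]]
    by eventually_elim (simp add: case_prod_beta norm_correlation_kernel_le)
  have int: "integrable ?M (\<lambda>p. (norm (case p of (x, y) \<Rightarrow> correlation_kernel P u v x y))\<^sup>2)"
  proof (rule Bochner_Integration.integrable_bound)
    show "integrable ?M (\<lambda>p. 81 * (case p of (x, y) \<Rightarrow> ?U x * ?V y))" using UV(1) by simp
    show "AE p in ?M. norm ((norm (case p of (x, y) \<Rightarrow> correlation_kernel P u v x y))\<^sup>2)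
        \<le> norm (81 * (case p of (x, y) \<Rightarrow> ?U x * ?V y))"
      using b by eventually_elim simp
  qed (use m in simp)
  with m show "sq_integrable2 D (correlation_kernel P u v)"
    by (simp add: sq_integrable2_def sq_integrable_def)
  have "L2_sq2 D (correlation_kernel P u v) = (\<integral>p. (norm (case p of (x, y) \<Rightarrow> correlation_kernel P u v x y))\<^sup>2 \<partial>?M)"
    by (simp add: L2_sq2_def case_prod_beta')
  also have "\<dots> \<le> (\<integral>p. 81 * (case p of (x, y) \<Rightarrow> ?U x * ?V y) \<partial>?M)"
    by (rule integral_mono_AE[OF int _ b]) (use UV(1) in simp)
  also have "\<dots> = 81 * ((\<integral>x. ?U x \<partial>lebesgue_on D) * (\<integral>y. ?V y \<partial>lebesgue_on D))"
    using UV(2) by simp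
  also have "\<dots> \<le> 81 * (c\<^sup>2 * c'\<^sup>2)"
    by (intro mult_left_mono mult_mono random_L2_slices(4)[OF P D u] random_L2_slices(4)[OF P D v]) auto
  finally show "L2_sq2 D (correlation_kernel P u v) \<le> 81 * (c * c')\<^sup>2" by (simp add: power_mult_distrib)
qed

text \<open>For fixed \<open>y\<close> the columns of a kernel \<open>\<integral> u(x) v(y)\<^sup>T dP\<close> are means of \<open>u\<close> weighted with the
  entries of \<open>v(y)\<close>, so the curl in \<open>x\<close> acts on \<open>u\<close> alone; likewise for the rows.\<close>

lemma correlation_kernel_curl_x:
  assumes u: "random_L2 P D c u" and u': "random_L2 P D c u'" and v: "random_L2 P D c' v"
    and curl: "\<And>w. w \<in> space P \<Longrightarrow> has_weak_curl D (u w) (u' w)"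
  shows "has_curl_x D (correlation_kernel P u v) (correlation_kernel P u' v)"
proof -
  have col: "AE x in lebesgue_on D. (\<integral>w. v w y $ b *\<^sub>R u w x \<partial>P) = column b (correlation_kernel P u v x y)"
    if u: "random_L2 P D c u" and y: "sq_integrable P (\<lambda>w. v w y)" for u y b
    using random_L2_slices(1)[OF P D u]
  proof eventually_elim
    case (elim x)
    have "integrable P (\<lambda>w. v w y $ b *\<^sub>R u w x)"
      by (rule norm_weighted_mean_le(1)[OF P D sq_integrable_vec_nth[OF y] elim])
    from integral_bounded_linear[OF bounded_linear_vec_nth this]
    show ?case by (simp add: vec_eq_iff column_def correlation_kernel_def mult.commute)
  qed
  have "AE y in lebesgue_on D. \<forall>b. has_weak_curl D (\<lambda>x. column b (correlation_kernel P u v x y)) (\<lambda>x. column b (correlation_kernel P u' v x y))"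
    using random_L2_slices(1)[OF P D v] AE_space
  proof eventually_elim
    case (elim y)
    show ?case
    proof
      fix b
      show "has_weak_curl D (\<lambda>x. column b (correlation_kernel P u v x y)) (\<lambda>x. column b (correlation_kernel P u' v x y))"
        by (rule has_weak_curl_cong_AE[OF D
              weighted_mean_weak_curl[OF P D sq_integrable_vec_nth[OF elim(1)] u u' curl]])
          (assumption | rule col u u' elim(1) column_borel_slices(1)[OF correlation_kernel_measurable[OF u v] elim(2)]
            column_borel_slices(1)[OF correlation_kernel_measurable[OF u' v] elim(2)])+
    qed
  qed
  then show ?thesis by (simp add: has_curl_x_def correlation_kernel_L2[OF u v] correlation_kernel_L2[OF u' v])
qed

lemma correlation_kernel_curl_y:
  assumes u: "random_L2 P D c u" and v: "random_L2 P D c' v" and v': "random_L2 P D c' v'"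
    and curl: "\<And>w. w \<in> space P \<Longrightarrow> has_weak_curl D (v w) (v' w)"
  shows "has_curl_y D (correlation_kernel P u v) (correlation_kernel P u v')"
proof -
  have ro: "AE y in lebesgue_on D. (\<integral>w. u w x $ a *\<^sub>R v w y \<partial>P) = row a (correlation_kernel P u v x y)"
    if v: "random_L2 P D c' v" and x: "sq_integrable P (\<lambda>w. u w x)" for v x a
    using random_L2_slices(1)[OF P D v]
  proof eventually_elim
    case (elim y)
    have "integrable P (\<lambda>w. u w x $ a *\<^sub>R v w y)"
      by (rule norm_weighted_mean_le(1)[OF P D sq_integrable_vec_nth[OF x] elim])
    from integral_bounded_linear[OF bounded_linear_vec_nth this]
    show ?case by (simp add: vec_eq_iff row_def correlation_kernel_def)
  qed
  have "AE x in lebesgue_on D. \<forall>a. has_weak_curl D (\<lambda>y. row a (correlation_kernel P u v x y)) (\<lambda>y. row a (correlation_kernel P u v' x y))"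
    using random_L2_slices(1)[OF P D u] AE_space
  proof eventually_elim
    case (elim x)
    show ?case
    proof
      fix a
      show "has_weak_curl D (\<lambda>y. row a (correlation_kernel P u v x y)) (\<lambda>y. row a (correlation_kernel P u v' x y))"
        by (rule has_weak_curl_cong_AE[OF D
              weighted_mean_weak_curl[OF P D sq_integrable_vec_nth[OF elim(1)] v v' curl]])
          (assumption | rule ro v v' elim(1) column_borel_slices(2)[OF correlation_kernel_measurable[OF u v] elim(2)]
            column_borel_slices(2)[OF correlation_kernel_measurable[OF u v'] elim(2)])+
    qed
  qed
  then show ?thesis by (simp add: has_curl_y_def correlation_kernel_L2[OF u v] correlation_kernel_L2[OF u v'])
qed

text \<open>A covariance differs from that of the first-order approximation by a sum of two kernels (and only almost
  everywhere). The curls act on the factors, so the kernel and its three curls are all bounded by products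
  of norms in \<open>H(curl)\<close>.\<close>

proposition correlation_kernel_sum_Hcurl2:
  assumes p: "random_curl P D p p'" "\<And>w. w \<in> space P \<Longrightarrow> Hcurl_norm D (p w) \<le> c1" "0 \<le> c1"
    and q: "random_curl P D q q'" "\<And>w. w \<in> space P \<Longrightarrow> Hcurl_norm D (q w) \<le> c2" "0 \<le> c2"
    and r: "random_curl P D r r'" "\<And>w. w \<in> space P \<Longrightarrow> Hcurl_norm D (r w) \<le> c3" "0 \<le> c3"
    and s: "random_curl P D s s'" "\<And>w. w \<in> space P \<Longrightarrow> Hcurl_norm D (s w) \<le> c4" "0 \<le> c4"
    and K: "AE z in lebesgue_on D \<Otimes>\<^sub>M lebesgue_on D.
        correlation_kernel P p q (fst z) (snd z) + correlation_kernel P r s (fst z) (snd z) = K (fst z) (snd z)"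
      "(\<lambda>(x, y). K x y) \<in> borel_measurable (lebesgue_on D \<Otimes>\<^sub>M lebesgue_on D)"
  shows "K \<in> Hcurl2 D" "Hcurl2_norm D K \<le> 26 * (c1 * c2 + c3 * c4)"
proof -
  have P1: "random_L2 P D c1 p" "random_L2 P D c1 p'"
    by (rule random_curl_L2[OF P D p(1,2)], assumption)+
  have Q1: "random_L2 P D c2 q" "random_L2 P D c2 q'"
    by (rule random_curl_L2[OF P D q(1,2)], assumption)+
  have R1: "random_L2 P D c3 r" "random_L2 P D c3 r'"
    by (rule random_curl_L2[OF P D r(1,2)], assumption)+
  have S1: "random_L2 P D c4 s" "random_L2 P D c4 s'"
    by (rule random_curl_L2[OF P D s(1,2)], assumption)+
  have wc: "\<And>w. w \<in> space P \<Longrightarrow> has_weak_curl D (p w) (p' w)" "\<And>w. w \<in> space P \<Longrightarrow> has_weak_curl D (q w) (q' w)"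
    "\<And>w. w \<in> space P \<Longrightarrow> has_weak_curl D (r w) (r' w)" "\<And>w. w \<in> space P \<Longrightarrow> has_weak_curl D (s w) (s' w)"
    using p q r s by (auto simp: random_curl_def)
  let ?K = "\<lambda>p q r s x y. correlation_kernel P p q x y + correlation_kernel P r s x y"
  have sq: "sq_integrable2 D (?K p q r s)"
    and bd: "L2_sq2 D (?K p q r s) \<le> 2 * (81 * (c1 * c2)\<^sup>2) + 2 * (81 * (c3 * c4)\<^sup>2)"
    if "random_L2 P D c1 p" "random_L2 P D c2 q" "random_L2 P D c3 r" "random_L2 P D c4 s" for p q r s
  proof -
    note k = correlation_kernel_L2[OF that(1,2)] correlation_kernel_L2[OF that(3,4)]
    show "sq_integrable2 D (?K p q r s)" by (rule sq_integrable2_add[OF k(1,3)])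
    show "L2_sq2 D (?K p q r s) \<le> 2 * (81 * (c1 * c2)\<^sup>2) + 2 * (81 * (c3 * c4)\<^sup>2)"
      using L2_sq2_add_le[OF k(1,3)] k(2,4) by linarith
  qed
  have x: "has_curl_x D (?K p q r s) (?K p' q r' s)" if "random_L2 P D c2 q" "random_L2 P D c4 s" for q s
    by (intro has_curl_x_add[OF D] correlation_kernel_curl_x[OF P1 that(1) wc(1)] correlation_kernel_curl_x[OF R1 that(2) wc(3)])
  have y: "has_curl_y D (?K p q r s) (?K p q' r s')"
    by (intro has_curl_y_add[OF D] correlation_kernel_curl_y[OF P1(1) Q1 wc(2)] correlation_kernel_curl_y[OF R1(1) S1 wc(4)])
  have mS: "(\<lambda>(x, y). ?K p' q r' s x y) \<in> borel_measurable (lebesgue_on D \<Otimes>\<^sub>M lebesgue_on D)"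
    using sq[OF P1(2) Q1(1) R1(2) S1(1)] by (simp add: sq_integrable2_def sq_integrable_def)
  have xK: "has_curl_x D K (?K p' q r' s)"
    by (rule has_curl_x_cong_AE[OF D x[OF Q1(1) S1(1)] K _ mS]) simp
  have yK: "has_curl_y D K (?K p q' r s')" by (rule has_curl_y_cong_AE[OF D y K])
  note xyK = x[OF Q1(2) S1(2)]
  show "K \<in> Hcurl2 D" by (rule Hcurl2_norm_eq(1)[OF D xK yK xyK])
  let ?b = "2 * (81 * (c1 * c2)\<^sup>2) + 2 * (81 * (c3 * c4)\<^sup>2)"
  have "L2_sq2 D (?K p q r s) = L2_sq2 D K"
    by (rule L2_sq2_cong_AE[OF D sq[OF P1(1) Q1(1) R1(1) S1(1)] _ K(1)]) (use xK in \<open>simp add: has_curl_x_def\<close>)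
  then have bK: "L2_sq2 D K \<le> ?b" using bd[OF P1(1) Q1(1) R1(1) S1(1)] by simp
  have sum4: "x1 + x2 + x3 + x4 \<le> 4 * b" if "x1 \<le> b" "x2 \<le> b" "x3 \<le> b" "x4 \<le> b" for x1 x2 x3 x4 b :: real
    using that by linarith
  have "L2_sq2 D K + L2_sq2 D (?K p' q r' s) + L2_sq2 D (?K p q' r s') + L2_sq2 D (?K p' q' r' s') \<le> 4 * ?b"
    by (rule sum4[OF bK bd[OF P1(2) Q1(1) R1(2) S1(1)] bd[OF P1(1) Q1(2) R1(1) S1(2)]
      bd[OF P1(2) Q1(2) R1(2) S1(2)]])
  also have "\<dots> \<le> (26 * (c1 * c2 + c3 * c4))\<^sup>2"
  proof -
    \<comment> \<open>Here \<open>4 * 2 * 81 = 648\<close> is less than \<open>26\<^sup>2 = 676\<close>.\<close>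
    have quad: "4 * (2 * (81 * \<alpha>\<^sup>2) + 2 * (81 * \<beta>\<^sup>2)) \<le> (26 * (\<alpha> + \<beta>))\<^sup>2"
      if "0 \<le> \<alpha>" "0 \<le> \<beta>" for \<alpha> \<beta> :: real
    proof -
      have sq: "(26 * (\<alpha> + \<beta>))\<^sup>2 = 676 * \<alpha>\<^sup>2 + 676 * \<beta>\<^sup>2 + 1352 * (\<alpha> * \<beta>)"
        by (simp add: power2_eq_square algebra_simps)
      have "0 \<le> \<alpha> * \<beta>" using that by simp
      moreover have "4 * (2 * (81 * A) + 2 * (81 * B)) \<le> 676 * A + 676 * B + 1352 * C"
        if "0 \<le> A" "0 \<le> B" "0 \<le> C" for A B C :: real
        using that by (simp add: algebra_simps)
      ultimately show ?thesis unfolding sq by simp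
    qed
    show ?thesis by (rule quad) (simp_all add: p(3) q(3) r(3) s(3))
  qed
  finally show "Hcurl2_norm D K \<le> 26 * (c1 * c2 + c3 * c4)"
    unfolding Hcurl2_norm_eq(2)[OF D xK yK xyK] using p(3) q(3) r(3) s(3) by (intro real_le_lsqrt) auto
qed

end

section \<open>Moments of square-integrable matrices\<close>

lemma bounded_bilinear_tensor:
  "bounded_bilinear (tensor :: real^'b^'a \<Rightarrow> real^'d^'c \<Rightarrow> real^'d^'c^'b^'a)"
proof -
  have "bilinear (tensor :: real^'b^'a \<Rightarrow> real^'d^'c \<Rightarrow> real^'d^'c^'b^'a)"
    unfolding bilinear_def linear_iff by (simp add: tensor_def vec_eq_iff algebra_simps)
  then show ?thesis by (simp add: bilinear_conv_bounded_bilinear)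
qed

lemma borel_measurable_tensor:
  fixes X :: "'w \<Rightarrow> real^'b^'a" and Y :: "'w \<Rightarrow> real^'d^'c"
  assumes X: "X \<in> borel_measurable M" and Y: "Y \<in> borel_measurable M"
  shows "(\<lambda>w. tensor (X w) (Y w)) \<in> borel_measurable M"
proof (intro borel_measurable_vecI)
  fix a b c d
  have "(\<lambda>w. X w $ a $ b * Y w $ c $ d) \<in> borel_measurable M"
    by (intro borel_measurable_times borel_measurable_vec_nth X Y)
  then show "(\<lambda>w. tensor (X w) (Y w) $ a $ b $ c $ d) \<in> borel_measurable M" by (simp add: tensor_def)
qed

lemma integrable_tensor:
  fixes X :: "'w \<Rightarrow> real^'b^'a" and Y :: "'w \<Rightarrow> real^'d^'c"
  assumes X: "sq_integrable P X" and Y: "sq_integrable P Y"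
  shows "integrable P (\<lambda>w. tensor (X w) (Y w))"
proof -
  obtain C where C: "C > 0" "\<And>A B. norm (tensor (A :: real^'b^'a) (B :: real^'d^'c)) \<le> norm A * norm B * C"
    using bounded_bilinear.pos_bounded[OF bounded_bilinear_tensor] by blast
  show ?thesis
  proof (rule Bochner_Integration.integrable_bound)
    show "integrable P (\<lambda>w. norm (X w) * norm (Y w) * C)" using sq_integrable_norm_mult[OF X Y] by simp
    show "AE w in P. norm (tensor (X w) (Y w)) \<le> norm (norm (X w) * norm (Y w) * C)"
      using C by (intro AE_I2) simp
  qed (use X Y in \<open>auto simp: sq_integrable_def intro: borel_measurable_tensor\<close>)
qed

lemma sq_integrable_const: "finite_measure \<mu> \<Longrightarrow> sq_integrable \<mu> (\<lambda>_. c)"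
  by (rule bounded_sq_integrable) auto

lemma sq_integrable_diff:
  "sq_integrable \<mu> f \<Longrightarrow> sq_integrable \<mu> g \<Longrightarrow> sq_integrable \<mu> (\<lambda>x. f x - g x)"
  using sq_integrable_add[of \<mu> f "\<lambda>x. (-1) *\<^sub>R g x"] sq_integrable_scaleR[of \<mu> g "-1"] by simp

lemma sq_integrable_sum:
  assumes "finite S" "S \<noteq> {}" "\<And>k. k \<in> S \<Longrightarrow> sq_integrable \<mu> (f k)"
  shows "sq_integrable \<mu> (\<lambda>x. \<Sum>k\<in>S. f k x)"
  using assms by (induction S rule: finite_ne_induct) (auto intro: sq_integrable_add)

lemma bounded_linear_column: "bounded_linear (column i :: real^'m^'n \<Rightarrow> real^'n)"
  unfolding linear_conv_bounded_linear[symmetric] linear_iff by (simp add: column_def vec_eq_iff)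

lemma sq_integrable_columns:
  fixes U :: "'w \<Rightarrow> real^'m^'n"
  assumes "\<And>i. sq_integrable P (\<lambda>w. column i (U w))"
  shows "sq_integrable P U"
proof -
  \<comment> \<open>A matrix is the sum of its columns, each embedded as a matrix with a single nonzero column.\<close>
  define emb where "emb i v = (\<chi> a j. if j = i then v $ a else 0)" for i :: 'm and v :: "real^'n"
  have "bounded_linear (emb i)" for i
    unfolding linear_conv_bounded_linear[symmetric] linear_iff by (auto simp: emb_def vec_eq_iff)
  then have "sq_integrable P (\<lambda>w. emb i (column i (U w)))" for i
    by (rule sq_integrable_bounded_linear[OF _ assms])
  then have "sq_integrable P (\<lambda>w. \<Sum>i\<in>UNIV. emb i (column i (U w)))"
    by (intro sq_integrable_sum) auto
  moreover have "(\<Sum>i\<in>UNIV. emb i (column i A)) = A" for A :: "real^'m^'n"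
    by (simp add: emb_def column_def vec_eq_iff)
  ultimately show ?thesis by simp
qed

lemma Cov_exists_sq_integrable:
  fixes X :: "'w \<Rightarrow> real^'b^'a" and Y :: "'w \<Rightarrow> real^'d^'c"
  assumes P: "prob_space P" and X: "sq_integrable P X" and Y: "sq_integrable P Y"
  shows "Cov_exists P X Y"
proof -
  interpret prob_space P by fact
  note fm = finite_measure_axioms
  show ?thesis
    unfolding Cov_exists_def
    by (intro conjI sq_integrable_imp_integrable[OF fm] X Y integrable_tensor sq_integrable_diff sq_integrable_const[OF fm])
qed

lemma Cov_entry:
  fixes X :: "'w \<Rightarrow> real^'b^'a" and Y :: "'w \<Rightarrow> real^'d^'c"
  assumes P: "prob_space P" and X: "sq_integrable P X" and Y: "sq_integrable P Y"
  shows "Cov P X Y $ a $ b $ c $ d = (\<integral>w. (X w - Mean P X) $ a $ b * (Y w - Mean P Y) $ c $ d \<partial>P)"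
proof -
  interpret prob_space P by fact
  note fm = finite_measure_axioms
  have bl: "bounded_linear (\<lambda>T :: real^'d^'c^'b^'a. T $ a $ b $ c $ d)"
    unfolding linear_conv_bounded_linear[symmetric] linear_iff by simp
  have "integrable P (\<lambda>w. tensor (X w - Mean P X) (Y w - Mean P Y))"
    by (intro integrable_tensor sq_integrable_diff X Y sq_integrable_const[OF fm])
  from integral_bounded_linear[OF bl this] show ?thesis
    by (simp add: Cov_def tensor_def)
qed

text \<open>If \<open>X\<close> and \<open>t A\<close> have centered versions that differ by \<open>\<rho> = O(t\<^sup>2)\<close>, then bilinearity leaves
  \<open>\<rho> \<otimes> (t A + \<rho>) + t A \<otimes> \<rho>\<close> as the difference of the covariances.\<close>

lemma Cov_expansion:
  fixes X A :: "'w \<Rightarrow> real^'b^'a"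
  assumes P: "prob_space P" and X: "X \<in> borel_measurable P" and A: "A \<in> borel_measurable P"
    and K: "\<And>w. w \<in> space P \<Longrightarrow> norm (X w - m - t *\<^sub>R A w) \<le> K * t\<^sup>2"
      "\<And>w. w \<in> space P \<Longrightarrow> norm (A w) \<le> K" "0 \<le> K" and t: "\<bar>t\<bar> \<le> 1"
    and C: "\<And>B B'. norm (tensor (B :: real^'b^'a) (B' :: real^'b^'a)) \<le> norm B * norm B' * C" "0 \<le> C"
  shows "Cov_exists P X X" "Cov_exists P A A" "norm (Cov P X X - t\<^sup>2 *\<^sub>R Cov P A A) \<le> 12 * C * K\<^sup>2 * \<bar>t\<bar> ^ 3"
    "(\<integral>w. A w \<partial>P) = 0 \<Longrightarrow> norm (Mean P X - m) \<le> K * t\<^sup>2"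
proof -
  interpret prob_space P by fact
  define R where "R w = X w - m - t *\<^sub>R A w" for w
  have Rm: "R \<in> borel_measurable P" unfolding R_def using X A by measurable
  have intb: "sq_integrable P Y" "integrable P Y" "norm (\<integral>w. Y w \<partial>P) \<le> b"
    if Y: "Y \<in> borel_measurable P" "\<And>w. w \<in> space P \<Longrightarrow> norm (Y w) \<le> b" for Y :: "'w \<Rightarrow> real^'b^'a" and b
  proof -
    obtain w0 where "w0 \<in> space P" using not_empty by blast
    then have b: "0 \<le> b" using order_trans[OF norm_ge_zero Y(2)] by blast
    show int: "integrable P Y" using Y by (intro integrable_const_bound[where B = b] AE_I2) auto
    have "norm ((norm (Y w))\<^sup>2) \<le> b\<^sup>2" if "w \<in> space P" for w using Y(2)[OF that] by (simp add: power_mono)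
    then show "sq_integrable P Y"
      using Y(1) by (auto simp: sq_integrable_def intro!: integrable_const_bound[where B = "b\<^sup>2"] AE_I2)
    have "norm (\<integral>w. Y w \<partial>P) \<le> (\<integral>w. norm (Y w) \<partial>P)" by (rule integral_norm_bound)
    also have "\<dots> \<le> (\<integral>w. b \<partial>P)" using int Y(2) by (intro integral_mono) auto
    finally show "norm (\<integral>w. Y w \<partial>P) \<le> b" by (simp add: prob_space)
  qed
  have Rb: "norm (R w) \<le> K * t\<^sup>2" if "w \<in> space P" for w using K(1)[OF that] by (simp add: R_def)
  have Ri: "sq_integrable P R" "integrable P R" "norm (\<integral>w. R w \<partial>P) \<le> K * t\<^sup>2"
    by (rule intb[OF Rm Rb], assumption)+
  have Ai: "sq_integrable P A" "integrable P A" "norm (\<integral>w. A w \<partial>P) \<le> K"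
    by (rule intb[OF A K(2)], assumption)+
  have Xeq: "X = (\<lambda>w. (m + t *\<^sub>R A w) + R w)" by (auto simp: R_def)
  have Xs: "sq_integrable P X"
    unfolding Xeq by (intro sq_integrable_add sq_integrable_scaleR Ri Ai sq_integrable_const finite_measure_axioms)
  show "Cov_exists P X X" "Cov_exists P A A"
    by (intro Cov_exists_sq_integrable P Xs Ai)+
  have MX: "Mean P X = m + t *\<^sub>R (\<integral>w. A w \<partial>P) + (\<integral>w. R w \<partial>P)"
  proof -
    have "Mean P X = (\<integral>w. (m + t *\<^sub>R A w) + R w \<partial>P)"
      unfolding Mean_def by (rule Bochner_Integration.integral_cong) (simp_all add: R_def)
    also have "\<dots> = (\<integral>w. m + t *\<^sub>R A w \<partial>P) + (\<integral>w. R w \<partial>P)"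
      using Ri(2) Ai(2) by (intro Bochner_Integration.integral_add) auto
    finally show ?thesis using Ai(2) by (simp add: prob_space)
  qed
  show "norm (Mean P X - m) \<le> K * t\<^sup>2" if "(\<integral>w. A w \<partial>P) = 0"
    using MX that Ri(3) by simp
  define A' where "A' w = A w - Mean P A" for w
  define \<rho> where "\<rho> w = R w - (\<integral>w. R w \<partial>P)" for w
  have XM: "X w - Mean P X = t *\<^sub>R A' w + \<rho> w" for w
  proof -
    have "X w = m + t *\<^sub>R A w + R w" by (simp add: R_def)
    then show ?thesis unfolding MX A'_def \<rho>_def by (simp add: Mean_def scaleR_diff_right)
  qed
  have s: "sq_integrable P A'" "sq_integrable P \<rho>"
    unfolding A'_def \<rho>_def by (intro sq_integrable_diff Ri Ai sq_integrable_const finite_measure_axioms)+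
  have bA: "norm (A' w) \<le> 2 * K" if "w \<in> space P" for w
    using norm_triangle_ineq4[of "A w" "Mean P A"] K(2)[OF that] Ai(3) by (simp add: A'_def Mean_def)
  have b\<rho>: "norm (\<rho> w) \<le> 2 * K * t\<^sup>2" if "w \<in> space P" for w
    using norm_triangle_ineq4[of "R w" "\<integral>w. R w \<partial>P"] K(1)[OF that] Ri(3) by (simp add: \<rho>_def R_def)
  let ?d = "\<lambda>w. tensor (\<rho> w) (t *\<^sub>R A' w + \<rho> w) + t *\<^sub>R tensor (A' w) (\<rho> w)"
  note bb = bounded_bilinear.add_left[OF bounded_bilinear_tensor] bounded_bilinear.add_right[OF bounded_bilinear_tensor]
    bounded_bilinear.scaleR_left[OF bounded_bilinear_tensor] bounded_bilinear.scaleR_right[OF bounded_bilinear_tensor]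
  have "Cov P X X - t\<^sup>2 *\<^sub>R Cov P A A
      = (\<integral>w. tensor (t *\<^sub>R A' w + \<rho> w) (t *\<^sub>R A' w + \<rho> w) - t\<^sup>2 *\<^sub>R tensor (A' w) (A' w) \<partial>P)"
    unfolding Cov_def XM A'_def[symmetric]
    by (subst Bochner_Integration.integral_diff)
      (auto intro!: integrable_tensor s sq_integrable_add sq_integrable_scaleR)
  also have "\<dots> = (\<integral>w. ?d w \<partial>P)"
    by (intro Bochner_Integration.integral_cong refl) (simp add: bb power2_eq_square algebra_simps)
  finally have eq: "Cov P X X - t\<^sup>2 *\<^sub>R Cov P A A = (\<integral>w. ?d w \<partial>P)" .
  have "norm (\<integral>w. ?d w \<partial>P) \<le> (\<integral>w. norm (?d w) \<partial>P)" by (rule integral_norm_bound)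
  also have "\<dots> \<le> (\<integral>w. 12 * C * K\<^sup>2 * \<bar>t\<bar> ^ 3 \<partial>P)"
  proof (rule integral_mono)
    show "integrable P (\<lambda>w. norm (?d w))"
      by (intro integrable_norm Bochner_Integration.integrable_add integrable_scaleR_right integrable_tensor
          s sq_integrable_add sq_integrable_scaleR)
    fix w assume w: "w \<in> space P"
    have t2: "t\<^sup>2 \<le> \<bar>t\<bar>" using t mult_left_mono[OF t, of "\<bar>t\<bar>"] by (simp add: power2_eq_square abs_mult[symmetric])
    have n: "norm (t *\<^sub>R A' w + \<rho> w) \<le> 4 * K * \<bar>t\<bar>"
    proof -
      have "norm (t *\<^sub>R A' w + \<rho> w) \<le> \<bar>t\<bar> * norm (A' w) + norm (\<rho> w)"
        using norm_triangle_ineq[of "t *\<^sub>R A' w" "\<rho> w"] by simp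
      also have "\<dots> \<le> \<bar>t\<bar> * (2 * K) + 2 * K * t\<^sup>2"
        using bA[OF w] b\<rho>[OF w] by (intro add_mono mult_left_mono) auto
      also have "\<dots> \<le> \<bar>t\<bar> * (2 * K) + 2 * K * \<bar>t\<bar>"
        using t2 K(3) by (intro add_left_mono mult_left_mono) auto
      finally show ?thesis by simp
    qed
    have "norm (?d w) \<le> norm (tensor (\<rho> w) (t *\<^sub>R A' w + \<rho> w)) + \<bar>t\<bar> * norm (tensor (A' w) (\<rho> w))"
      using norm_triangle_ineq[of "tensor (\<rho> w) (t *\<^sub>R A' w + \<rho> w)" "t *\<^sub>R tensor (A' w) (\<rho> w)"] by simp
    also have "norm (tensor (\<rho> w) (t *\<^sub>R A' w + \<rho> w)) \<le> (2 * K * t\<^sup>2) * (4 * K * \<bar>t\<bar>) * C"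
      using b\<rho>[OF w] n K(3) C(2) by (intro order_trans[OF C(1)] mult_right_mono mult_mono) auto
    also have "norm (tensor (A' w) (\<rho> w)) \<le> (2 * K) * (2 * K * t\<^sup>2) * C"
      using b\<rho>[OF w] bA[OF w] K(3) C(2) by (intro order_trans[OF C(1)] mult_right_mono mult_mono) auto
    \<comment> \<open>The factor \<open>12\<close> is \<open>8 + 4\<close>.\<close>
    also have "(2 * K * t\<^sup>2) * (4 * K * \<bar>t\<bar>) * C + \<bar>t\<bar> * ((2 * K) * (2 * K * t\<^sup>2) * C) = 12 * C * K\<^sup>2 * \<bar>t\<bar> ^ 3"
      by (simp add: power2_eq_square power3_eq_cube abs_mult[symmetric])
    finally show "norm (?d w) \<le> 12 * C * K\<^sup>2 * \<bar>t\<bar> ^ 3" by (simp add: mult_left_mono)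
  qed simp
  finally show "norm (Cov P X X - t\<^sup>2 *\<^sub>R Cov P A A) \<le> 12 * C * K\<^sup>2 * \<bar>t\<bar> ^ 3"
    unfolding eq by (simp add: prob_space)
qed

section \<open>Mean and covariance of the eigenpairs\<close>

text \<open>Replacing the two factors one at a time, every term of the difference contains \<open>r\<close> or \<open>s\<close>, the small
  parts of the factors.\<close>

lemma integral_product_expansion:
  fixes p q r s :: "'w \<Rightarrow> real"
  assumes "integrable P (\<lambda>w. p w * q w)" "integrable P (\<lambda>w. p w * s w)"
    "integrable P (\<lambda>w. r w * q w)" "integrable P (\<lambda>w. r w * s w)"
  shows "(\<integral>w. (t * p w + r w) * (t * q w + s w) \<partial>P) - t\<^sup>2 * (\<integral>w. p w * q w \<partial>P)
    = (\<integral>w. r w * (t * q w + s w) \<partial>P) + (\<integral>w. (t * p w) * s w \<partial>P)"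
proof -
  have "(\<integral>w. (t * p w + r w) * (t * q w + s w) \<partial>P)
      = (\<integral>w. t\<^sup>2 * (p w * q w) + (t * (p w * s w) + (t * (r w * q w) + r w * s w)) \<partial>P)"
    by (rule Bochner_Integration.integral_cong) (simp_all add: power2_eq_square algebra_simps)
  also have "\<dots> = t\<^sup>2 * (\<integral>w. p w * q w \<partial>P)
      + (t * (\<integral>w. p w * s w \<partial>P) + (t * (\<integral>w. r w * q w \<partial>P) + (\<integral>w. r w * s w \<partial>P)))"
    using assms by simp
  finally have 1: "(\<integral>w. (t * p w + r w) * (t * q w + s w) \<partial>P) = \<dots>" .
  have "(\<integral>w. r w * (t * q w + s w) \<partial>P) = (\<integral>w. t * (r w * q w) + r w * s w \<partial>P)"
    by (rule Bochner_Integration.integral_cong) (simp_all add: algebra_simps)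
  also have "\<dots> = t * (\<integral>w. r w * q w \<partial>P) + (\<integral>w. r w * s w \<partial>P)" using assms by simp
  finally have 2: "(\<integral>w. r w * (t * q w + s w) \<partial>P) = \<dots>" .
  have 3: "(\<integral>w. (t * p w) * s w \<partial>P) = t * (\<integral>w. p w * s w \<partial>P)" by (simp add: mult.assoc)
  show ?thesis unfolding 1 2 3 by simp
qed

text \<open>\<open>\<Psi>\<close> composed with the derivative of the coefficients is linear on the cube. Boundedness of \<open>\<Psi>\<close> in the
  supremum norm turns the uniform convergence along truncations into the continuity that is needed to
  exchange limit and mean.\<close>

lemma mean_zero_coeff_functional:
  fixes \<Psi> :: "(real^3 \<Rightarrow> (real^3^3) \<times> (real^3^3)) \<Rightarrow> 'b::euclidean_space"
  assumes D: "open D" "D \<noteq> {}" and P: "prob_space P"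
    and z: "z \<in> measurable P (Pi\<^sub>M UNIV (\<lambda>_. borel))" "\<And>w. w \<in> space P \<Longrightarrow> z w \<in> cube M"
    and centered: "\<And>i. (\<integral>w. z w i \<partial>P) = 0"
    and lin: "linear_param_field D M V"
    and diff: "\<And>y x. y \<in> cube M \<Longrightarrow> x \<in> D \<Longrightarrow> V y differentiable (at x)"
    and cp: "\<And>y. y \<in> cube M \<Longrightarrow> coeff_deriv D (V y) \<in> coeff_perturbations D"
    and B: "\<And>y. y \<in> cube M \<Longrightarrow> sup_norm D (coeff_deriv D (V y)) \<le> B"
    and \<Psi>lin: "\<And>g g' a b. g \<in> coeff_perturbations D \<Longrightarrow> g' \<in> coeff_perturbations D \<Longrightarrow>
        \<Psi> (\<lambda>x. a *\<^sub>R g x + b *\<^sub>R g' x) = a *\<^sub>R \<Psi> g + b *\<^sub>R \<Psi> g'"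
    and \<Psi>b: "\<And>g. g \<in> coeff_perturbations D \<Longrightarrow> norm (\<Psi> g) \<le> C * sup_norm D g" and C: "0 \<le> C"
    and meas: "(\<lambda>w. \<Psi> (coeff_deriv D (V (z w)))) \<in> borel_measurable P"
  shows "(\<integral>w. \<Psi> (coeff_deriv D (V (z w))) \<partial>P) = 0"
proof (rule mean_zero_if_linear_on_cube[OF P z centered, where \<psi> = "\<lambda>y. \<Psi> (coeff_deriv D (V y))"])
  show "linear_on_cube M (\<lambda>y. \<Psi> (coeff_deriv D (V y)))"
    unfolding linear_on_cube_def
  proof (intro ballI allI impI)
    fix w y a b assume *: "w \<in> cube M" "y \<in> cube M" "(\<lambda>i. a * w i + b * y i) \<in> cube M"
    show "\<Psi> (coeff_deriv D (V (\<lambda>i. a * w i + b * y i)))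
        = a *\<^sub>R \<Psi> (coeff_deriv D (V w)) + b *\<^sub>R \<Psi> (coeff_deriv D (V y))"
    proof -
      have "coeff_deriv D (V (\<lambda>i. a * w i + b * y i))
          = (\<lambda>x. a *\<^sub>R coeff_deriv D (V w) x + b *\<^sub>R coeff_deriv D (V y) x)"
        by (rule coeff_deriv_linear_on_cube[OF D(1) lin _ *]) (rule diff)
      then show ?thesis using \<Psi>lin[OF cp[OF *(1)] cp[OF *(2)], of a b] by simp
    qed
  qed
  show "norm (\<Psi> (coeff_deriv D (V y))) \<le> C * B" if "y \<in> cube M" for y
    using order_trans[OF \<Psi>b[OF cp[OF that]] mult_left_mono[OF B[OF that] C]] .
  show "(\<lambda>N. \<Psi> (coeff_deriv D (V (truncate_param N y)))) \<longlonglongrightarrow> \<Psi> (coeff_deriv D (V y))" if y: "y \<in> cube M" for y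
  proof (rule LIM_zero_cancel, rule Lim_null_comparison)
    let ?d = "\<lambda>N x. coeff_deriv D (V (truncate_param N y)) x - coeff_deriv D (V y) x"
    have "norm (\<Psi> (coeff_deriv D (V (truncate_param N y))) - \<Psi> (coeff_deriv D (V y))) \<le> C * sup_norm D (?d N)" for N
    proof -
      note c = cp[OF truncate_param_cube[OF y, of N]] cp[OF y]
      have d: "?d N \<in> coeff_perturbations D" using coeff_perturbations_lincomb[OF c, of 1 "-1"] by simp
      have "\<Psi> (?d N) = \<Psi> (coeff_deriv D (V (truncate_param N y))) - \<Psi> (coeff_deriv D (V y))"
        using \<Psi>lin[OF c, of 1 "-1"] by simp
      then show ?thesis using \<Psi>b[OF d] by simp
    qed
    then show "\<forall>\<^sub>F N in sequentially.
        norm (\<Psi> (coeff_deriv D (V (truncate_param N y))) - \<Psi> (coeff_deriv D (V y))) \<le> C * sup_norm D (?d N)"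
      by simp
    show "(\<lambda>N. C * sup_norm D (?d N)) \<longlonglongrightarrow> 0"
      using tendsto_mult_left[OF coeff_deriv_truncation[OF D(2) lin y], of C] by simp
  qed
qed (assumption | rule meas)+

text \<open>The mean is a pointwise integral, whereas the linear dependence on the coefficients is available only in
  \<open>H(curl)\<close>. Pairing with a test field reduces the claim to real-valued functionals, and the fundamental
  lemma leads back to the pointwise mean.\<close>

proposition mean_zero_field:
  fixes A :: "'w \<Rightarrow> real^3 \<Rightarrow> real^'m^3"
  assumes D: "open D" "bounded D" "D \<noteq> {}" and P: "prob_space P"
    and z: "z \<in> measurable P (Pi\<^sub>M UNIV (\<lambda>_. borel))" "\<And>w. w \<in> space P \<Longrightarrow> z w \<in> cube M"
    and centered: "\<And>i. (\<integral>w. z w i \<partial>P) = 0"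
    and lin: "linear_param_field D M V"
    and diff: "\<And>y x. y \<in> cube M \<Longrightarrow> x \<in> D \<Longrightarrow> V y differentiable (at x)"
    and cp: "\<And>y. y \<in> cube M \<Longrightarrow> coeff_deriv D (V y) \<in> coeff_perturbations D"
    and B: "\<And>y. y \<in> cube M \<Longrightarrow> sup_norm D (coeff_deriv D (V y)) \<le> B"
    and maps: "bounded_linear_coeff_maps D K F1 L1" and K: "0 \<le> K"
    and A2: "random_L2 P D c (\<lambda>w x. column i (A w x))"
    and A: "\<And>w. w \<in> space P \<Longrightarrow> A w \<in> col_Hcurl D i"
      "\<And>w. w \<in> space P \<Longrightarrow> col_norm D i (\<lambda>x. A w x - F1 (coeff_deriv D (V (z w))) x) = 0"
  shows "AE x in lebesgue_on D. (\<integral>w. column i (A w x) \<partial>P) = 0"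
proof -
  note D' = D(1,2)
  interpret P: prob_space P by (rule P)
  interpret DD: finite_measure "lebesgue_on D" by (rule finite_measure_domain[OF D'])
  note F1 = bounded_linear_coeff_mapsD(1)[OF maps] and F1b = bounded_linear_coeff_mapsD(2)[OF maps]
    and F1lin = bounded_linear_coeff_mapsD(4)[OF maps]
  show ?thesis
  proof (rule AE_eq_0_if_orthogonal_to_test_fields[OF D(1)])
    have one: "sq_integrable P (\<lambda>_. 1::real)" by (simp add: sq_integrable_def)
    show "integrable (lebesgue_on D) (\<lambda>x. \<integral>w. column i (A w x) \<partial>P)"
      using weighted_mean_L2(3)[OF P D' one A2]
      by (intro sq_integrable_imp_integrable[OF DD.finite_measure_axioms]) simp
    fix f :: "real^3 \<Rightarrow> real^3" assume f: "test_field D f"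
    note t = test_field_sq_integrable[OF D' f]
    obtain Bf where Bf: "\<And>x. norm (f x) \<le> Bf" using t(3) by blast
    have fm: "f \<in> borel_measurable (lebesgue_on D)" using t(1) by (simp add: sq_integrable_def)
    define N where "N = sqrt (\<integral>x. (norm (f x))\<^sup>2 \<partial>lebesgue_on D)"
    have N: "0 \<le> N" by (simp add: N_def)
    define \<Psi> where "\<Psi> g = L2_inner D (\<lambda>x. column i (F1 g x)) f" for g
    have sq: "sq_integrable (lebesgue_on D) (\<lambda>x. column i (U x))" if "U \<in> col_Hcurl D i" for U :: "real^3 \<Rightarrow> real^'m^3"
      using that by (auto simp: col_Hcurl_def Hcurl_def has_weak_curl_def)
    have bnd: "\<bar>L2_inner D (\<lambda>x. column i (U x)) f\<bar> \<le> col_norm D i U * N"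
      if "U \<in> col_Hcurl D i" for U :: "real^3 \<Rightarrow> real^'m^3"
      using L2_inner_le_Hcurl_norm[OF D' _ t(1)] that by (simp add: col_Hcurl_def col_norm_def N_def)
    have eq: "L2_inner D (\<lambda>x. column i (A w x)) f = \<Psi> (coeff_deriv D (V (z w)))" if w: "w \<in> space P" for w
    proof -
      have hw: "coeff_deriv D (V (z w)) \<in> coeff_perturbations D" by (rule cp[OF z(2)[OF w]])
      note H = A(1)[OF w] F1[OF hw, of i]
      have "\<bar>L2_inner D (\<lambda>x. column i (A w x - F1 (coeff_deriv D (V (z w))) x)) f\<bar> \<le> 0"
        using bnd[OF col_Hcurl_diff[OF D' H]] A(2)[OF w] by simp
      then have "L2_inner D (\<lambda>x. 1 *\<^sub>R column i (A w x) + (-1) *\<^sub>R column i (F1 (coeff_deriv D (V (z w))) x)) f = 0"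
        by (simp add: column_linear)
      then show ?thesis
        unfolding L2_inner_lincomb[OF sq[OF H(1)] sq[OF H(2)] t(1)] by (simp add: \<Psi>_def)
    qed
    have "L2_inner D (\<lambda>x. \<integral>w. column i (A w x) \<partial>P) f
        = (\<integral>w. L2_inner D (\<lambda>x. column i (A w x)) f \<partial>P)"
      using weighted_mean_inner[OF P D' one A2 fm Bf] by simp
    also have "\<dots> = (\<integral>w. \<Psi> (coeff_deriv D (V (z w))) \<partial>P)"
      by (rule Bochner_Integration.integral_cong) (simp_all add: eq)
    also have "\<dots> = 0"
    proof (rule mean_zero_coeff_functional[OF D(1,3) P z centered lin diff cp B])
      fix g g' :: "real^3 \<Rightarrow> (real^3^3) \<times> (real^3^3)" and a b :: real
      assume g: "g \<in> coeff_perturbations D" "g' \<in> coeff_perturbations D"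
      have "\<Psi> (\<lambda>x. a *\<^sub>R g x + b *\<^sub>R g' x) = L2_inner D (\<lambda>x. a *\<^sub>R column i (F1 g x) + b *\<^sub>R column i (F1 g' x)) f"
        unfolding \<Psi>_def
      proof (rule L2_inner_cong_AE)
        show "AE x in lebesgue_on D. column i (F1 (\<lambda>x. a *\<^sub>R g x + b *\<^sub>R g' x) x)
            = a *\<^sub>R column i (F1 g x) + b *\<^sub>R column i (F1 g' x)"
          using F1lin[OF g, of a b] by eventually_elim (simp add: column_linear)
        show "(\<lambda>x. column i (F1 (\<lambda>x. a *\<^sub>R g x + b *\<^sub>R g' x) x)) \<in> borel_measurable (lebesgue_on D)"
          "(\<lambda>x. a *\<^sub>R column i (F1 g x) + b *\<^sub>R column i (F1 g' x)) \<in> borel_measurable (lebesgue_on D)"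
          using sq[OF F1[OF coeff_perturbations_lincomb[OF g, of a b], of i]] sq[OF F1[OF g(1)]] sq[OF F1[OF g(2)]]
          by (auto simp: sq_integrable_def)
      qed (rule fm)
      then show "\<Psi> (\<lambda>x. a *\<^sub>R g x + b *\<^sub>R g' x) = a *\<^sub>R \<Psi> g + b *\<^sub>R \<Psi> g'"
        unfolding L2_inner_lincomb[OF sq[OF F1[OF g(1)]] sq[OF F1[OF g(2)]] t(1)] by (simp add: \<Psi>_def)
    next
      fix g assume g: "g \<in> coeff_perturbations D"
      show "norm (\<Psi> g) \<le> (K * N) * sup_norm D g"
        using order_trans[OF bnd[OF F1[OF g, of i]] mult_right_mono[OF F1b[OF g, of i] N]]
        by (simp add: \<Psi>_def mult.commute mult.left_commute)
    next
      show "0 \<le> K * N" using K N by simp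
      have "(\<lambda>w. L2_inner D (\<lambda>x. column i (A w x)) f) \<in> borel_measurable P"
      proof -
        have [measurable]: "(\<lambda>p. column i (A (fst p) (snd p))) \<in> borel_measurable (P \<Otimes>\<^sub>M lebesgue_on D)"
          using A2 by (simp add: random_L2_def case_prod_beta')
        note fm [measurable]
        show ?thesis unfolding L2_inner_def by measurable
      qed
      then show "(\<lambda>w. \<Psi> (coeff_deriv D (V (z w)))) \<in> borel_measurable P"
        by (subst measurable_cong[OF eq[symmetric]])
    qed assumption
    finally show "L2_inner D (\<lambda>x. \<integral>w. column i (A w x) \<partial>P) f = 0" .
  qed
qed

lemma random_curl_lincomb:
  assumes D: "open D" "bounded D" and "random_curl P D u v" "random_curl P D u' v'"
  shows "random_curl P D (\<lambda>w x. a *\<^sub>R u w x + b *\<^sub>R u' w x) (\<lambda>w x. a *\<^sub>R v w x + b *\<^sub>R v' w x)"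
proof -
  have [measurable]: "(\<lambda>p. u (fst p) (snd p)) \<in> borel_measurable (P \<Otimes>\<^sub>M lebesgue_on D)"
    "(\<lambda>p. v (fst p) (snd p)) \<in> borel_measurable (P \<Otimes>\<^sub>M lebesgue_on D)"
    "(\<lambda>p. u' (fst p) (snd p)) \<in> borel_measurable (P \<Otimes>\<^sub>M lebesgue_on D)"
    "(\<lambda>p. v' (fst p) (snd p)) \<in> borel_measurable (P \<Otimes>\<^sub>M lebesgue_on D)"
    using assms by (simp_all add: random_curl_def case_prod_beta')
  show ?thesis
    using assms(3,4) unfolding random_curl_def case_prod_beta'
    by (auto intro: has_weak_curl_lincomb[OF D])
qed

lemma random_curl_const:
  assumes "has_weak_curl D u v"
  shows "random_curl P D (\<lambda>_. u) (\<lambda>_. v)"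
proof -
  have [measurable]: "u \<in> borel_measurable (lebesgue_on D)" "v \<in> borel_measurable (lebesgue_on D)"
    using assms by (auto simp: has_weak_curl_def sq_integrable_def)
  show ?thesis using assms by (simp add: random_curl_def)
qed

lemma random_Hcurl_field_column:
  fixes U :: "'w \<Rightarrow> real^3 \<Rightarrow> real^'m^3"
  assumes "random_Hcurl_field P D U"
  obtains v where "random_curl P D (\<lambda>w x. column i (U w x)) v"
proof -
  obtain V :: "'w \<Rightarrow> real^3 \<Rightarrow> real^'m^3" where V: "(\<lambda>(w, x). V w x) \<in> borel_measurable (P \<Otimes>\<^sub>M lebesgue_on D)"
    "\<forall>w\<in>space P. \<forall>i. has_weak_curl D (\<lambda>x. column i (U w x)) (\<lambda>x. column i (V w x))"
    using assms unfolding random_Hcurl_field_def by blast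
  have U: "(\<lambda>(w, x). U w x) \<in> borel_measurable (P \<Otimes>\<^sub>M lebesgue_on D)"
    using assms by (simp add: random_Hcurl_field_def)
  have "random_curl P D (\<lambda>w x. column i (U w x)) (\<lambda>w x. column i (V w x))"
    using borel_measurable_column[OF U, of i] borel_measurable_column[OF V(1), of i] V(2)
    by (simp add: random_curl_def case_prod_beta')
  then show thesis by (rule that)
qed

text \<open>Covariances involve the derivative of the field and the remainder after subtracting their means. Since
  taking means does not increase the norm, this at most doubles the bounds.\<close>

lemma random_curl_centered:
  assumes P: "prob_space P" and D: "open D" "bounded D"
    and u: "random_curl P D u v" "\<And>w. w \<in> space P \<Longrightarrow> Hcurl_norm D (u w) \<le> c" "0 \<le> c"
  shows "\<exists>v. random_curl P D (\<lambda>w x. u w x - (\<integral>w. u w x \<partial>P)) v"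
    "w \<in> space P \<Longrightarrow> Hcurl_norm D (\<lambda>x. u w x - (\<integral>w. u w x \<partial>P)) \<le> 2 * c"
proof -
  note m = mean_Hcurl[OF P D u]
  show "\<exists>v. random_curl P D (\<lambda>w x. u w x - (\<integral>w. u w x \<partial>P)) v"
    using random_curl_lincomb[OF D u(1) random_curl_const[OF m(1)], of 1 "-1"] by auto
  assume w: "w \<in> space P"
  have uH: "u w \<in> Hcurl D" using u(1) w by (auto simp: random_curl_def intro: HcurlI)
  note mH = HcurlI[OF m(1)]
  have "Hcurl_norm D (\<lambda>x. u w x + (-1) *\<^sub>R (\<integral>w. u w x \<partial>P))
      \<le> Hcurl_norm D (u w) + Hcurl_norm D (\<lambda>x. (-1) *\<^sub>R (\<integral>w. u w x \<partial>P))"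
    by (intro Hcurl_norm_add[OF D] Hcurl_scale[OF D] uH mH)
  also have "\<dots> = Hcurl_norm D (u w) + Hcurl_norm D (\<lambda>x. \<integral>w. u w x \<partial>P)"
    using Hcurl_norm_scale[OF D mH, of "-1"] by simp
  also have "\<dots> \<le> 2 * c" using u(2)[OF w] m(2) by simp
  finally show "Hcurl_norm D (\<lambda>x. u w x - (\<integral>w. u w x \<partial>P)) \<le> 2 * c" by simp
qed

context
  fixes P :: "'w measure" and D :: "(real^3) set"
  assumes P: "prob_space P" and D: "open D" "bounded D"
begin

interpretation P: prob_space P by (rule P)
interpretation DD: finite_measure "lebesgue_on D" by (rule finite_measure_domain[OF D])
interpretation PD: pair_sigma_finite P "lebesgue_on D" ..

lemma random_field_slices:
  fixes U :: "'w \<Rightarrow> real^3 \<Rightarrow> real^'m^3"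
  assumes "\<And>i. random_L2 P D c (\<lambda>w x. column i (U w x))"
  shows "AE x in lebesgue_on D. sq_integrable P (\<lambda>w. U w x)"
proof -
  have "AE x in lebesgue_on D. \<forall>i. sq_integrable P (\<lambda>w. column i (U w x))"
    using random_L2_slices(1)[OF P D assms] by (simp add: AE_all_countable)
  then show ?thesis by eventually_elim (auto intro: sq_integrable_columns)
qed

lemma field_Cov_exists_random_field:
  fixes U :: "'w \<Rightarrow> real^3 \<Rightarrow> real^'m^3"
  assumes "\<And>i. random_L2 P D c (\<lambda>w x. column i (U w x))"
  shows "field_Cov_exists P D U"
  unfolding field_Cov_exists_def
  using AE_prod_fst[OF DD.sigma_finite_measure_axioms random_field_slices[OF assms]]
    AE_prod_snd[OF DD.sigma_finite_measure_axioms random_field_slices[OF assms]]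
  by eventually_elim (simp add: case_prod_beta Cov_exists_sq_integrable[OF P])

lemma column_Mean:
  assumes "sq_integrable P U" shows "column i (Mean P U) = (\<integral>w. column i (U w) \<partial>P)"
  unfolding Mean_def
  by (rule integral_bounded_linear[OF bounded_linear_column
        sq_integrable_imp_integrable[OF P.finite_measure_axioms assms], symmetric])

lemma field_Cov_measurable:
  fixes U :: "'w \<Rightarrow> real^3 \<Rightarrow> real^'m^3"
  assumes U: "(\<lambda>(w, x). U w x) \<in> borel_measurable (P \<Otimes>\<^sub>M lebesgue_on D)"
  shows "(\<lambda>(x, y). field_Cov P U x y) \<in> borel_measurable (lebesgue_on D \<Otimes>\<^sub>M lebesgue_on D)"
proof -
  have [measurable]: "(\<lambda>p. U (snd p) (fst p)) \<in> borel_measurable (lebesgue_on D \<Otimes>\<^sub>M P)"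
    using measurable_pair_swap[OF U] by (simp add: case_prod_beta')
  have [measurable]: "(\<lambda>x. Mean P (\<lambda>w. U w x)) \<in> borel_measurable (lebesgue_on D)"
    unfolding Mean_def by (rule P.borel_measurable_lebesgue_integral) (simp add: case_prod_beta')
  have [measurable]: "(\<lambda>p. U (fst p) (snd p)) \<in> borel_measurable (P \<Otimes>\<^sub>M lebesgue_on D)"
    using U by (simp add: case_prod_beta')
  have "(\<lambda>(w, x). U w x - Mean P (\<lambda>w. U w x)) \<in> borel_measurable (P \<Otimes>\<^sub>M lebesgue_on D)"
    unfolding case_prod_beta' by measurable
  note m = triple_measurable[OF P D this]
  have "(\<lambda>(p, w). tensor (U w (fst p) - Mean P (\<lambda>w. U w (fst p))) (U w (snd p) - Mean P (\<lambda>w. U w (snd p))))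
      \<in> borel_measurable ((lebesgue_on D \<Otimes>\<^sub>M lebesgue_on D) \<Otimes>\<^sub>M P)"
    using borel_measurable_tensor[OF m] by (simp add: case_prod_beta')
  from P.borel_measurable_lebesgue_integral[OF this] show ?thesis
    by (simp add: field_Cov_def Cov_def case_prod_beta')
qed

lemma block_measurable:
  assumes "(\<lambda>(x, y). T x y) \<in> borel_measurable (lebesgue_on D \<Otimes>\<^sub>M lebesgue_on D)"
  shows "(\<lambda>(x, y). block i j (T x y)) \<in> borel_measurable (lebesgue_on D \<Otimes>\<^sub>M lebesgue_on D)"
proof (intro borel_measurable_vecI)
  fix a b
  have "(\<lambda>p. (case p of (x, y) \<Rightarrow> T x y) $ a $ i $ b $ j) \<in> borel_measurable (lebesgue_on D \<Otimes>\<^sub>M lebesgue_on D)"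
    by (intro borel_measurable_vec_nth assms)
  then show "(\<lambda>p. (case p of (x, y) \<Rightarrow> block i j (T x y)) $ a $ b) \<in> borel_measurable (lebesgue_on D \<Otimes>\<^sub>M lebesgue_on D)"
    by (simp add: block_def case_prod_beta')
qed

text \<open>\<open>U = E0 + t A + R\<close> with \<open>R = O(t\<^sup>2)\<close> in \<open>H(curl)\<close>. If \<open>A\<close> has mean zero, then the mean of \<open>U\<close> differs from \<open>E0\<close>
  by the mean of \<open>R\<close>. In the covariance \<open>E0\<close> drops out; with the centered fields \<open>\<beta>\<close> and \<open>\<rho>\<close> of \<open>A\<close> and \<open>R\<close>, the
  difference to \<open>t\<^sup>2 Cov A\<close> is the mean of \<open>\<rho>(x) \<otimes> (t \<beta> + \<rho>)(y) + t \<beta>(x) \<otimes> \<rho>(y)\<close>, which is \<open>O(t\<^sup>3)\<close>.\<close>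

proposition field_Cov_expansion:
  fixes U A :: "'w \<Rightarrow> real^3 \<Rightarrow> real^'m^3" and E0 :: "real^3 \<Rightarrow> real^'m^3"
  assumes U: "random_Hcurl_field P D U" and A: "random_Hcurl_field P D A"
    and E0: "\<And>i. E0 \<in> col_Hcurl D i"
    and R: "\<And>w i. w \<in> space P \<Longrightarrow> col_norm D i (\<lambda>x. U w x - E0 x - t *\<^sub>R A w x) \<le> K * t\<^sup>2"
    and Ab: "\<And>w i. w \<in> space P \<Longrightarrow> col_norm D i (A w) \<le> K"
    and K: "0 \<le> K" and t: "\<bar>t\<bar> \<le> 1"
  defines "\<Delta> \<equiv> \<lambda>i j x y. block i j (field_Cov P U x y - t\<^sup>2 *\<^sub>R field_Cov P A x y)"
  shows "field_Cov_exists P D U" "field_Cov_exists P D A"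
    "\<Delta> i j \<in> Hcurl2 D" "Hcurl2_norm D (\<Delta> i j) \<le> 312 * K\<^sup>2 * \<bar>t\<bar> ^ 3"
    "(\<And>i. AE x in lebesgue_on D. (\<integral>w. column i (A w x) \<partial>P) = 0) \<Longrightarrow>
      (\<lambda>x. column i (Mean P (\<lambda>w. U w x) - E0 x)) \<in> Hcurl D \<and>
      Hcurl_norm D (\<lambda>x. column i (Mean P (\<lambda>w. U w x) - E0 x)) \<le> K * t\<^sup>2"
proof -
  define u where "u i w x = column i (U w x)" for i w x
  define \<alpha> where "\<alpha> i w x = column i (A w x)" for i w x
  define e where "e i x = column i (E0 x)" for i x
  \<comment> \<open>The factors \<open>1\<close> and \<open>-1\<close> give \<open>R\<close> the form of the linear combinations for which curls are available.\<close>
  define R where "R i w x = 1 *\<^sub>R (1 *\<^sub>R u i w x + (-1) *\<^sub>R e i x) + (-t) *\<^sub>R \<alpha> i w x" for i w x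
  have Req: "R i w x = column i (U w x - E0 x - t *\<^sub>R A w x)" for i w x
    by (simp add: R_def u_def e_def \<alpha>_def column_linear)
  have "\<exists>v. random_curl P D (u i) v" for i
    unfolding u_def[abs_def] by (rule random_Hcurl_field_column[OF U]) (rule exI)
  then obtain u' where u: "\<And>i. random_curl P D (u i) (u' i)" by metis
  have "\<exists>v. random_curl P D (\<alpha> i) v" for i
    unfolding \<alpha>_def[abs_def] by (rule random_Hcurl_field_column[OF A]) (rule exI)
  then obtain \<alpha>' where \<alpha>: "\<And>i. random_curl P D (\<alpha> i) (\<alpha>' i)" by metis
  have e: "has_weak_curl D (e i) (wcurl D (e i))" for i
    using E0[of i] by (intro wcurl_works) (simp add: col_Hcurl_def e_def[abs_def])
  have "\<exists>v. random_curl P D (R i) v" for i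
    unfolding R_def[abs_def]
    by (intro exI) (rule random_curl_lincomb[OF D random_curl_lincomb[OF D u random_curl_const[OF e]] \<alpha>])
  then obtain R' where Rc: "\<And>i. random_curl P D (R i) (R' i)" by metis
  have Rb: "Hcurl_norm D (R i w) \<le> K * t\<^sup>2" if "w \<in> space P" for i w
    using assms(4)[OF that, of i] by (simp add: Req[abs_def] col_norm_def)
  have \<alpha>b: "Hcurl_norm D (\<alpha> i w) \<le> K" if "w \<in> space P" for i w
    using Ab[OF that, of i] by (simp add: \<alpha>_def[abs_def] col_norm_def)
  have Kt: "0 \<le> K * t\<^sup>2" using K by simp
  have t2: "t\<^sup>2 \<le> \<bar>t\<bar>" using mult_left_mono[OF t, of "\<bar>t\<bar>"] by (simp add: power2_eq_square abs_mult[symmetric])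
  have R2: "random_L2 P D (K * t\<^sup>2) (R i)" for i by (rule random_curl_L2(1)[OF P D Rc Rb])
  have \<alpha>2: "random_L2 P D K (\<alpha> i)" for i by (rule random_curl_L2(1)[OF P D \<alpha> \<alpha>b])
  \<comment> \<open>The norms of the columns of \<open>E0\<close> are finite, hence bounded by their sum.\<close>
  define c0 where "c0 = (\<Sum>i\<in>UNIV. Hcurl_norm D (e i))"
  have ub: "Hcurl_norm D (u i w) \<le> c0 + 2 * K" if w: "w \<in> space P" for i w
  proof -
    have H: "R i w \<in> Hcurl D" "\<alpha> i w \<in> Hcurl D" "e i \<in> Hcurl D"
      using Rc[of i] \<alpha>[of i] e[of i] w by (auto simp: random_curl_def intro: HcurlI)
    have "u i w = (\<lambda>x. (e i x + t *\<^sub>R \<alpha> i w x) + R i w x)" by (auto simp: R_def)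
    then have "Hcurl_norm D (u i w) \<le> Hcurl_norm D (\<lambda>x. e i x + t *\<^sub>R \<alpha> i w x) + Hcurl_norm D (R i w)"
      using Hcurl_norm_add[OF D Hcurl_add[OF D H(3) Hcurl_scale[OF D H(2)]] H(1), of t] by simp
    also have "Hcurl_norm D (\<lambda>x. e i x + t *\<^sub>R \<alpha> i w x) \<le> Hcurl_norm D (e i) + \<bar>t\<bar> * Hcurl_norm D (\<alpha> i w)"
      using Hcurl_norm_add[OF D H(3) Hcurl_scale[OF D H(2)], of t] by (simp add: Hcurl_norm_scale[OF D H(2)])
    also have "\<bar>t\<bar> * Hcurl_norm D (\<alpha> i w) \<le> 1 * K" using t \<alpha>b[OF w] K by (intro mult_mono Hcurl_norm_nonneg) auto
    also have "Hcurl_norm D (R i w) \<le> K"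
      using mult_left_mono[OF order_trans[OF t2 t] K] by (intro order_trans[OF Rb[OF w]]) simp
    also have "Hcurl_norm D (e i) \<le> c0" unfolding c0_def
      by (rule member_le_sum) (auto simp: Hcurl_norm_nonneg)
    finally show ?thesis by simp
  qed
  have u2: "random_L2 P D (c0 + 2 * K) (u i)" for i by (rule random_curl_L2(1)[OF P D u ub])
  show "field_Cov_exists P D U" by (rule field_Cov_exists_random_field[OF u2[unfolded u_def[abs_def]]])
  show "field_Cov_exists P D A" by (rule field_Cov_exists_random_field[OF \<alpha>2[unfolded \<alpha>_def[abs_def]]])
  note Us = random_field_slices[OF u2[unfolded u_def[abs_def]]] and As = random_field_slices[OF \<alpha>2[unfolded \<alpha>_def[abs_def]]]
  have slice: "(\<integral>w. u i w x \<partial>P) = e i x + t *\<^sub>R (\<integral>w. \<alpha> i w x \<partial>P) + (\<integral>w. R i w x \<partial>P)"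
    "sq_integrable P (\<lambda>w. \<alpha> i w x)" "sq_integrable P (\<lambda>w. R i w x)"
    if "sq_integrable P (\<lambda>w. U w x)" "sq_integrable P (\<lambda>w. A w x)" for x i
  proof -
    show a: "sq_integrable P (\<lambda>w. \<alpha> i w x)" unfolding \<alpha>_def
      by (rule sq_integrable_bounded_linear[OF bounded_linear_column that(2)])
    have us: "sq_integrable P (\<lambda>w. u i w x)" unfolding u_def
      by (rule sq_integrable_bounded_linear[OF bounded_linear_column that(1)])
    show r: "sq_integrable P (\<lambda>w. R i w x)" unfolding R_def
      by (intro sq_integrable_add sq_integrable_scaleR a us sq_integrable_const P.finite_measure_axioms)
    have "(\<integral>w. u i w x \<partial>P) = (\<integral>w. (e i x + t *\<^sub>R \<alpha> i w x) + R i w x \<partial>P)" by (simp add: R_def)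
    also have "\<dots> = e i x + t *\<^sub>R (\<integral>w. \<alpha> i w x \<partial>P) + (\<integral>w. R i w x \<partial>P)"
      using a[THEN sq_integrable_imp_integrable[OF P.finite_measure_axioms]]
        r[THEN sq_integrable_imp_integrable[OF P.finite_measure_axioms]] by (simp add: P.prob_space)
    finally show "(\<integral>w. u i w x \<partial>P) = e i x + t *\<^sub>R (\<integral>w. \<alpha> i w x \<partial>P) + (\<integral>w. R i w x \<partial>P)" .
  qed

  show "(\<lambda>x. column i (Mean P (\<lambda>w. U w x) - E0 x)) \<in> Hcurl D \<and>
      Hcurl_norm D (\<lambda>x. column i (Mean P (\<lambda>w. U w x) - E0 x)) \<le> K * t\<^sup>2"
    if zero: "\<And>i. AE x in lebesgue_on D. (\<integral>w. column i (A w x) \<partial>P) = 0"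
  proof -
    note m = mean_Hcurl[OF P D Rc[of i] Rb Kt]
    have eq: "AE x in lebesgue_on D. (\<integral>w. R i w x \<partial>P) = column i (Mean P (\<lambda>w. U w x) - E0 x)"
      using zero[of i] Us As
    proof eventually_elim
      case (elim x)
      show ?case
        using slice(1)[OF elim(2,3), of i] column_Mean[OF elim(2), of i] elim(1)
        by (simp add: column_linear u_def \<alpha>_def e_def)
    qed
    have [measurable]: "(\<lambda>x. Mean P (\<lambda>w. U w x)) \<in> borel_measurable (lebesgue_on D)"
    proof -
      have "(\<lambda>(w, x). U w x) \<in> borel_measurable (P \<Otimes>\<^sub>M lebesgue_on D)"
        using U by (simp add: random_Hcurl_field_def)
      from measurable_pair_swap[OF this]
      show ?thesis unfolding Mean_def
        by (intro P.borel_measurable_lebesgue_integral) (simp add: case_prod_beta')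
    qed
    have "(\<lambda>x. column i (Mean P (\<lambda>w. U w x)) - e i x) \<in> borel_measurable (lebesgue_on D)"
      using e[of i] by (intro borel_measurable_diff borel_measurable_column) (auto simp: has_weak_curl_def sq_integrable_def)
    then have meas: "(\<lambda>x. column i (Mean P (\<lambda>w. U w x) - E0 x)) \<in> borel_measurable (lebesgue_on D)"
      by (simp add: column_linear e_def)
    have H: "(\<lambda>x. column i (Mean P (\<lambda>w. U w x) - E0 x)) \<in> Hcurl D"
      by (rule Hcurl_cong_AE[OF D HcurlI[OF m(1)] eq meas])
    moreover have "Hcurl_norm D (\<lambda>x. column i (Mean P (\<lambda>w. U w x) - E0 x)) \<le> K * t\<^sup>2"
      using Hcurl_norm_cong_AE[OF D HcurlI[OF m(1)] H eq] m(2) by simp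
    ultimately show ?thesis ..
  qed

  define \<rho> where "\<rho> i w x = R i w x - (\<integral>w. R i w x \<partial>P)" for i w x
  define \<beta> where "\<beta> i w x = \<alpha> i w x - (\<integral>w. \<alpha> i w x \<partial>P)" for i w x
  \<comment> \<open>\<open>\<sigma>\<close> is the centered field \<open>u\<close>, and \<open>\<tau> = t \<beta>\<close>; the vanishing summand of \<open>\<tau>\<close> makes it a linear combination
    of two random fields.\<close>
  define \<sigma> where "\<sigma> i w x = t *\<^sub>R \<beta> i w x + 1 *\<^sub>R \<rho> i w x" for i w x
  define \<tau> where "\<tau> i w x = t *\<^sub>R \<beta> i w x + 0 *\<^sub>R \<beta> i w x" for i w x
  have "\<exists>v. random_curl P D (\<rho> i) v" for i
    unfolding \<rho>_def[abs_def] by (rule random_curl_centered(1)[OF P D Rc Rb Kt])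
  then obtain \<rho>' where \<rho>: "\<And>i. random_curl P D (\<rho> i) (\<rho>' i)" by metis
  have \<rho>b: "Hcurl_norm D (\<rho> i w) \<le> 2 * (K * t\<^sup>2)" if "w \<in> space P" for i w
    unfolding \<rho>_def[abs_def] by (rule random_curl_centered(2)[OF P D Rc Rb Kt that])
  have "\<exists>v. random_curl P D (\<beta> i) v" for i
    unfolding \<beta>_def[abs_def] by (rule random_curl_centered(1)[OF P D \<alpha> \<alpha>b K])
  then obtain \<beta>' where \<beta>: "\<And>i. random_curl P D (\<beta> i) (\<beta>' i)" by metis
  have \<beta>b: "Hcurl_norm D (\<beta> i w) \<le> 2 * K" if "w \<in> space P" for i w
    unfolding \<beta>_def[abs_def] by (rule random_curl_centered(2)[OF P D \<alpha> \<alpha>b K that])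
  have \<sigma>: "random_curl P D (\<sigma> i) (\<lambda>w x. t *\<^sub>R \<beta>' i w x + 1 *\<^sub>R \<rho>' i w x)" for i
    unfolding \<sigma>_def[abs_def] by (rule random_curl_lincomb[OF D \<beta> \<rho>])
  have \<tau>: "random_curl P D (\<tau> i) (\<lambda>w x. t *\<^sub>R \<beta>' i w x + 0 *\<^sub>R \<beta>' i w x)" for i
    unfolding \<tau>_def[abs_def] by (rule random_curl_lincomb[OF D \<beta> \<beta>])
  have \<tau>b: "Hcurl_norm D (\<tau> i w) \<le> 2 * K * \<bar>t\<bar>" if w: "w \<in> space P" for i w
  proof -
    have "\<beta> i w \<in> Hcurl D" using \<beta>[of i] w by (auto simp: random_curl_def intro: HcurlI)
    from Hcurl_norm_scale[OF D this, of t] have "Hcurl_norm D (\<tau> i w) = \<bar>t\<bar> * Hcurl_norm D (\<beta> i w)"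
      by (simp add: \<tau>_def[abs_def])
    also have "\<dots> \<le> \<bar>t\<bar> * (2 * K)" by (intro mult_left_mono \<beta>b w) simp
    finally show ?thesis by (simp add: mult.commute)
  qed
  have \<sigma>b: "Hcurl_norm D (\<sigma> i w) \<le> 4 * K * \<bar>t\<bar>" if w: "w \<in> space P" for i w
  proof -
    have "\<tau> i w \<in> Hcurl D" "\<rho> i w \<in> Hcurl D"
      using \<tau>[of i] \<rho>[of i] w by (auto simp: random_curl_def intro: HcurlI)
    from Hcurl_norm_add[OF D this]
    have "Hcurl_norm D (\<sigma> i w) \<le> Hcurl_norm D (\<tau> i w) + Hcurl_norm D (\<rho> i w)"
      by (simp add: \<sigma>_def[abs_def] \<tau>_def)
    also have "\<dots> \<le> 2 * K * \<bar>t\<bar> + 2 * (K * t\<^sup>2)" by (intro add_mono \<tau>b \<rho>b w)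
    also have "2 * (K * t\<^sup>2) \<le> 2 * K * \<bar>t\<bar>" using mult_left_mono[OF t2 K] by simp
    finally show ?thesis by simp
  qed
  have meas: "(\<lambda>(x, y). \<Delta> i j x y) \<in> borel_measurable (lebesgue_on D \<Otimes>\<^sub>M lebesgue_on D)"
  proof -
    have [measurable]: "(\<lambda>p. field_Cov P U (fst p) (snd p)) \<in> borel_measurable (lebesgue_on D \<Otimes>\<^sub>M lebesgue_on D)"
      "(\<lambda>p. field_Cov P A (fst p) (snd p)) \<in> borel_measurable (lebesgue_on D \<Otimes>\<^sub>M lebesgue_on D)"
      using field_Cov_measurable[of U] field_Cov_measurable[of A] assms(1,2)
      by (simp_all add: random_Hcurl_field_def case_prod_beta')
    show ?thesis unfolding \<Delta>_def
      by (rule block_measurable) (unfold case_prod_beta', measurable)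
  qed
  have eq: "AE p in lebesgue_on D \<Otimes>\<^sub>M lebesgue_on D.
      correlation_kernel P (\<rho> i) (\<sigma> j) (fst p) (snd p) + correlation_kernel P (\<tau> i) (\<rho> j) (fst p) (snd p) = \<Delta> i j (fst p) (snd p)"
    using AE_prod_fst[OF DD.sigma_finite_measure_axioms Us] AE_prod_fst[OF DD.sigma_finite_measure_axioms As]
      AE_prod_snd[OF DD.sigma_finite_measure_axioms Us] AE_prod_snd[OF DD.sigma_finite_measure_axioms As]
  proof eventually_elim
    case (elim p)
    define x where "x = fst p"
    define y where "y = snd p"
    note Ux = elim(1)[folded x_def] and Ax = elim(2)[folded x_def] and Uy = elim(3)[folded y_def] and Ay = elim(4)[folded y_def]
    have cen: "sq_integrable P (\<lambda>w. \<beta> i w x)" "sq_integrable P (\<lambda>w. \<rho> i w x)"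
      "(U w x - Mean P (\<lambda>w. U w x)) $ a $ i = t * \<beta> i w x $ a + \<rho> i w x $ a"
      "(A w x - Mean P (\<lambda>w. A w x)) $ a $ i = \<beta> i w x $ a"
      if x: "sq_integrable P (\<lambda>w. U w x)" "sq_integrable P (\<lambda>w. A w x)" for x i a w
    proof -
      show "sq_integrable P (\<lambda>w. \<beta> i w x)" "sq_integrable P (\<lambda>w. \<rho> i w x)"
        unfolding \<beta>_def \<rho>_def
        by (intro sq_integrable_diff slice[OF x] sq_integrable_const P.finite_measure_axioms)+
      have "column i (U w x - Mean P (\<lambda>w. U w x)) = t *\<^sub>R \<beta> i w x + \<rho> i w x"
        using column_Mean[OF x(1), of i] slice(1)[OF x, of i]
        by (simp add: column_linear u_def[symmetric] \<beta>_def \<rho>_def R_def algebra_simps)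
      from arg_cong[OF this, of "\<lambda>v. v $ a"]
      show "(U w x - Mean P (\<lambda>w. U w x)) $ a $ i = t * \<beta> i w x $ a + \<rho> i w x $ a" by (simp add: column_def)
      have "column i (A w x - Mean P (\<lambda>w. A w x)) = \<beta> i w x"
        using column_Mean[OF x(2), of i] by (simp add: column_linear \<alpha>_def \<beta>_def)
      from arg_cong[OF this, of "\<lambda>v. v $ a"]
      show "(A w x - Mean P (\<lambda>w. A w x)) $ a $ i = \<beta> i w x $ a" by (simp add: column_def)
    qed
    note X = cen[OF Ux Ax] and Y = cen[OF Uy Ay]
    have int: "integrable P (\<lambda>w. f w $ a * g w $ b)"
      if "sq_integrable P f" "sq_integrable P g" for f g :: "'w \<Rightarrow> real^3" and a b
      using sq_integrable_inner[OF sq_integrable_vec_nth[OF that(1), of a] sq_integrable_vec_nth[OF that(2), of b]] by simp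
    have "\<Delta> i j x y $ a $ b = correlation_kernel P (\<rho> i) (\<sigma> j) x y $ a $ b + correlation_kernel P (\<tau> i) (\<rho> j) x y $ a $ b" for a b
    proof -
      note ints = int[OF X(1) Y(1), of i a j b] int[OF X(1) Y(2), of i a j b]
        int[OF X(2) Y(1), of i a j b] int[OF X(2) Y(2), of i a j b]
      have "\<Delta> i j x y $ a $ b = Cov P (\<lambda>w. U w x) (\<lambda>w. U w y) $ a $ i $ b $ j
          - t\<^sup>2 * Cov P (\<lambda>w. A w x) (\<lambda>w. A w y) $ a $ i $ b $ j"
        by (simp add: \<Delta>_def block_def field_Cov_def)
      also have "\<dots> = (\<integral>w. (t * \<beta> i w x $ a + \<rho> i w x $ a) * (t * \<beta> j w y $ b + \<rho> j w y $ b) \<partial>P)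
          - t\<^sup>2 * (\<integral>w. \<beta> i w x $ a * \<beta> j w y $ b \<partial>P)"
        unfolding Cov_entry[OF P Ux Uy] Cov_entry[OF P Ax Ay] X(3,4) Y(3,4) by (rule refl)
      also have "\<dots> = (\<integral>w. \<rho> i w x $ a * (t * \<beta> j w y $ b + \<rho> j w y $ b) \<partial>P) + (\<integral>w. (t * \<beta> i w x $ a) * \<rho> j w y $ b \<partial>P)"
        by (rule integral_product_expansion[OF ints])
      finally show ?thesis by (simp add: correlation_kernel_def \<sigma>_def \<tau>_def)
    qed
    then show ?case by (simp add: vec_eq_iff x_def y_def)
  qed
  have c: "0 \<le> 2 * (K * t\<^sup>2)" "0 \<le> 4 * K * \<bar>t\<bar>" "0 \<le> 2 * K * \<bar>t\<bar>" using K by auto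
  note fin = correlation_kernel_sum_Hcurl2[OF P D \<rho>[of i] \<rho>b c(1) \<sigma>[of j] \<sigma>b c(2) \<tau>[of i] \<tau>b c(3) \<rho>[of j] \<rho>b c(1) eq meas]
  show "\<Delta> i j \<in> Hcurl2 D" by (rule fin(1))
  have "Hcurl2_norm D (\<Delta> i j) \<le> 26 * (2 * (K * t\<^sup>2) * (4 * K * \<bar>t\<bar>) + 2 * K * \<bar>t\<bar> * (2 * (K * t\<^sup>2)))"
    by (rule fin(2))
  \<comment> \<open>The factor is \<open>312 = 26 * (8 + 4)\<close>.\<close>
  also have "\<dots> = 312 * K\<^sup>2 * \<bar>t\<bar> ^ 3"
    by (simp add: power2_eq_square power3_eq_cube abs_mult[symmetric])
  finally show "Hcurl2_norm D (\<Delta> i j) \<le> 312 * K\<^sup>2 * \<bar>t\<bar> ^ 3" .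
qed

end

theorem lemma3:
  fixes D :: "(real^3) set"
    and M :: enat
    and G :: "real \<Rightarrow> (nat \<Rightarrow> real) \<Rightarrow> real^3 \<Rightarrow> real^3"
    and dG :: "(nat \<Rightarrow> real) \<Rightarrow> real^3 \<Rightarrow> real^3"
    and P :: "'w measure"
    and z :: "'w \<Rightarrow> nat \<Rightarrow> real"
    and l0 :: real
    and E0 :: "real^3 \<Rightarrow> real^'m^3"
    and E :: "real \<Rightarrow> (nat \<Rightarrow> real) \<Rightarrow> real^3 \<Rightarrow> real^'m^3"
    and L :: "real \<Rightarrow> (nat \<Rightarrow> real) \<Rightarrow> real^'m^'m"
    and dE :: "(nat \<Rightarrow> real) \<Rightarrow> real^3 \<Rightarrow> real^'m^3"
    and dL :: "(nat \<Rightarrow> real) \<Rightarrow> real^'m^'m"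
  assumes domain: "lipschitz_domain D" "bounded D"
    and deformation: "deformation D M G"
    and prob: "prob_space P"
    and z_rv: "z \<in> measurable P (Pi\<^sub>M UNIV (\<lambda>_. borel))" "\<And>w. w \<in> space P \<Longrightarrow> z w \<in> cube M"
    and eigenbasis: "orthonormal_eigenbasis D identity_coeffs l0 E0"
    and dG: "\<And>y x. y \<in> cube M \<Longrightarrow> x \<in> D \<Longrightarrow>
               ((\<lambda>t. G t y x) has_vector_derivative dG y x) (at 0)"
    and dG_linear: "linear_param_field D M dG"
    and z_centered: "\<And>i. (\<integral>w. z w i \<partial>P) = 0"
    and Cov_Jacobian: "\<And>t. field_Cov_exists P D (\<lambda>w x. jacobian (G t (z w)) (at x))"
    and trajectory: "analytic_trajectory D M G E0 l0 E L"
    and dE: "\<And>y. y \<in> cube M \<Longrightarrow> has_Hcurl_derivative_at_0 D (\<lambda>t. E t y) (dE y)"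
    and dL: "\<And>y. y \<in> cube M \<Longrightarrow> ((\<lambda>t. L t y) has_vector_derivative dL y) (at 0)"
    and E_random: "\<forall>\<^sub>F t in nhds 0. random_Hcurl_field P D (\<lambda>w. E t (z w))"
    and dE_random: "random_Hcurl_field P D (\<lambda>w. dE (z w))"
    and L_random: "\<forall>\<^sub>F t in nhds 0. (\<lambda>w. L t (z w)) \<in> borel_measurable P"
  shows
    "((\<forall>\<^sub>F t in at 0. Cov_exists P (\<lambda>w. L t (z w)) (\<lambda>w. L t (z w)) \<and>
                     field_Cov_exists P D (\<lambda>w. E t (z w))) \<and>
      Cov_exists P (\<lambda>w. dL (z w)) (\<lambda>w. dL (z w)) \<and> field_Cov_exists P D (\<lambda>w. dE (z w))) \<and>
     (\<lambda>t. norm (Mean P (\<lambda>w. L t (z w)) - l0 *\<^sub>R mat 1)) \<in> O[at 0](\<lambda>t. t^2) \<and>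
     (\<forall>i. (\<forall>\<^sub>F t in at 0. (\<lambda>x. column i (Mean P (\<lambda>w. E t (z w) x) - E0 x)) \<in> Hcurl D) \<and>
          (\<lambda>t. Hcurl_norm D (\<lambda>x. column i (Mean P (\<lambda>w. E t (z w) x) - E0 x)))
            \<in> O[at 0](\<lambda>t. t^2)) \<and>
     (\<lambda>t. norm (Cov P (\<lambda>w. L t (z w)) (\<lambda>w. L t (z w))
                - t^2 *\<^sub>R Cov P (\<lambda>w. dL (z w)) (\<lambda>w. dL (z w)))) \<in> O[at 0](\<lambda>t. t^3) \<and>
     (\<forall>i j. (\<forall>\<^sub>F t in at 0.
               (\<lambda>x y. block i j (field_Cov P (\<lambda>w. E t (z w)) x y
                                 - t^2 *\<^sub>R field_Cov P (\<lambda>w. dE (z w)) x y)) \<in> Hcurl2 D) \<and>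
            (\<lambda>t. Hcurl2_norm D
               (\<lambda>x y. block i j (field_Cov P (\<lambda>w. E t (z w)) x y
                                 - t^2 *\<^sub>R field_Cov P (\<lambda>w. dE (z w)) x y))) \<in> O[at 0](\<lambda>t. t^3))"
proof -
  from domain have D: "open D" "bounded D" "D \<noteq> {}" by (auto simp: lipschitz_domain_def)
  note D' = D(1,2)
  have E0: "E0 \<in> col_Hcurl D i" for i
    using eigenbasis by (auto simp: orthonormal_eigenbasis_def maxwell_eigenspace_def col_Hcurl_def Hcurl0_def)
  obtain e K F1 L1 where e: "e > 0" and K: "K > 0"
    and dEH: "\<And>y i. y \<in> cube M \<Longrightarrow> dE y \<in> col_Hcurl D i"
    and ER: "\<And>t y i. \<bar>t\<bar> < e \<Longrightarrow> y \<in> cube M \<Longrightarrow> col_norm D i (\<lambda>x. E t y x - E0 x - t *\<^sub>R dE y x) \<le> K * t\<^sup>2"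
    and LR: "\<And>t y. \<bar>t\<bar> < e \<Longrightarrow> y \<in> cube M \<Longrightarrow> norm (L t y - l0 *\<^sub>R mat 1 - t *\<^sub>R dL y) \<le> K * t\<^sup>2"
    and dEb: "\<And>y i. y \<in> cube M \<Longrightarrow> col_norm D i (dE y) \<le> K"
    and dLb: "\<And>y. y \<in> cube M \<Longrightarrow> norm (dL y) \<le> K"
    and hcp: "\<And>y. y \<in> cube M \<Longrightarrow> coeff_deriv D (dG y) \<in> coeff_perturbations D"
    and dEF1: "\<And>y i. y \<in> cube M \<Longrightarrow> col_norm D i (\<lambda>x. dE y x - F1 (coeff_deriv D (dG y)) x) = 0"
    and dLL1: "\<And>y. y \<in> cube M \<Longrightarrow> dL y = L1 (coeff_deriv D (dG y))"
    and lin: "bounded_linear_coeff_maps D K F1 L1"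
    and diff: "\<And>y x. y \<in> cube M \<Longrightarrow> x \<in> D \<Longrightarrow> dG y differentiable (at x)"
    and hb: "\<And>y. y \<in> cube M \<Longrightarrow> sup_norm D (coeff_deriv D (dG y)) \<le> K"
    by (rule trajectory_first_order[OF D deformation dG E0 trajectory dE dL]) (assumption | rule that)+
  obtain e' where e': "e' > 0"
    and Er: "\<And>t. \<bar>t\<bar> < e' \<Longrightarrow> random_Hcurl_field P D (\<lambda>w. E t (z w))"
    and Lm: "\<And>t. \<bar>t\<bar> < e' \<Longrightarrow> (\<lambda>w. L t (z w)) \<in> borel_measurable P"
    using eventually_nhds_0D[OF eventually_conj[OF E_random L_random]] by blast
  define \<epsilon> where "\<epsilon> = min (min e e') 1"
  have \<epsilon>: "0 < \<epsilon>" "\<epsilon> \<le> e" "\<epsilon> \<le> e'" "\<epsilon> \<le> 1" using e e' by (auto simp: \<epsilon>_def)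

  \<comment> \<open>Measurability of \<open>dL\<close> is inherited from the difference quotients at times below \<open>e'\<close>.\<close>
  have dLm: "(\<lambda>w. dL (z w)) \<in> borel_measurable P"
  proof (rule borel_measurable_LIMSEQ_metric)
    define \<tau> where "\<tau> n = \<epsilon> / real (n + 2)" for n
    have \<tau>: "\<tau> n > 0" "\<bar>\<tau> n\<bar> < e'" for n
    proof -
      show "\<tau> n > 0" using \<epsilon> by (simp add: \<tau>_def)
      moreover have "\<tau> n < \<epsilon>" using \<epsilon> by (simp add: \<tau>_def field_simps add_pos_nonneg)
      ultimately show "\<bar>\<tau> n\<bar> < e'" using \<epsilon> by simp
    qed
    have "(\<lambda>n. 1 / real (n + 2)) \<longlonglongrightarrow> 0"
      using LIMSEQ_ignore_initial_segment[OF lim_1_over_n[where 'a=real], of 2] by simp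
    from tendsto_mult_left[OF this, of \<epsilon>] have "\<tau> \<longlonglongrightarrow> 0" by (simp add: \<tau>_def[abs_def])
    then have lim: "filterlim \<tau> (at 0) sequentially"
      using \<tau>(1) by (auto simp: filterlim_at intro!: always_eventually) (metis less_irrefl)
    show "(\<lambda>w. (1 / \<tau> n) *\<^sub>R (L (\<tau> n) (z w) - L 0 (z w))) \<in> borel_measurable P" for n
      using Lm[OF \<tau>(2)[of n]] Lm[of 0] e' by simp
    show "(\<lambda>n. (1 / \<tau> n) *\<^sub>R (L (\<tau> n) (z w) - L 0 (z w))) \<longlonglongrightarrow> dL (z w)" if "w \<in> space P" for w
      using filterlim_compose[OF difference_quotient_tendsto[OF dL[OF z_rv(2)[OF that]]] lim] .
  qed
  have dL0: "(\<integral>w. dL (z w) \<partial>P) = 0"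
  proof -
    have eq: "dL (z w) = L1 (coeff_deriv D (dG (z w)))" if "w \<in> space P" for w
      using dLL1[OF z_rv(2)[OF that]] .
    have "(\<integral>w. dL (z w) \<partial>P) = (\<integral>w. L1 (coeff_deriv D (dG (z w))) \<partial>P)"
      by (rule Bochner_Integration.integral_cong) (simp_all add: eq)
    also have "\<dots> = 0"
    proof (rule mean_zero_coeff_functional[OF D(1,3) prob z_rv z_centered dG_linear diff hcp hb
        bounded_linear_coeff_mapsD(5)[OF lin] bounded_linear_coeff_mapsD(3)[OF lin]])
      show "(\<lambda>w. L1 (coeff_deriv D (dG (z w)))) \<in> borel_measurable P"
        using dLm by (subst measurable_cong[OF eq[symmetric]])
    qed (assumption | use K in simp)+
    finally show ?thesis .
  qed
  have dEc: "\<exists>v. random_curl P D (\<lambda>w x. column i (dE (z w) x)) v" for i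
    by (rule random_Hcurl_field_column[OF dE_random]) (rule exI)
  have dE2: "random_L2 P D K (\<lambda>w x. column i (dE (z w) x))" for i
  proof -
    obtain v where v: "random_curl P D (\<lambda>w x. column i (dE (z w) x)) v" using dEc by blast
    show ?thesis
      by (rule random_curl_L2(1)[OF prob D' v]) (use dEb[OF z_rv(2)] in \<open>simp add: col_norm_def\<close>)
  qed
  have dE0: "AE x in lebesgue_on D. (\<integral>w. column i (dE (z w) x) \<partial>P) = 0" for i
  proof (rule mean_zero_field[OF D prob z_rv z_centered dG_linear diff hcp hb lin _ dE2])
    show "0 \<le> K" using K by simp
    show "dE (z w) \<in> col_Hcurl D i" "col_norm D i (\<lambda>x. dE (z w) x - F1 (coeff_deriv D (dG (z w))) x) = 0"
      if "w \<in> space P" for w using dEH[OF z_rv(2)[OF that]] dEF1[OF z_rv(2)[OF that]] .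
  qed

  obtain C where C: "C > 0" "\<And>B B'. norm (tensor (B :: real^'m^'m) (B' :: real^'m^'m)) \<le> norm B * norm B' * C"
    using bounded_bilinear.pos_bounded[OF bounded_bilinear_tensor] by blast
  have Lexp: "Cov_exists P (\<lambda>w. L t (z w)) (\<lambda>w. L t (z w))" "Cov_exists P (\<lambda>w. dL (z w)) (\<lambda>w. dL (z w))"
    "norm (Cov P (\<lambda>w. L t (z w)) (\<lambda>w. L t (z w)) - t\<^sup>2 *\<^sub>R Cov P (\<lambda>w. dL (z w)) (\<lambda>w. dL (z w))) \<le> 12 * C * K\<^sup>2 * \<bar>t\<bar> ^ 3"
    "norm (Mean P (\<lambda>w. L t (z w)) - l0 *\<^sub>R mat 1) \<le> K * t\<^sup>2" if t: "\<bar>t\<bar> < \<epsilon>" for t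
  proof -
    have t': "\<bar>t\<bar> < e" "\<bar>t\<bar> < e'" "\<bar>t\<bar> \<le> 1" using t \<epsilon> by auto
    have R: "norm (L t (z w) - l0 *\<^sub>R mat 1 - t *\<^sub>R dL (z w)) \<le> K * t\<^sup>2" "norm (dL (z w)) \<le> K"
      if "w \<in> space P" for w using LR[OF t'(1) z_rv(2)[OF that]] dLb[OF z_rv(2)[OF that]] by auto
    have K0: "0 \<le> K" "0 \<le> C" using K C by auto
    show "Cov_exists P (\<lambda>w. L t (z w)) (\<lambda>w. L t (z w))" "Cov_exists P (\<lambda>w. dL (z w)) (\<lambda>w. dL (z w))"
      "norm (Cov P (\<lambda>w. L t (z w)) (\<lambda>w. L t (z w)) - t\<^sup>2 *\<^sub>R Cov P (\<lambda>w. dL (z w)) (\<lambda>w. dL (z w))) \<le> 12 * C * K\<^sup>2 * \<bar>t\<bar> ^ 3"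
      by (rule Cov_expansion[OF prob Lm[OF t'(2)] dLm R K0(1) t'(3) C(2) K0(2)], assumption+)+
    show "norm (Mean P (\<lambda>w. L t (z w)) - l0 *\<^sub>R mat 1) \<le> K * t\<^sup>2"
      by (rule Cov_expansion(4)[OF prob Lm[OF t'(2)] dLm R K0(1) t'(3) C(2) K0(2) dL0], assumption+)
  qed
  have Eexp: "field_Cov_exists P D (\<lambda>w. E t (z w))" "field_Cov_exists P D (\<lambda>w. dE (z w))"
    "(\<lambda>x y. block i j (field_Cov P (\<lambda>w. E t (z w)) x y - t\<^sup>2 *\<^sub>R field_Cov P (\<lambda>w. dE (z w)) x y)) \<in> Hcurl2 D"
    "Hcurl2_norm D (\<lambda>x y. block i j (field_Cov P (\<lambda>w. E t (z w)) x y - t\<^sup>2 *\<^sub>R field_Cov P (\<lambda>w. dE (z w)) x y))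
      \<le> 312 * K\<^sup>2 * \<bar>t\<bar> ^ 3"
    "(\<lambda>x. column i (Mean P (\<lambda>w. E t (z w) x) - E0 x)) \<in> Hcurl D \<and>
     Hcurl_norm D (\<lambda>x. column i (Mean P (\<lambda>w. E t (z w) x) - E0 x)) \<le> K * t\<^sup>2" if t: "\<bar>t\<bar> < \<epsilon>" for t i j
  proof -
    have t': "\<bar>t\<bar> < e" "\<bar>t\<bar> < e'" "\<bar>t\<bar> \<le> 1" using t \<epsilon> by auto
    have R: "col_norm D i (\<lambda>x. E t (z w) x - E0 x - t *\<^sub>R dE (z w) x) \<le> K * t\<^sup>2" "col_norm D i (dE (z w)) \<le> K"
      if "w \<in> space P" for w i using ER[OF t'(1) z_rv(2)[OF that]] dEb[OF z_rv(2)[OF that]] by auto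
    have K0: "0 \<le> K" using K by simp
    show "field_Cov_exists P D (\<lambda>w. E t (z w))" "field_Cov_exists P D (\<lambda>w. dE (z w))"
      "(\<lambda>x y. block i j (field_Cov P (\<lambda>w. E t (z w)) x y - t\<^sup>2 *\<^sub>R field_Cov P (\<lambda>w. dE (z w)) x y)) \<in> Hcurl2 D"
      "Hcurl2_norm D (\<lambda>x y. block i j (field_Cov P (\<lambda>w. E t (z w)) x y - t\<^sup>2 *\<^sub>R field_Cov P (\<lambda>w. dE (z w)) x y))
        \<le> 312 * K\<^sup>2 * \<bar>t\<bar> ^ 3"
      by (rule field_Cov_expansion[OF prob D' Er[OF t'(2)] dE_random E0 R K0 t'(3)], assumption+)+
    show "(\<lambda>x. column i (Mean P (\<lambda>w. E t (z w) x) - E0 x)) \<in> Hcurl D \<and>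
     Hcurl_norm D (\<lambda>x. column i (Mean P (\<lambda>w. E t (z w) x) - E0 x)) \<le> K * t\<^sup>2"
      by (rule field_Cov_expansion(5)[OF prob D' Er[OF t'(2)] dE_random E0 R K0 t'(3) dE0], assumption+)
  qed

  have ev: "\<forall>\<^sub>F t in at 0. Q t" if "\<And>t. \<bar>t\<bar> < \<epsilon> \<Longrightarrow> Q t" for Q :: "real \<Rightarrow> bool"
    unfolding eventually_at using \<epsilon>(1) that by (intro exI[of _ \<epsilon>]) (auto simp: dist_norm)
  have z0: "\<bar>0\<bar> < \<epsilon>" using \<epsilon> by simp
  have Hcurl2_nn: "0 \<le> Hcurl2_norm D k" for k
    unfolding Hcurl2_norm_def L2_sq2_def
    by (intro real_sqrt_ge_zero add_nonneg_nonneg Bochner_Integration.integral_nonneg) auto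
  show ?thesis
  proof (intro conjI allI)
    show "\<forall>\<^sub>F t in at 0. Cov_exists P (\<lambda>w. L t (z w)) (\<lambda>w. L t (z w)) \<and> field_Cov_exists P D (\<lambda>w. E t (z w))"
      by (rule ev) (intro conjI Lexp(1) Eexp(1))
    show "Cov_exists P (\<lambda>w. dL (z w)) (\<lambda>w. dL (z w))" by (rule Lexp(2)[OF z0])
    show "field_Cov_exists P D (\<lambda>w. dE (z w))" by (rule Eexp(2)[OF z0])
    show "(\<lambda>t. norm (Mean P (\<lambda>w. L t (z w)) - l0 *\<^sub>R mat 1)) \<in> O[at 0](\<lambda>t. t^2)"
      by (rule bigoI[of _ K], rule ev) (use Lexp(4) in simp)
    show "(\<lambda>t. norm (Cov P (\<lambda>w. L t (z w)) (\<lambda>w. L t (z w)) - t^2 *\<^sub>R Cov P (\<lambda>w. dL (z w)) (\<lambda>w. dL (z w))))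
        \<in> O[at 0](\<lambda>t. t^3)"
      by (rule bigoI[of _ "12 * C * K\<^sup>2"], rule ev) (use Lexp(3) in \<open>simp add: power_abs\<close>)
    fix i j
    show "\<forall>\<^sub>F t in at 0. (\<lambda>x. column i (Mean P (\<lambda>w. E t (z w) x) - E0 x)) \<in> Hcurl D"
      by (rule ev) (use Eexp(5) in blast)
    show "(\<lambda>t. Hcurl_norm D (\<lambda>x. column i (Mean P (\<lambda>w. E t (z w) x) - E0 x))) \<in> O[at 0](\<lambda>t. t^2)"
      by (rule bigoI[of _ K], rule ev) (use Eexp(5) Hcurl_norm_nonneg in simp)
    show "\<forall>\<^sub>F t in at 0. (\<lambda>x y. block i j (field_Cov P (\<lambda>w. E t (z w)) x y
        - t^2 *\<^sub>R field_Cov P (\<lambda>w. dE (z w)) x y)) \<in> Hcurl2 D"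
      by (rule ev) (rule Eexp(3))
    show "(\<lambda>t. Hcurl2_norm D (\<lambda>x y. block i j (field_Cov P (\<lambda>w. E t (z w)) x y
        - t^2 *\<^sub>R field_Cov P (\<lambda>w. dE (z w)) x y))) \<in> O[at 0](\<lambda>t. t^3)"
      by (rule bigoI[of _ "312 * K\<^sup>2"], rule ev) (use Eexp(4) Hcurl2_nn in \<open>simp add: power_abs\<close>)
  qed
qed

end
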